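(* Let $u$ be the weak solution of the Euler–Bernoulli problem described in the context, whose inputs satisfy the basic conditions listed there, and assume in addition that $r\in H^2(0,\ell)$ and that the damping constant of proportionality is positive, $\gamma>0$. Let $$\mathcal{E}(t)=\frac12\int_0^\ell\left[m(x)u_t^2(x,t)+r(x)u_{xx}^2(x,t)\right]dx+\frac12 k_r^-u_x^2(0,t)+\frac12k_r^+u_x^2(\ell,t)$$ be the total energy, with initial value $$\mathcal{E}(0)=\frac12\int_0^\ell\left[m(x)(u_1(x))^2+r(x)(u_0''(x))^2\right]dx+\frac12k_r^-(u_0'(0))^2+\frac12k_r^+(u_0'(\ell))^2>0,$$ and put $$\beta_0=\frac{\ell^2}{2}\sqrt{\frac{m_1}{r_0}},\qquad \beta_1=\beta_0\left\{1+\frac{1}{\sqrt{m_1r_0}}\left[\ell^2\mu_1+\frac{2}{\ell}\left(k_a^-+k_a^+\right)\right]\right\}.$$ Then the system is exponentially stable in the following sense: for every $\lambda$ with $$0<\lambda<\min\left(\frac{1}{\beta_0},\ \frac{\gamma\,m_0}{2m_1}\right)$$ one has $$\mathcal{E}(t)\le M e^{-\sigma t}\,\mathcal{E}(0),\quad t\in[0,T],\qquad\text{where}\quad M=\frac{1+\beta_1\lambda}{1-\beta_0\lambda},\quad \sigma=\frac{2\lambda}{1+\beta_1\lambda}.$$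
   Context: Problem. Let $\ell>0$, $T>0$. Consider $$m(x)u_{tt}+\mu(x)u_t+(r(x)u_{xx})_{xx}=0,\quad (x,t)\in(0,\ell)\times(0,T),$$ $$u(x,0)=u_0(x),\quad u_t(x,0)=u_1(x),\quad x\in(0,\ell),$$ $$u(0,t)=0,\quad (-r(x)u_{xx}(x,t))_{x=0}=-k_r^-u_x(0,t)-k_a^-u_{xt}(0,t),$$ $$u(\ell,t)=0,\quad (-r(x)u_{xx}(x,t))_{x=\ell}=k_r^+u_x(\ell,t)+k_a^+u_{xt}(\ell,t),\quad t\in[0,T].$$ Here $\mu(x)=\gamma\,m(x)$ with a constant $\gamma\ge0$ (the damping constant of proportionality). Basic conditions: $m,\mu,r\in L^\infty(0,\ell)$; there are constants with $0<m_0\le m(x)\le m_1$, $0\le\mu_0\le\mu(x)\le\mu_1$, $0<r_0\le r(x)\le r_1$ for $x\in(0,\ell)$; $u_0\in H^2(0,\ell)$, $u_1\in L^2(0,\ell)$; $k_r^-,k_a^-,k_r^+,k_a^+\ge0$; and $\gamma+k_r^-+k_a^-+k_r^++k_a^+>0$. Weak solution: let $\mathcal{V}^2(0,\ell)=\{v\in H^2(0,\ell): v(0)=v(\ell)=0\}$. A weak solution is a function $u\in L^2(0,T;\mathcal{V}^2(0,\ell))$ with $u_t\in L^2(0,T;L^2(0,\ell))$, $u_{tt}\in L^2(0,T;H^{-2}(0,\ell))$, $u(\cdot,0)=u_0$, such that for every $v\in\mathcal{V}^2(0,\ell)$ and a.e. $t\in(0,T)$ $$\int_0^\ell (m u_t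 v+\mu u v)\,dx+k_a^-u_x(0,t)v'(0)+k_a^+u_x(\ell,t)v'(\ell)+\int_0^t\Big[\int_0^\ell r u_{xx}v''\,dx+k_r^-u_x(0,\tau)v'(0)+k_r^+u_x(\ell,\tau)v'(\ell)\Big]d\tau$$ $$=\int_0^\ell (m u_1 v+\mu u_0 v)\,dx+k_a^-u_0'(0)v'(0)+k_a^+u_0'(\ell)v'(\ell).$$ As usual, $u$ is identified with its representative with $u\in C([0,T];\mathcal{V}^2(0,\ell))$, $u_t\in C([0,T];L^2(0,\ell))$, so that pointwise-in-$t$ expressions make sense. *)

theory Defs
  imports "HOL-Analysis.Analysis"
begin

section \<open>Sobolev spaces on a bounded interval\<close>

text \<open>
  Elements of the spaces below are ordinary functions standing for their a.e.-classes on the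
  open interval: no notion in this theory depends on the choice of the representative.
  The values of the functions outside the interval are irrelevant.
\<close>

definition test_functions :: "real \<Rightarrow> real \<Rightarrow> (real \<Rightarrow> real) set" where
  "test_functions a b =
     {\<phi>. (\<forall>k. (deriv ^^ k) \<phi> differentiable_on UNIV) \<and> closure {x. \<phi> x \<noteq> 0} \<subseteq> {a<..<b}}"

definition has_weak_deriv ::
    "real \<Rightarrow> real \<Rightarrow> nat \<Rightarrow> (real \<Rightarrow> real) \<Rightarrow> (real \<Rightarrow> real) \<Rightarrow> bool" where
  "has_weak_deriv a b k f g \<longleftrightarrow>
     (\<forall>c d. a < c \<and> d < b \<longrightarrow>
        integrable (lebesgue_on {c..d}) f \<and> integrable (lebesgue_on {c..d}) g) \<and>
     (\<forall>\<phi>\<in>test_functions a b.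
        (LINT x|lebesgue_on {a<..<b}. f x * (deriv ^^ k) \<phi> x)
          = (-1) ^ k * (LINT x|lebesgue_on {a<..<b}. g x * \<phi> x))"

text \<open>A weak derivative is unique up to null sets, so the choice is immaterial.\<close>

definition wderiv :: "real \<Rightarrow> real \<Rightarrow> nat \<Rightarrow> (real \<Rightarrow> real) \<Rightarrow> real \<Rightarrow> real" where
  "wderiv a b k f = (SOME g. has_weak_deriv a b k f g)"

definition L_infty :: "real \<Rightarrow> real \<Rightarrow> (real \<Rightarrow> real) set" where
  "L_infty a b = {f. f \<in> borel_measurable (lebesgue_on {a<..<b}) \<and>
                     (\<exists>C. AE x in lebesgue_on {a<..<b}. \<bar>f x\<bar> \<le> C)}"

definition L2 :: "real \<Rightarrow> real \<Rightarrow> (real \<Rightarrow> real) set" where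
  "L2 a b = {f. f \<in> borel_measurable (lebesgue_on {a<..<b}) \<and>
                integrable (lebesgue_on {a<..<b}) (\<lambda>x. (f x)\<^sup>2)}"

definition L2_inner :: "real \<Rightarrow> real \<Rightarrow> (real \<Rightarrow> real) \<Rightarrow> (real \<Rightarrow> real) \<Rightarrow> real" where
  "L2_inner a b f g = (LINT x|lebesgue_on {a<..<b}. f x * g x)"

definition L2_norm :: "real \<Rightarrow> real \<Rightarrow> (real \<Rightarrow> real) \<Rightarrow> real" where
  "L2_norm a b f = sqrt (L2_inner a b f f)"

definition H2 :: "real \<Rightarrow> real \<Rightarrow> (real \<Rightarrow> real) set" where
  "H2 a b = {f \<in> L2 a b. \<forall>k\<in>{1,2}. \<exists>g\<in>L2 a b. has_weak_deriv a b k f g}"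

definition H2_norm :: "real \<Rightarrow> real \<Rightarrow> (real \<Rightarrow> real) \<Rightarrow> real" where
  "H2_norm a b f =
     sqrt ((L2_norm a b f)\<^sup>2 + (L2_norm a b (wderiv a b 1 f))\<^sup>2 + (L2_norm a b (wderiv a b 2 f))\<^sup>2)"

text \<open>
  Boundary values are those of the representative that is continuous on the closed interval.
  By the one-dimensional Sobolev embedding it exists for a function in \<open>H2\<close> and for its first
  weak derivative, and for \<open>a < b\<close> it is unique on \<open>{a..b}\<close>.
\<close>

definition trace :: "real \<Rightarrow> real \<Rightarrow> (real \<Rightarrow> real) \<Rightarrow> real \<Rightarrow> real" where
  "trace a b f =
     (SOME g. continuous_on {a..b} g \<and> (AE x in lebesgue_on {a<..<b}. f x = g x))"

definition V2 :: "real \<Rightarrow> real \<Rightarrow> (real \<Rightarrow> real) set" where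
  "V2 a b = {v \<in> H2 a b. trace a b v a = 0 \<and> trace a b v b = 0}"

definition H2_0 :: "real \<Rightarrow> real \<Rightarrow> (real \<Rightarrow> real) set" where
  "H2_0 a b = {v \<in> H2 a b. \<exists>\<phi>. (\<forall>n::nat. \<phi> n \<in> test_functions a b) \<and>
                               (\<lambda>n. H2_norm a b (\<phi> n - v)) \<longlonglongrightarrow> 0}"

text \<open>The dual space of \<open>H2_0\<close>; the values of a functional outside \<open>H2_0\<close> are irrelevant.\<close>

definition H_minus2 :: "real \<Rightarrow> real \<Rightarrow> ((real \<Rightarrow> real) \<Rightarrow> real) set" where
  "H_minus2 a b =
     {F. (\<forall>v\<in>H2_0 a b. \<forall>w\<in>H2_0 a b. F (\<lambda>x. v x + w x) = F v + F w) \<and>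
         (\<forall>c. \<forall>v\<in>H2_0 a b. F (\<lambda>x. c * v x) = c * F v) \<and>
         (\<exists>C. \<forall>v\<in>H2_0 a b. \<bar>F v\<bar> \<le> C * H2_norm a b v)}"

definition H_minus2_norm :: "real \<Rightarrow> real \<Rightarrow> ((real \<Rightarrow> real) \<Rightarrow> real) \<Rightarrow> real" where
  "H_minus2_norm a b F = (SUP v\<in>{v \<in> H2_0 a b. H2_norm a b v \<le> 1}. \<bar>F v\<bar>)"


section \<open>Functions of time with values in a function space\<close>

text \<open>
  \<open>X\<close> is a set of functions with norm \<open>N\<close>.  Membership in \<open>L\<^sup>2(0,T;X)\<close> means strong measurability
  (a.e. limit of simple functions) together with square integrability of the norm.
\<close>

definition bochner_L2 :: "real \<Rightarrow> 'a::minus set \<Rightarrow> ('a \<Rightarrow> real) \<Rightarrow> (real \<Rightarrow> 'a) set" where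
  "bochner_L2 T X N =
     {f. (AE t in lebesgue_on {0<..<T}. f t \<in> X) \<and>
         (\<exists>s. (\<forall>n::nat. simple_function (lebesgue_on {0<..<T}) (s n) \<and> (\<forall>t\<in>{0<..<T}. s n t \<in> X)) \<and>
              (AE t in lebesgue_on {0<..<T}. (\<lambda>n. N (s n t - f t)) \<longlonglongrightarrow> 0)) \<and>
         integrable (lebesgue_on {0<..<T}) (\<lambda>t. (N (f t))\<^sup>2)}"

definition cont_in_time :: "real \<Rightarrow> 'a::minus set \<Rightarrow> ('a \<Rightarrow> real) \<Rightarrow> (real \<Rightarrow> 'a) set" where
  "cont_in_time T X N =
     {f. \<forall>t\<in>{0..T}. f t \<in> X \<and> ((\<lambda>s. N (f s - f t)) \<longlongrightarrow> 0) (at t within {0..T})}"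

text \<open>
  Time derivatives are in the sense of vector-valued distributions on \<open>(0,T)\<close>, tested against
  the elements \<open>w\<close> of \<open>W\<close>; \<open>F t w\<close> is the pairing of the value at time \<open>t\<close> with \<open>w\<close>.
\<close>

definition has_time_deriv ::
    "real \<Rightarrow> 'b set \<Rightarrow> (real \<Rightarrow> 'b \<Rightarrow> real) \<Rightarrow> (real \<Rightarrow> 'b \<Rightarrow> real) \<Rightarrow> bool" where
  "has_time_deriv T W F G \<longleftrightarrow> (\<forall>w\<in>W. has_weak_deriv 0 T 1 (\<lambda>t. F t w) (\<lambda>t. G t w))"


section \<open>The damped Euler--Bernoulli beam\<close>

text \<open>
  The state at time \<open>t\<close> is the function \<open>u t\<close> of the space variable, and \<open>ut\<close> is the time
  derivative of \<open>u\<close>; both are the representatives that are continuous in time.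
  \<open>krm\<close>, \<open>kam\<close>, \<open>krp\<close>, \<open>kap\<close> stand for \<open>k\<^sub>r\<^sup>-\<close>, \<open>k\<^sub>a\<^sup>-\<close>, \<open>k\<^sub>r\<^sup>+\<close>, \<open>k\<^sub>a\<^sup>+\<close>.
\<close>

definition weak_solution ::
    "real \<Rightarrow> real \<Rightarrow> (real \<Rightarrow> real) \<Rightarrow> (real \<Rightarrow> real) \<Rightarrow> (real \<Rightarrow> real) \<Rightarrow>
     real \<Rightarrow> real \<Rightarrow> real \<Rightarrow> real \<Rightarrow> (real \<Rightarrow> real) \<Rightarrow> (real \<Rightarrow> real) \<Rightarrow>
     (real \<Rightarrow> real \<Rightarrow> real) \<Rightarrow> (real \<Rightarrow> real \<Rightarrow> real) \<Rightarrow> bool" where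
  "weak_solution l T m \<mu> r krm kam krp kap u0 u1 u ut \<longleftrightarrow>
     u \<in> bochner_L2 T (V2 0 l) (H2_norm 0 l) \<and>
     ut \<in> bochner_L2 T (L2 0 l) (L2_norm 0 l) \<and>
     has_time_deriv T (L2 0 l) (\<lambda>t. L2_inner 0 l (u t)) (\<lambda>t. L2_inner 0 l (ut t)) \<and>
     (\<exists>utt \<in> bochner_L2 T (H_minus2 0 l) (H_minus2_norm 0 l).
        has_time_deriv T (H2_0 0 l) (\<lambda>t. L2_inner 0 l (ut t)) utt) \<and>
     u \<in> cont_in_time T (V2 0 l) (H2_norm 0 l) \<and>
     ut \<in> cont_in_time T (L2 0 l) (L2_norm 0 l) \<and>
     (AE x in lebesgue_on {0<..<l}. u 0 x = u0 x) \<and>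
     (\<forall>v\<in>V2 0 l. AE t in lebesgue_on {0<..<T}.
        (LINT x|lebesgue_on {0<..<l}. m x * ut t x * v x + \<mu> x * u t x * v x)
        + kam * trace 0 l (wderiv 0 l 1 (u t)) 0 * trace 0 l (wderiv 0 l 1 v) 0
        + kap * trace 0 l (wderiv 0 l 1 (u t)) l * trace 0 l (wderiv 0 l 1 v) l
        + (LINT \<tau>|lebesgue_on {0<..<t}.
             (LINT x|lebesgue_on {0<..<l}. r x * wderiv 0 l 2 (u \<tau>) x * wderiv 0 l 2 v x)
             + krm * trace 0 l (wderiv 0 l 1 (u \<tau>)) 0 * trace 0 l (wderiv 0 l 1 v) 0
             + krp * trace 0 l (wderiv 0 l 1 (u \<tau>)) l * trace 0 l (wderiv 0 l 1 v) l)
        = (LINT x|lebesgue_on {0<..<l}. m x * u1 x * v x + \<mu> x * u0 x * v x)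
          + kam * trace 0 l (wderiv 0 l 1 u0) 0 * trace 0 l (wderiv 0 l 1 v) 0
          + kap * trace 0 l (wderiv 0 l 1 u0) l * trace 0 l (wderiv 0 l 1 v) l)"

text \<open>Total energy of the state with displacement \<open>w\<close> and velocity \<open>z\<close>.\<close>

definition energy ::
    "real \<Rightarrow> (real \<Rightarrow> real) \<Rightarrow> (real \<Rightarrow> real) \<Rightarrow> real \<Rightarrow> real \<Rightarrow>
     (real \<Rightarrow> real) \<Rightarrow> (real \<Rightarrow> real) \<Rightarrow> real" where
  "energy l m r krm krp w z =
     1/2 * (LINT x|lebesgue_on {0<..<l}. m x * (z x)\<^sup>2 + r x * (wderiv 0 l 2 w x)\<^sup>2)
     + 1/2 * krm * (trace 0 l (wderiv 0 l 1 w) 0)\<^sup>2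
     + 1/2 * krp * (trace 0 l (wderiv 0 l 1 w) l)\<^sup>2"

end

theory Submission
  imports Defs
begin

text \<open>
  Let \<open>E\<close> be the energy and
  \<open>J = (m u\<^sub>t, u) + 1/2 (\<mu> u, u) + 1/2 (k\<^sub>a\<^sup>- u\<^sub>x(0)\<^sup>2 + k\<^sub>a\<^sup>+ u\<^sub>x(\<ell>)\<^sup>2)\<close>.
  Testing with \<open>u\<close> gives \<open>J' = \<integral> m u\<^sub>t\<^sup>2 - a(u, u)\<close>, where \<open>a\<close> is the stiffness form, and
  testing with \<open>u\<^sub>t\<close> gives \<open>E' \<le> - \<gamma> \<integral> m u\<^sub>t\<^sup>2\<close>, so \<open>L = E + \<lambda> J\<close> satisfies \<open>L' \<le> - 2 \<lambda> E\<close> if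
  \<open>2 \<lambda> \<le> \<gamma>\<close>.  Poincare inequalities give \<open>- \<beta>\<^sub>0 E \<le> J \<le> \<beta>\<^sub>1 E\<close>, and Gronwall's lemma concludes.

  The velocity \<open>u\<^sub>t\<close> is not an admissible test function for a weak solution.  Following Strauss,
  one tests with \<open>u(t+h) - u(t)\<close> instead, integrates over \<open>t\<close>, divides by \<open>h\<^sup>2\<close> and lets \<open>h \<rightarrow> 0\<close>;
  the boundary damping then contributes a term of favourable sign, which is dropped.
\<close>

section \<open>Smooth functions with compact support\<close>

text \<open>None of the quantities compared is known to be differentiable in time: \<open>ut\<close>
  is merely continuous with values in \<open>L2\<close>, and u_xt has no boundary trace for a weak
  solution, so the boundary damping form at u(t) may fail to have a derivative. Every differential
  inequality is therefore stated for increments over [s, t], and monotonicity is deduced from small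
  increments. This works because the solution enters only through scalar functions of two times,
  such as the mass form at ut(s) and u(t); in the increment inequalities the boundary damping enters
  through symmetry and positivity of its form. The constants come from one fact: an element of
  \<open>V2\<close> vanishes at both ends, so by Rolle its derivative has an interior zero.
  Integrating from that zero, and then from 0, bounds the norm of v by l^2 / 2 times that of v''.
  With m \<le> m1 and r \<ge> r0 this becomes \<open>\<beta>0\<close>, and the boundary slopes add
  the term with \<open>kam + kap\<close> in \<open>\<beta>1\<close>. Since m0 \<le> m1, the
  restriction on \<open>lam\<close> yields 2 lam \<le> \<gamma>.\<close>

definition smooth :: "(real \<Rightarrow> real) \<Rightarrow> bool" where
  "smooth f \<longleftrightarrow> (\<forall>k. (deriv ^^ k) f differentiable_on UNIV)"

lemma smooth_deriv: "smooth f \<Longrightarrow> smooth (deriv f)"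
  unfolding smooth_def by (metis funpow_Suc_right o_apply)

lemma smooth_has_deriv:
  assumes "smooth f" shows "(f has_real_derivative deriv f x) (at x)"
proof -
  have "f differentiable (at x)"
    using assms unfolding smooth_def differentiable_on_def
    by (metis UNIV_I funpow_0)
  then show ?thesis
    using DERIV_deriv_iff_real_differentiable by blast
qed

text \<open>A coinduction principle: if every member of \<open>S\<close> has its derivative in
  \<open>S\<close>, then by induction all iterated derivatives stay in \<open>S\<close>, and each is
  differentiable. It replaces formulas for k-th derivatives.\<close>

lemma smooth_closedI:
  assumes "f \<in> S"
    and "\<And>f. f \<in> S \<Longrightarrow> \<exists>f'\<in>S. \<forall>x. (f has_real_derivative f' x) (at x)"
  shows "smooth f"
proof -
  have "(deriv ^^ k) f \<in> S" for k
  proof (induction k)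
    case (Suc k)
    obtain f' where f': "f' \<in> S" "\<forall>x. ((deriv ^^ k) f has_real_derivative f' x) (at x)"
      using assms(2)[OF Suc] by blast
    then have "deriv ((deriv ^^ k) f) = f'"
      by (intro ext DERIV_imp_deriv) auto
    then show ?case using f' by simp
  qed (use assms(1) in simp)
  then show ?thesis
    unfolding smooth_def differentiable_on_def
    using assms(2) by (meson real_differentiable_def)
qed

text \<open>Products alone are not closed under differentiation, because of the sum in the Leibniz
  rule. The algebra generated by the smooth functions is, so \<open>smooth_closedI\<close> applies
  to it.\<close>

inductive_set smooth_alg :: "(real \<Rightarrow> real) set" where
  base: "smooth f \<Longrightarrow> f \<in> smooth_alg"
| add: "f \<in> smooth_alg \<Longrightarrow> g \<in> smooth_alg \<Longrightarrow> (\<lambda>x. f x + g x) \<in> smooth_alg"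
| mult: "f \<in> smooth_alg \<Longrightarrow> g \<in> smooth_alg \<Longrightarrow> (\<lambda>x. f x * g x) \<in> smooth_alg"

lemma smooth_alg_smooth:
  assumes "f \<in> smooth_alg" shows "smooth f"
proof (rule smooth_closedI[OF assms])
  show "\<exists>f'\<in>smooth_alg. \<forall>x. (f has_real_derivative f' x) (at x)" if "f \<in> smooth_alg" for f
    using that
  proof induction
    case (base f)
    then show ?case
      using smooth_deriv smooth_has_deriv smooth_alg.base by blast
  next
    case (add f g)
    then obtain f' g' where
      "f' \<in> smooth_alg" "g' \<in> smooth_alg"
      "\<forall>x. (f has_real_derivative f' x) (at x)" "\<forall>x. (g has_real_derivative g' x) (at x)" by blast
    then show ?case
      by (intro bexI[of _ "\<lambda>x. f' x + g' x"] smooth_alg.add) (auto intro: DERIV_add)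
  next
    case (mult f g)
    then obtain f' g' where *:
      "f' \<in> smooth_alg" "g' \<in> smooth_alg"
      "\<forall>x. (f has_real_derivative f' x) (at x)" "\<forall>x. (g has_real_derivative g' x) (at x)" by blast
    show ?case
      using * mult by (intro bexI[of _ "\<lambda>x. f' x * g x + g' x * f x"] smooth_alg.add smooth_alg.mult)
        (auto intro: DERIV_mult)
  qed
qed

lemma smooth_add: "smooth f \<Longrightarrow> smooth g \<Longrightarrow> smooth (\<lambda>x. f x + g x)"
  and smooth_mult: "smooth f \<Longrightarrow> smooth g \<Longrightarrow> smooth (\<lambda>x. f x * g x)"
  by (auto intro!: smooth_alg_smooth intro: smooth_alg.intros)

lemma smooth_const: "smooth (\<lambda>x. c)"
proof (rule smooth_closedI[of _ "range (\<lambda>c x. c)"])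
  fix f :: "real \<Rightarrow> real" assume "f \<in> range (\<lambda>c x. c)"
  then show "\<exists>f'\<in>range (\<lambda>c x. c). \<forall>x. (f has_real_derivative f' x) (at x)"
    by (intro bexI[of _ "\<lambda>x. 0"]) auto
qed auto

lemma smooth_antideriv:
  assumes "\<And>x. (f has_real_derivative f' x) (at x)" "smooth f'"
  shows "smooth f"
proof (rule smooth_closedI[of _ "insert f {g. smooth g}"])
  fix g assume "g \<in> insert f {g. smooth g}"
  then show "\<exists>f'\<in>insert f {g. smooth g}. \<forall>x. (g has_real_derivative f' x) (at x)"
    using assms smooth_has_deriv smooth_deriv by fast
qed auto

section \<open>The function exp(-1/x) and smooth bumps\<close>

definition flat :: "real poly \<Rightarrow> real \<Rightarrow> real" where
  "flat p x = (if x > 0 then poly p (1 / x) * exp (- (1 / x)) else 0)"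

lemma poly_div_exp_tendsto_0: "((\<lambda>y. poly p y / exp y) \<longlongrightarrow> (0::real)) at_top"
proof -
  have "((\<lambda>y. \<Sum>i\<le>degree p. coeff p i * (y ^ i / exp y)) \<longlongrightarrow> (\<Sum>i\<le>degree p. coeff p i * 0)) at_top"
    by (intro tendsto_intros tendsto_power_div_exp_0)
  then show ?thesis
    by (simp add: poly_altdef sum_divide_distrib)
qed

lemma flat_tendsto_0: "(flat p \<longlongrightarrow> 0) (at 0)"
proof -
  have "((\<lambda>x. poly p (1 / x) / exp (1 / x)) \<longlongrightarrow> 0) (at_right 0)"
    using filterlim_compose[OF poly_div_exp_tendsto_0 filterlim_inverse_at_top_right]
    by (simp add: inverse_eq_divide)
  then have "(flat p \<longlongrightarrow> 0) (at_right 0)"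
  proof (rule tendsto_cong[THEN iffD1, rotated])
    show "\<forall>\<^sub>F x in at_right 0. poly p (1 / x) / exp (1 / x) = flat p x"
      unfolding flat_def by (auto simp: eventually_at_filter exp_minus divide_inverse)
  qed
  moreover have "(flat p \<longlongrightarrow> 0) (at_left 0)"
    by (rule tendsto_eventually) (auto simp: flat_def eventually_at_filter)
  ultimately show ?thesis
    by (simp add: filterlim_at_split)
qed

text \<open>Put y = 1/x: differentiating p(y) exp(-y) gives y^2 (p - p')(y) exp(-y), so the family
  of all \<open>flat p\<close> is closed under differentiation, as \<open>smooth_closedI\<close>
  requires. The polynomial factor is carried along for this purpose.\<close>

lemma flat_has_deriv:
  "(flat p has_real_derivative flat ([:0, 0, 1:] * (p - pderiv p)) x) (at x)"
proof -
  consider "x > 0" | "x < 0" | "x = 0" by linarith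
  then show ?thesis
  proof cases
    case 1
    have "((\<lambda>x. poly p (1 / x) * exp (- (1 / x))) has_real_derivative
            flat ([:0, 0, 1:] * (p - pderiv p)) x) (at x)"
      using 1 by (auto intro!: derivative_eq_intros poly_DERIV[THEN DERIV_chain2]
          simp: flat_def field_simps power2_eq_square)
    then show ?thesis
      by (rule has_field_derivative_transform_within_open[of _ _ _ "{0<..}"])
        (use 1 in \<open>auto simp: flat_def\<close>)
  next
    case 2
    have "((\<lambda>x. 0) has_real_derivative 0) (at x)" by simp
    then have "(flat p has_real_derivative 0) (at x)"
      by (rule has_field_derivative_transform_within_open[of _ _ _ "{..<0}"])
        (use 2 in \<open>auto simp: flat_def\<close>)
    then show ?thesis using 2 by (simp add: flat_def)
  next
    case 3
    \<comment> \<open>At 0 the difference quotient of \<open>flat p\<close> is again a flat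
      function, with \<open>p\<close> multiplied by y, so its limit is 0.\<close>
    have "(flat ([:0, 1:] * p) \<longlongrightarrow> 0) (at 0)" by (rule flat_tendsto_0)
    moreover have "flat ([:0, 1:] * p) = (\<lambda>h. (flat p (0 + h) - flat p 0) / h)"
      by (auto simp: flat_def fun_eq_iff)
    ultimately show ?thesis
      using 3 by (simp add: has_field_derivative_iff flat_def)
  qed
qed

definition ramp :: "real \<Rightarrow> real" where
  "ramp x = (if x > 0 then exp (- (1 / x)) else 0)"

lemma smooth_ramp_affine: "smooth (\<lambda>x. ramp (c * x + d))"
proof (rule smooth_closedI)
  let ?S = "{f. \<exists>p q. f = (\<lambda>x. q * flat p (c * x + d))}"
  have "ramp = flat [:1:]" by (auto simp: ramp_def flat_def fun_eq_iff)
  then show "(\<lambda>x. ramp (c * x + d)) \<in> ?S"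
    by (intro CollectI exI[of _ "[:1:]"] exI[of _ 1]) auto
  fix f assume "f \<in> ?S"
  then obtain p q where f: "f = (\<lambda>x. q * flat p (c * x + d))" by blast
  let ?p = "[:0, 0, 1:] * (p - pderiv p)"
  have "(f has_real_derivative q * c * flat ?p (c * x + d)) (at x)" for x
    unfolding f by (rule derivative_eq_intros flat_has_deriv[THEN DERIV_chain2] refl | simp)+
  then show "\<exists>f'\<in>?S. \<forall>x. (f has_real_derivative f' x) (at x)"
    by (intro bexI[of _ "\<lambda>x. q * c * flat ?p (c * x + d)"]) auto
qed

lemma ramp_bounds: "0 \<le> ramp x" "ramp x \<le> 1" and ramp_eq_0: "x \<le> 0 \<Longrightarrow> ramp x = 0"
  and ramp_pos: "x > 0 \<Longrightarrow> ramp x > 0"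
  by (auto simp: ramp_def)

lemma ramp_tendsto_1:
  assumes "x > 0" shows "(\<lambda>n. ramp (real n * x)) \<longlonglongrightarrow> 1"
proof -
  have "((\<lambda>y::real. exp (- (1 / y))) \<longlongrightarrow> exp (- 0)) at_top"
    by (intro tendsto_intros tendsto_divide_0[OF tendsto_const] filterlim_at_top_imp_at_infinity filterlim_ident)
  moreover have "filterlim (\<lambda>n. real n * x) at_top sequentially"
    using filterlim_tendsto_pos_mult_at_top[OF tendsto_const assms filterlim_real_sequentially]
    by (simp add: mult.commute)
  ultimately have "(\<lambda>n. exp (- (1 / (real n * x)))) \<longlonglongrightarrow> 1"
    using filterlim_compose by fastforce
  then show ?thesis
    by (rule Lim_transform_eventually)
      (use assms in \<open>auto simp: ramp_def intro!: eventually_sequentiallyI[of 1]\<close>)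
qed

text \<open>The two ramps steepen with \<open>n\<close>: the bumps tend pointwise to the indicator
  of the open interval, stay between 0 and 1 and vanish outside it. Testing with them and dominated
  convergence recover integrals over intervals.\<close>

definition bump :: "nat \<Rightarrow> real \<Rightarrow> real \<Rightarrow> real \<Rightarrow> real" where
  "bump n c d x = ramp (real n * (x - c)) * ramp (real n * (d - x))"

lemma smooth_bump: "smooth (bump n c d)"
proof -
  have "bump n c d = (\<lambda>x. ramp (real n * x + - (real n * c)) * ramp ((- real n) * x + real n * d))"
    by (auto simp: bump_def fun_eq_iff algebra_simps)
  then show ?thesis
    by (simp only:) (intro smooth_mult smooth_ramp_affine)
qed

lemma bump_eq_0: "x \<notin> {c<..<d} \<Longrightarrow> bump n c d x = 0"
  by (force simp: bump_def intro: ramp_eq_0 mult_nonneg_nonpos)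

lemma bump_bounds: "0 \<le> bump n c d x" "bump n c d x \<le> 1"
  using ramp_bounds by (auto simp: bump_def mult_le_one)

lemma bump_tendsto: "(\<lambda>n. bump n c d x) \<longlonglongrightarrow> indicator {c<..<d} x"
proof (cases "x \<in> {c<..<d}")
  case True
  then have "(\<lambda>n. bump n c d x) \<longlonglongrightarrow> 1 * 1"
    unfolding bump_def by (intro tendsto_mult ramp_tendsto_1) auto
  then show ?thesis using True by simp
qed (simp add: bump_eq_0)

section \<open>Test functions and their supports\<close>

lemma test_functions_iff: "\<phi> \<in> test_functions a b \<longleftrightarrow> smooth \<phi> \<and> closure {x. \<phi> x \<noteq> 0} \<subseteq> {a<..<b}"
  by (simp add: test_functions_def smooth_def)

lemma test_function_support:
  assumes "\<phi> \<in> test_functions a b" "a < b"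
  obtains c d where "a < c" "c < d" "d < b" "\<And>x. x \<notin> {c..d} \<Longrightarrow> \<phi> x = 0"
proof -
  let ?K = "closure {x. \<phi> x \<noteq> 0}"
  have K: "?K \<subseteq> {a<..<b}" using assms by (simp add: test_functions_iff)
  show thesis
  proof (cases "?K = {}")
    case True
    then have "\<And>x. \<phi> x = 0" by auto
    then show thesis
      \<comment> \<open>The zero function has empty support; any c < d inside the interval will do,
        here the thirds.\<close>
      using assms(2) that[of "(2*a+b)/3" "(a+2*b)/3"] by simp
  next
    case False
    have "bounded ?K" using K bounded_subset bounded_box[of a b] by (metis box_real(1))
    then have "compact ?K" by (simp add: compact_eq_bounded_closed)
    then obtain p q where p: "p \<in> ?K" "\<forall>x\<in>?K. p \<le> x" and q: "q \<in> ?K" "\<forall>x\<in>?K. x \<le> q"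
      using compact_attains_inf[of ?K] compact_attains_sup[of ?K] False by blast
    then have "a < p" "p \<le> q" "q < b" using K by auto
    moreover have "\<phi> x = 0" if "x \<notin> {p..q}" for x
    proof (rule ccontr)
      assume "\<phi> x \<noteq> 0"
      then have "x \<in> ?K" by (intro closure_subset[THEN subsetD]) simp
      then show False using that p(2) q(2) by auto
    qed
    ultimately show thesis
      \<comment> \<open>Midpoints enlarge [p, q] within (a, b), which yields the strict inequality c
        < d.\<close>
      by (intro that[of "(a+p)/2" "(q+b)/2"]) auto
  qed
qed

lemma test_functionI:
  assumes "smooth \<phi>" "a < c" "d < b" "\<And>x. x \<notin> {c..d} \<Longrightarrow> \<phi> x = 0"
  shows "\<phi> \<in> test_functions a b"
proof -
  have "closure {x. \<phi> x \<noteq> 0} \<subseteq> {c..d}"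
    using assms(4) by (intro closure_minimal subsetI) (blast, simp)
  then show ?thesis
    using assms(1-3) by (auto simp: test_functions_iff)
qed

lemma bump_test_function: "a < c \<Longrightarrow> d < b \<Longrightarrow> bump n c d \<in> test_functions a b"
  using bump_eq_0 by (intro test_functionI[of _ _ c d] smooth_bump) auto

lemma test_function_deriv:
  assumes "\<phi> \<in> test_functions a b" "a < b" shows "deriv \<phi> \<in> test_functions a b"
proof -
  obtain c d where cd: "a < c" "c < d" "d < b" "\<And>x. x \<notin> {c..d} \<Longrightarrow> \<phi> x = 0"
    using test_function_support assms by metis
  show ?thesis
  proof (rule test_functionI[OF _ cd(1,3)])
    show "smooth (deriv \<phi>)" using assms by (simp add: smooth_deriv test_functions_iff)
    fix x assume x: "x \<notin> {c..d}"
    have "((\<lambda>x. 0) has_real_derivative 0) (at x)" by simp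
    then have "(\<phi> has_real_derivative 0) (at x)"
      by (rule has_field_derivative_transform_within_open[of _ _ _ "- {c..d}"])
        (use x cd(4) in auto)
    then show "deriv \<phi> x = 0" by (rule DERIV_imp_deriv)
  qed
qed

section \<open>Weak derivatives\<close>

lemma AE_lebesgue_on_iff:
  fixes S :: "real set"
  assumes "S \<in> sets lebesgue"
  shows "(AE x in lebesgue_on S. P x) \<longleftrightarrow> (\<exists>N. negligible N \<and> (\<forall>x\<in>S - N. P x))"
proof -
  have "(AE x in lebesgue_on S. P x) \<longleftrightarrow> (AE x in lebesgue. x \<in> S \<longrightarrow> P x)"
    using assms by (subst AE_restrict_space_iff) auto
  also have "\<dots> \<longleftrightarrow> negligible {x \<in> S. \<not> P x}"
    by (simp add: completion.AE_iff_null_sets negligible_iff_null_sets)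
  also have "\<dots> \<longleftrightarrow> (\<exists>N. negligible N \<and> (\<forall>x\<in>S - N. P x))"
  proof
    assume "\<exists>N. negligible N \<and> (\<forall>x\<in>S - N. P x)"
    then obtain N where "negligible N" "\<forall>x\<in>S - N. P x" by blast
    then show "negligible {x \<in> S. \<not> P x}"
      by (elim negligible_subset) auto
  qed blast
  finally show ?thesis .
qed

lemma integrable_lebesgue_on_iff:
  fixes f :: "real \<Rightarrow> real"
  assumes "S \<in> sets lebesgue"
  shows "integrable (lebesgue_on S) f \<longleftrightarrow> f absolutely_integrable_on S"
  using assms by (simp add: set_integrable_def integrable_restrict_space)

lemma integrable_on_subset:
  fixes f :: "real \<Rightarrow> real"
  assumes "integrable (lebesgue_on S) f" "A \<subseteq> S" "A \<in> sets lebesgue" "S \<in> sets lebesgue"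
  shows "integrable (lebesgue_on A) f"
  using assms by (simp add: integrable_lebesgue_on_iff) (meson set_integrable_subset)

lemma integrable_open_closed:
  fixes f :: "real \<Rightarrow> real"
  shows "integrable (lebesgue_on {a<..<b}) f \<longleftrightarrow> integrable (lebesgue_on {a..b}) f"
proof -
  have "negligible {x \<in> {a..b} - {a<..<b}. f x \<noteq> 0}"
    by (rule negligible_subset[of "{a, b}"]) auto
  moreover have "{x \<in> {a<..<b} - {a..b}. f x \<noteq> 0} = {}" by auto
  ultimately have "f absolutely_integrable_on {a<..<b} \<longleftrightarrow> f absolutely_integrable_on {a..b}"
    by (intro absolutely_integrable_spike_set_eq) (simp_all only: negligible_empty)
  then show ?thesis
    by (simp add: integrable_lebesgue_on_iff)
qed

lemma integral_open_eq:
  fixes f :: "real \<Rightarrow> real"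
  assumes "integrable (lebesgue_on {a<..<b}) f"
  shows "(LINT x|lebesgue_on {a<..<b}. f x) = integral {a..b} f"
proof -
  have "(LINT x|lebesgue_on {a<..<b}. f x) = integral {a<..<b} f"
    using assms by (intro lebesgue_integral_eq_integral) auto
  then show ?thesis
    by (simp add: integral_open_interval_real)
qed

lemma supported_integral:
  fixes h :: "real \<Rightarrow> real"
  assumes "\<And>x. x \<notin> A \<Longrightarrow> h x = 0" "A \<subseteq> S" "A \<in> sets lebesgue" "S \<in> sets lebesgue"
  shows "integrable (lebesgue_on S) h \<longleftrightarrow> integrable (lebesgue_on A) h"
    and "(LINT x|lebesgue_on S. h x) = (LINT x|lebesgue_on A. h x)"
proof -
  have "(\<lambda>x. indicat_real S x *\<^sub>R h x) = (\<lambda>x. indicat_real A x *\<^sub>R h x)"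
    using assms(1,2) by (auto simp: indicator_def fun_eq_iff)
  then show "integrable (lebesgue_on S) h \<longleftrightarrow> integrable (lebesgue_on A) h"
    and "(LINT x|lebesgue_on S. h x) = (LINT x|lebesgue_on A. h x)"
    using assms(3,4) by (simp_all add: integrable_restrict_space integral_restrict_space del: real_scaleR_def)
qed

text \<open>By Lebesgue differentiation a locally integrable function is almost everywhere the limit
  of its averages over [x, x+h], and these are all 0. Since \<open>f\<close> is integrable only away
  from the endpoints, this is applied to its truncations \<open>F n\<close> to [p n, q n], and the
  countably many exceptional sets are united.\<close>

lemma integral_subintervals_zero_imp_AE:
  fixes f :: "real \<Rightarrow> real"
  assumes int: "\<And>c d. a < c \<Longrightarrow> d < b \<Longrightarrow> f integrable_on {c..d}"
    and zero: "\<And>c d. a < c \<Longrightarrow> c < d \<Longrightarrow> d < b \<Longrightarrow> integral {c..d} f = 0"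
  shows "AE x in lebesgue_on {a<..<b}. f x = 0"
proof -
  define p q where "p n = a + 1 / real (Suc n)" and "q n = b - 1 / real (Suc n)" for n
  define F where "F n x = (if x \<in> {p n .. q n} then f x else 0)" for n x
  have pq: "a < p n" "q n < b" for n by (auto simp: p_def q_def)
  have "\<exists>N. negligible N \<and> (\<forall>x. x \<notin> N \<longrightarrow> F n x = 0)" for n
  proof -
    have Int: "{p n .. q n} \<inter> {c..d} = {max c (p n) .. min d (q n)}" for c d by auto
    have "F n integrable_on cbox c d" for c d
      unfolding F_def box_real integrable_restrict_Int Int
      by (rule int) (use pq in \<open>auto simp: less_max_iff_disj min_less_iff_disj\<close>)
    then obtain N where N: "negligible N"
      "\<And>x e. \<lbrakk>x \<notin> N; 0 < e\<rbrakk> \<Longrightarrow>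
         \<exists>d>0. \<forall>h. 0 < h \<and> h < d \<longrightarrow>
            norm (integral (cbox x (x + h *\<^sub>R One)) (F n) /\<^sub>R h ^ DIM(real) - F n x) < e"
      using integrable_ccontinuous_explicit[of "F n"] by metis
    have "integral (cbox c d) (F n) = 0" for c d
    proof -
      have "integral (cbox c d) (F n) = integral {max c (p n) .. min d (q n)} f"
        unfolding F_def box_real Henstock_Kurzweil_Integration.integral_restrict_Int Int ..
      also have "\<dots> = 0"
      proof (cases "max c (p n) < min d (q n)")
        case True
        show ?thesis
          by (rule zero[OF _ True]) (use pq in \<open>auto simp: less_max_iff_disj min_less_iff_disj\<close>)
      next
        case False
        then show ?thesis by (intro integral_null[of "max c (p n)" "min d (q n)", unfolded box_real]) auto
      qed
      finally show ?thesis .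
    qed
    then have "norm (F n x) < e" if xe: "x \<notin> N" "e > 0" for x e
    proof -
      obtain d where d: "d > 0" "\<And>h. 0 < h \<Longrightarrow> h < d \<Longrightarrow>
            norm (integral (cbox x (x + h *\<^sub>R One)) (F n) /\<^sub>R h ^ DIM(real) - F n x) < e"
        using N(2)[OF xe] by blast
      show ?thesis
        using d(2)[of "d / 2"] d(1) \<open>\<And>c d. integral (cbox c d) (F n) = 0\<close> by auto
    qed
    then have "F n x = 0" if "x \<notin> N" for x
      using that by (metis less_irrefl zero_less_norm_iff)
    then show ?thesis using N(1) by blast
  qed
  then obtain N where N: "\<And>n. negligible (N n)" "\<And>n x. x \<notin> N n \<Longrightarrow> F n x = 0"
    by metis
  have "f x = 0" if x: "x \<in> {a<..<b} - (\<Union>n. N n)" for x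
  proof -
    have "min (x - a) (b - x) > 0" using x by auto
    then obtain n where "1 / real (Suc n) < min (x - a) (b - x)"
      using nat_approx_posE by metis
    then have "F n x = f x" by (auto simp: F_def p_def q_def)
    then show ?thesis using N(2) x by auto
  qed
  moreover have "negligible (\<Union>n. N n)"
    using N by (intro negligible_Union_nat) auto
  ultimately show ?thesis
    by (auto simp: AE_lebesgue_on_iff)
qed

section \<open>Locally integrable functions determined by test functions\<close>

definition loc_integrable :: "real \<Rightarrow> real \<Rightarrow> (real \<Rightarrow> real) \<Rightarrow> bool" where
  "loc_integrable a b f \<longleftrightarrow> (\<forall>c d. a < c \<and> d < b \<longrightarrow> integrable (lebesgue_on {c..d}) f)"

lemma integrable_imp_loc_integrable:
  "integrable (lebesgue_on {a<..<b}) f \<Longrightarrow> loc_integrable a b f"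
  unfolding loc_integrable_def by (auto intro: integrable_on_subset[of "{a<..<b}"])

lemma loc_integrable_diff:
  "loc_integrable a b f \<Longrightarrow> loc_integrable a b g \<Longrightarrow> loc_integrable a b (\<lambda>x. f x - g x)"
  unfolding loc_integrable_def by auto

lemma smooth_continuous_on: "smooth f \<Longrightarrow> continuous_on S f"
  by (meson DERIV_isCont continuous_at_imp_continuous_on smooth_has_deriv)

lemma integrable_times_continuous:
  fixes f \<phi> :: "real \<Rightarrow> real"
  assumes "integrable (lebesgue_on {c..d}) f" "continuous_on {c..d} \<phi>"
  shows "integrable (lebesgue_on {c..d}) (\<lambda>x. f x * \<phi> x)"
proof -
  have "bounded (\<phi> ` {c..d})"
    using assms(2) by (intro compact_imp_bounded compact_continuous_image) auto
  then have "(\<lambda>x. \<phi> x * f x) absolutely_integrable_on {c..d}"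
    using assms by (intro absolutely_integrable_bounded_measurable_product_real)
      (auto simp: integrable_lebesgue_on_iff continuous_imp_measurable_on_sets_lebesgue)
  then show ?thesis
    by (simp add: integrable_lebesgue_on_iff mult.commute)
qed

lemma integrable_times_test:
  assumes "a < b" "loc_integrable a b f" "\<phi> \<in> test_functions a b"
  shows "integrable (lebesgue_on {a<..<b}) (\<lambda>x. f x * \<phi> x)"
proof -
  obtain c d where cd: "a < c" "c < d" "d < b" "\<And>x. x \<notin> {c..d} \<Longrightarrow> \<phi> x = 0"
    using test_function_support assms by metis
  have "integrable (lebesgue_on {c..d}) (\<lambda>x. f x * \<phi> x)"
    using assms cd by (intro integrable_times_continuous smooth_continuous_on)
      (auto simp: loc_integrable_def test_functions_iff)
  then show ?thesis
    using cd by (subst supported_integral(1)[of "{c..d}"]) auto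
qed

text \<open>Testing with \<open>bump n c d\<close> and passing to the limit under the bound |g|
  turns the hypothesis into vanishing integrals over all compact subintervals, to which
  \<open>integral_subintervals_zero_imp_AE\<close> applies.\<close>

lemma fundamental_lemma:
  assumes "a < b" "loc_integrable a b g"
    and zero: "\<And>\<phi>. \<phi> \<in> test_functions a b \<Longrightarrow> (LINT x|lebesgue_on {a<..<b}. g x * \<phi> x) = 0"
  shows "AE x in lebesgue_on {a<..<b}. g x = 0"
proof (rule integral_subintervals_zero_imp_AE)
  show "g integrable_on {c..d}" if "a < c" "d < b" for c d
    using assms(2) that by (auto simp: loc_integrable_def intro: integrable_on_lebesgue_on)
  fix c d assume cd: "a < c" "c < d" "d < b"
  have g: "integrable (lebesgue_on {c..d}) g"
    using assms(2) cd by (auto simp: loc_integrable_def)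
  have "(\<lambda>n. LINT x|lebesgue_on {c..d}. g x * bump n c d x) \<longlonglongrightarrow>
          (LINT x|lebesgue_on {c..d}. g x * indicator {c<..<d} x)"
  proof (rule integral_dominated_convergence[where w = "\<lambda>x. \<bar>g x\<bar>"])
    show "(\<lambda>x. g x * indicat_real {c<..<d} x) \<in> borel_measurable (lebesgue_on {c..d})"
      by (intro borel_measurable_times borel_measurable_integrable[OF g] measurable_restrict_space1)
        (simp add: borel_measurable_indicator)
    show "(\<lambda>x. g x * bump n c d x) \<in> borel_measurable (lebesgue_on {c..d})" for n
      using g by (intro borel_measurable_integrable integrable_times_continuous smooth_continuous_on smooth_bump)
    show "AE x in lebesgue_on {c..d}. (\<lambda>n. g x * bump n c d x) \<longlonglongrightarrow> g x * indicat_real {c<..<d} x"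
      by (intro always_eventually allI tendsto_mult tendsto_const bump_tendsto)
    show "AE x in lebesgue_on {c..d}. norm (g x * bump n c d x) \<le> \<bar>g x\<bar>" for n
      using bump_bounds by (intro always_eventually allI) (simp add: abs_mult mult_left_le)
  qed (use g in auto)
  moreover have "(LINT x|lebesgue_on {c..d}. g x * bump n c d x) = 0" for n
  proof -
    have "(LINT x|lebesgue_on {a<..<b}. g x * bump n c d x) = (LINT x|lebesgue_on {c..d}. g x * bump n c d x)"
      using cd by (intro supported_integral) (auto simp: bump_eq_0)
    then show ?thesis using zero[OF bump_test_function] cd by simp
  qed
  ultimately have "0 = (LINT x|lebesgue_on {c..d}. g x * indicator {c<..<d} x)"
    by (simp add: LIMSEQ_const_iff)
  also have "\<dots> = (LINT x|lebesgue_on {c..d}. (if x \<in> {c<..<d} then g x else 0))"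
    by (intro Bochner_Integration.integral_cong) auto
  also have "\<dots> = (LINT x|lebesgue_on {c<..<d}. g x)"
    by (subst Lebesgue_Measure.integral_restrict_Int) (auto simp: Int_absorb2 greaterThanLessThan_subseteq_atLeastAtMost_iff)
  also have "\<dots> = integral {c..d} g"
    using g by (intro integral_open_eq) (simp add: integrable_open_closed)
  finally show "integral {c..d} g = 0" by simp
qed

lemma integrable_test:
  assumes "a < b" "\<phi> \<in> test_functions a b"
  shows "integrable (lebesgue_on {a<..<b}) \<phi>"
  using integrable_times_test[of a b "\<lambda>x. 1" \<phi>] assms
  by (auto simp: loc_integrable_def integrable_lebesgue_on_iff)

text \<open>The primitive from \<open>a\<close> vanishes to the left of the support of
  \<open>\<psi>\<close> and is constant to the right of it. That constant is the total integral, so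
  mean zero is exactly what gives the primitive compact support.\<close>

lemma test_function_antideriv:
  assumes "a < b" "\<psi> \<in> test_functions a b" "(LINT x|lebesgue_on {a<..<b}. \<psi> x) = 0"
  obtains \<phi> where "\<phi> \<in> test_functions a b" "deriv \<phi> = \<psi>"
proof -
  obtain c d where cd: "a < c" "c < d" "d < b" "\<And>x. x \<notin> {c..d} \<Longrightarrow> \<psi> x = 0"
    using test_function_support assms by metis
  define \<phi> where "\<phi> x = integral {a..x} \<psi>" for x
  have cont: "continuous_on S \<psi>" for S
    using assms(2) by (simp add: test_functions_iff smooth_continuous_on)
  have low: "\<phi> x = 0" if "x < c" for x
  proof -
    have "integral {a..x} \<psi> = integral {a..x} (\<lambda>x. 0)"
      using that cd(4) by (intro Henstock_Kurzweil_Integration.integral_cong) auto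
    then show ?thesis by (simp add: \<phi>_def)
  qed
  have high: "\<phi> x = integral {a..d} \<psi>" if "d < x" for x
  proof -
    have "integral {d..x} \<psi> = integral {d..x} (\<lambda>x. 0)"
      by (rule integral_spike[of "{d}"]) (use that cd(4) in auto)
    moreover have "\<phi> x = integral {a..d} \<psi> + integral {d..x} \<psi>"
      unfolding \<phi>_def using that cd
      by (intro Henstock_Kurzweil_Integration.integral_combine[symmetric] integrable_continuous_real cont) auto
    ultimately show ?thesis by simp
  qed
  have "\<phi> b = 0"
    using assms integrable_test[of a b \<psi>] by (simp add: integral_open_eq \<phi>_def)
  then have zero: "\<phi> x = 0" if "x \<notin> {c..d}" for x
    using that low[of x] high[of x] high[OF \<open>d < b\<close>] by (cases "x < c") auto
  have deriv: "(\<phi> has_real_derivative \<psi> x) (at x)" for x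
  proof (cases "x < c")
    case True
    have "((\<lambda>x. 0) has_real_derivative 0) (at x)" by simp
    then have "(\<phi> has_real_derivative 0) (at x)"
      by (rule has_field_derivative_transform_within_open[of _ _ _ "{..<c}"])
        (use True low in auto)
    then show ?thesis using cd(4)[of x] True by simp
  next
    case False
    then have "(\<phi> has_real_derivative \<psi> x) (at x within {a..x+1})"
      unfolding \<phi>_def using cd by (intro integral_has_real_derivative cont) auto
    then show ?thesis
      using False cd(1) by (simp add: at_within_Icc_at)
  qed
  show thesis
  proof (rule that)
    show "deriv \<phi> = \<psi>" using deriv by (auto intro: DERIV_imp_deriv)
    have "smooth \<phi>" using smooth_antideriv[OF deriv] assms(2) by (simp add: test_functions_iff)
    then show "\<phi> \<in> test_functions a b" using test_functionI zero cd by blast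
  qed
qed

lemma integral_test_deriv:
  assumes "a < b" "\<phi> \<in> test_functions a b" "x \<in> {a..b}"
  shows "integral {x..b} (deriv \<phi>) = - \<phi> x"
proof -
  have "(deriv \<phi> has_integral \<phi> b - \<phi> x) {x..b}"
    using assms smooth_has_deriv
    by (intro fundamental_theorem_of_calculus)
      (auto simp: test_functions_iff has_real_derivative_iff_has_vector_derivative[symmetric]
        intro: has_field_derivative_at_within)
  moreover obtain c d where "d < b" "\<And>x. x \<notin> {c..d} \<Longrightarrow> \<phi> x = 0"
    using test_function_support assms by metis
  then have "\<phi> b = 0" by auto
  ultimately show ?thesis by (simp add: integral_unique)
qed

text \<open>Subtracting from a test function the right multiple of a fixed bump
  \<open>\<rho>\<close> makes its mean zero, hence makes it the derivative of a test function, to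
  which \<open>zero\<close> applies. This says that \<open>f\<close> minus a constant annihilates
  all test functions.\<close>

lemma du_Bois_Reymond:
  assumes "a < b" and f: "loc_integrable a b f"
    and zero: "\<And>\<phi>. \<phi> \<in> test_functions a b \<Longrightarrow> (LINT x|lebesgue_on {a<..<b}. f x * deriv \<phi> x) = 0"
  obtains C where "AE x in lebesgue_on {a<..<b}. f x = C"
proof -
  let ?M = "lebesgue_on {a<..<b}"
  obtain c d where cd: "a < c" "c < d" "d < b"
    using \<open>a < b\<close> dense by (metis dense_le_bounded le_less_linear less_trans)
  define \<rho> where "\<rho> = bump 1 c d"
  have \<rho>: "\<rho> \<in> test_functions a b" unfolding \<rho>_def using cd by (intro bump_test_function)
  define I where "I = (LINT x|?M. \<rho> x)"
  have "I \<noteq> 0"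
  proof
    assume "I = 0"
    have int: "integrable ?M \<rho>" using \<rho> assms(1) by (simp add: integrable_test)
    have "integral {a..b} \<rho> = 0"
      using \<open>I = 0\<close> integral_open_eq[OF int] by (simp add: I_def)
    then have "\<forall>x\<in>{a..b}. \<rho> x = 0"
      using assms(1) by (subst (asm) integral_eq_0_iff)
        (auto simp: \<rho>_def smooth_bump smooth_continuous_on bump_bounds)
    moreover have "\<rho> ((c + d) / 2) > 0"
      using cd ramp_pos by (auto simp: \<rho>_def bump_def field_simps)
    ultimately show False using cd by (auto simp: field_simps)
  qed
  \<comment> \<open>Testing the desired identity f = C with \<open>\<rho>\<close> leaves this as the
    only possible value.\<close>
  define C where "C = (LINT x|?M. f x * \<rho> x) / I"
  have "AE x in ?M. f x - C = 0"
  proof (rule fundamental_lemma[OF assms(1)])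
    show "loc_integrable a b (\<lambda>x. f x - C)"
      using f by (intro loc_integrable_diff) (auto simp: loc_integrable_def integrable_lebesgue_on_iff)
    fix \<psi> assume \<psi>: "\<psi> \<in> test_functions a b"
    define s where "s = (LINT x|?M. \<psi> x) / I"
    have int: "integrable ?M \<psi>" "integrable ?M \<rho>"
      "integrable ?M (\<lambda>x. f x * \<psi> x)" "integrable ?M (\<lambda>x. f x * \<rho> x)"
      using \<psi> \<rho> f assms(1) by (simp_all add: integrable_test integrable_times_test)
    have "(\<lambda>x. \<psi> x + (- s) * \<rho> x) \<in> test_functions a b"
    proof -
      obtain p q where pq: "a < p" "q < b" "\<And>x. x \<notin> {p..q} \<Longrightarrow> \<psi> x = 0"
        using test_function_support assms(1) \<psi> by metis
      moreover have "\<rho> x = 0" if "x \<notin> {c..d}" for x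
        unfolding \<rho>_def using that by (intro bump_eq_0) auto
      ultimately have "\<psi> x + (- s) * \<rho> x = 0" if "x \<notin> {min p c..max q d}" for x
        using that pq(3)[of x] by (auto simp: min_le_iff_disj le_max_iff_disj)
      then show ?thesis
        using \<psi> \<rho> cd pq(1,2)
        by (intro test_functionI[of _ a "min p c" "max q d" b] smooth_add smooth_mult smooth_const)
          (simp_all add: test_functions_iff)
    qed
    moreover have "(LINT x|?M. \<psi> x + (- s) * \<rho> x) = 0"
      using int \<open>I \<noteq> 0\<close> by (simp add: s_def I_def)
    ultimately obtain \<phi> where \<phi>: "\<phi> \<in> test_functions a b" "deriv \<phi> = (\<lambda>x. \<psi> x + (- s) * \<rho> x)"
      using test_function_antideriv[OF assms(1)] by metis
    have "0 = (LINT x|?M. f x * \<psi> x - s * (f x * \<rho> x))"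
      using zero[OF \<phi>(1)] by (simp add: \<phi>(2) algebra_simps)
    also have "\<dots> = (LINT x|?M. f x * \<psi> x) - s * (LINT x|?M. f x * \<rho> x)"
      using int by simp
    finally have "(LINT x|?M. f x * \<psi> x) = C * (LINT x|?M. \<psi> x)"
      by (simp add: s_def C_def)
    then show "(LINT x|?M. (f x - C) * \<psi> x) = 0"
      using int by (simp add: left_diff_distrib)
  qed
  then show thesis by (intro that[of C]) simp
qed

text \<open>Integration by parts when \<open>g\<close> is only integrable, so that its primitive
  need not be differentiable everywhere. Fubini is used on the triangle x < y: integrating first in
  x produces the primitive of \<open>g\<close>, integrating first in y produces - \<phi>.\<close>

lemma integral_primitive_test:
  assumes "a < b" and g: "integrable (lebesgue_on {a<..<b}) g" and \<phi>: "\<phi> \<in> test_functions a b"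
  shows "(LINT x|lebesgue_on {a<..<b}. integral {a..x} g * deriv \<phi> x)
       = - (LINT x|lebesgue_on {a<..<b}. g x * \<phi> x)"
proof -
  let ?M = "lebesgue_on {a<..<b}" and ?\<psi> = "deriv \<phi>"
  have \<psi>: "?\<psi> \<in> test_functions a b" using assms by (simp add: test_function_deriv)
  then have int\<psi>: "integrable ?M ?\<psi>" using assms(1) by (simp add: integrable_test)
  interpret finite_measure ?M by (simp add: finite_measure_lebesgue_on)
  interpret pair_sigma_finite ?M ?M ..
  have [measurable]: "g \<in> borel_measurable ?M" "?\<psi> \<in> borel_measurable ?M" "(\<lambda>x. x) \<in> borel_measurable ?M"
    using g int\<psi> id_borel_measurable_lebesgue_on[of "{a<..<b}"]
    by (auto simp: id_def)
  have prod: "integrable (?M \<Otimes>\<^sub>M ?M) (\<lambda>(x, y). g x * ?\<psi> y)"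
    by (rule Fubini_integrable) (use g int\<psi> in \<open>auto simp: abs_mult\<close>)
  have "integrable (?M \<Otimes>\<^sub>M ?M) (\<lambda>(x, y). (if x < y then g x * ?\<psi> y else 0))"
    by (rule Bochner_Integration.integrable_bound[OF prod]) auto
  note Fub = Fubini_integral[OF this]
  have eq1: "(LINT x|?M. (if x < y then g x * ?\<psi> y else 0)) = integral {a..y} g * ?\<psi> y"
    if "y \<in> {a<..<b}" for y
  proof -
    have "(LINT x|?M. (if x < y then g x * ?\<psi> y else 0)) = (LINT x|?M. (if x \<in> {..<y} then g x else 0) * ?\<psi> y)"
      by (intro Bochner_Integration.integral_cong) auto
    also have "\<dots> = (LINT x|lebesgue_on ({..<y} \<inter> {a<..<b}). g x) * ?\<psi> y"
      by (simp add: Lebesgue_Measure.integral_restrict_Int del: lessThan_iff)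
    also have "{..<y} \<inter> {a<..<b} = {a<..<y}" using that by auto
    also have "(LINT x|lebesgue_on {a<..<y}. g x) = integral {a..y} g"
      using that g by (intro integral_open_eq) (auto intro: integrable_on_subset[of "{a<..<b}"])
    finally show ?thesis .
  qed
  have eq2: "(LINT y|?M. (if x < y then g x * ?\<psi> y else 0)) = - (g x * \<phi> x)"
    if "x \<in> {a<..<b}" for x
  proof -
    have "(LINT y|?M. (if x < y then g x * ?\<psi> y else 0)) = (LINT y|?M. g x * (if y \<in> {x<..} then ?\<psi> y else 0))"
      by (intro Bochner_Integration.integral_cong) auto
    also have "\<dots> = g x * (LINT y|lebesgue_on ({x<..} \<inter> {a<..<b}). ?\<psi> y)"
      by (simp add: Lebesgue_Measure.integral_restrict_Int del: greaterThan_iff)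
    also have "{x<..} \<inter> {a<..<b} = {x<..<b}" using that by auto
    also have "(LINT y|lebesgue_on {x<..<b}. ?\<psi> y) = integral {x..b} ?\<psi>"
      using that int\<psi> by (intro integral_open_eq) (auto intro: integrable_on_subset[of "{a<..<b}"])
    also have "\<dots> = - \<phi> x" using that by (intro integral_test_deriv[OF assms(1) \<phi>]) auto
    finally show ?thesis by simp
  qed
  have "(LINT y|?M. integral {a..y} g * ?\<psi> y) = (LINT y|?M. (LINT x|?M. (if x < y then g x * ?\<psi> y else 0)))"
    by (intro Bochner_Integration.integral_cong refl eq1[symmetric]) simp
  also have "\<dots> = (LINT x|?M. - (g x * \<phi> x))"
    unfolding Fub by (intro Bochner_Integration.integral_cong refl eq2) simp
  finally show ?thesis by simp
qed

lemma has_weak_deriv_loc: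
  assumes "has_weak_deriv a b k f g"
  shows "loc_integrable a b f" "loc_integrable a b g"
  using assms by (auto simp: has_weak_deriv_def loc_integrable_def)

text \<open>The difference of \<open>f\<close> and the primitive of \<open>g\<close> has weak
  derivative 0, so \<open>du_Bois_Reymond\<close> makes it constant almost everywhere.\<close>

lemma weak_deriv_primitive:
  assumes "a < b" and wd: "has_weak_deriv a b 1 f g" and g: "integrable (lebesgue_on {a<..<b}) g"
  obtains C where "AE x in lebesgue_on {a<..<b}. f x = C + integral {a..x} g"
proof -
  let ?G = "\<lambda>x. integral {a..x} g"
  have "g integrable_on {a..b}"
    using g by (auto simp: integrable_open_closed intro: integrable_on_lebesgue_on)
  then have cont: "continuous_on {a..b} ?G"
    by (rule indefinite_integral_continuous_1)
  have intG: "loc_integrable a b ?G"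
    unfolding loc_integrable_def
    by (auto intro!: continuous_imp_integrable_real continuous_on_subset[OF cont])
  have f: "loc_integrable a b f" using has_weak_deriv_loc[OF wd] by simp
  obtain C where "AE x in lebesgue_on {a<..<b}. f x - ?G x = C"
  proof (rule du_Bois_Reymond[OF assms(1)])
    show "loc_integrable a b (\<lambda>x. f x - ?G x)" using f intG by (rule loc_integrable_diff)
    fix \<phi> assume \<phi>: "\<phi> \<in> test_functions a b"
    note int = integrable_times_test[OF assms(1) _ test_function_deriv[OF \<phi> assms(1)]]
    have "(LINT x|lebesgue_on {a<..<b}. (f x - ?G x) * deriv \<phi> x)
        = (LINT x|lebesgue_on {a<..<b}. f x * deriv \<phi> x) - (LINT x|lebesgue_on {a<..<b}. ?G x * deriv \<phi> x)"
      using int[OF f] int[OF intG] by (simp add: left_diff_distrib)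
    also have "\<dots> = 0"
      using wd \<phi> integral_primitive_test[OF assms(1) g \<phi>] by (simp add: has_weak_deriv_def)
    finally show "(LINT x|lebesgue_on {a<..<b}. (f x - ?G x) * deriv \<phi> x) = 0" .
  qed
  then show thesis
    by (intro that[of C]) (auto elim: eventually_mono)
qed

section \<open>\<open>L\<^sup>2\<close> and \<open>H\<^sup>2\<close> on an interval\<close>

lemma borel_measurable_cong_AE_lebesgue_on:
  fixes f g :: "real \<Rightarrow> real"
  assumes "f \<in> borel_measurable (lebesgue_on S)" "AE x in lebesgue_on S. f x = g x" "S \<in> sets lebesgue"
  shows "g \<in> borel_measurable (lebesgue_on S)"
proof -
  have "AE x in lebesgue. x \<in> S \<longrightarrow> f x = g x"
    using assms(2,3) by (subst (asm) AE_restrict_space_iff) auto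
  then have "AE x in lebesgue. (if x \<in> S then f x else 0) = (if x \<in> S then g x else 0)"
    by (rule eventually_mono) auto
  then have "(\<lambda>x. if x \<in> S then g x else 0) \<in> borel_measurable lebesgue"
    by (rule borel_measurable_AE[OF borel_measurable_if[OF assms(3), THEN iffD2, OF assms(1)]])
  then show ?thesis
    by (rule borel_measurable_if[OF assms(3), THEN iffD1])
qed

lemma L2_cong_AE:
  assumes "f \<in> L2 a b" "AE x in lebesgue_on {a<..<b}. f x = g x"
  shows "g \<in> L2 a b"
proof -
  have g: "g \<in> borel_measurable (lebesgue_on {a<..<b})"
    using assms by (auto simp: L2_def intro: borel_measurable_cong_AE_lebesgue_on)
  moreover have "integrable (lebesgue_on {a<..<b}) (\<lambda>x. (g x)\<^sup>2)"
    by (rule integrable_cong_AE_imp[of _ "\<lambda>x. (f x)\<^sup>2"]) (use assms g in \<open>auto simp: L2_def elim: eventually_mono\<close>)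
  ultimately show ?thesis by (simp add: L2_def)
qed

lemma L2_mult_integrable:
  assumes "f \<in> L2 a b" "g \<in> L2 a b"
  shows "integrable (lebesgue_on {a<..<b}) (\<lambda>x. f x * g x)"
proof (rule Bochner_Integration.integrable_bound)
  show "integrable (lebesgue_on {a<..<b}) (\<lambda>x. (f x)\<^sup>2 + (g x)\<^sup>2)"
    using assms by (auto simp: L2_def)
  have "\<bar>p * q\<bar> \<le> p\<^sup>2 + q\<^sup>2" for p q :: real
    using sum_squares_bound[of "\<bar>p\<bar>" "\<bar>q\<bar>"] mult_nonneg_nonneg[of "\<bar>p\<bar>" "\<bar>q\<bar>"]
    by (simp add: abs_mult del: mult_nonneg_nonneg)
  then show "AE x in lebesgue_on {a<..<b}. norm (f x * g x) \<le> norm ((f x)\<^sup>2 + (g x)\<^sup>2)"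
    by simp
qed (use assms in \<open>auto simp: L2_def\<close>)

lemma L2_diff:
  assumes "f \<in> L2 a b" "g \<in> L2 a b"
  shows "f - g \<in> L2 a b"
proof -
  have "integrable (lebesgue_on {a<..<b}) (\<lambda>x. (f x)\<^sup>2 - 2 * (f x * g x) + (g x)\<^sup>2)"
    using assms L2_mult_integrable[OF assms] by (auto simp: L2_def)
  moreover have "((f - g) x)\<^sup>2 = (f x)\<^sup>2 - 2 * (f x * g x) + (g x)\<^sup>2" for x
    by (simp add: power2_eq_square algebra_simps)
  ultimately show ?thesis using assms by (auto simp: L2_def fun_diff_def)
qed

lemma L2_const: "(\<lambda>x. c) \<in> L2 a b"
  by (auto simp: L2_def integrable_lebesgue_on_iff)

lemma L2_integrable: "f \<in> L2 a b \<Longrightarrow> integrable (lebesgue_on {a<..<b}) f"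
  using L2_mult_integrable[OF _ L2_const[of 1]] by simp

lemma L2_weight:
  assumes \<rho>: "\<rho> \<in> borel_measurable (lebesgue_on {a<..<b})" "AE x in lebesgue_on {a<..<b}. \<bar>\<rho> x\<bar> \<le> C"
    and "f \<in> L2 a b"
  shows "(\<lambda>x. \<rho> x * f x) \<in> L2 a b"
proof -
  have "integrable (lebesgue_on {a<..<b}) (\<lambda>x. (\<rho> x * f x)\<^sup>2)"
  proof (rule Bochner_Integration.integrable_bound)
    show "integrable (lebesgue_on {a<..<b}) (\<lambda>x. C\<^sup>2 * (f x)\<^sup>2)" using assms by (simp add: L2_def)
    show "AE x in lebesgue_on {a<..<b}. norm ((\<rho> x * f x)\<^sup>2) \<le> norm (C\<^sup>2 * (f x)\<^sup>2)"
      using \<rho>(2)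
    proof eventually_elim
      case (elim x)
      then have "\<bar>\<rho> x\<bar>\<^sup>2 \<le> C\<^sup>2" by (intro power_mono) auto
      then show ?case by (simp add: power_mult_distrib mult_right_mono)
    qed
  qed (use assms in \<open>auto simp: L2_def\<close>)
  then show ?thesis using assms by (auto simp: L2_def)
qed

lemma Cauchy_Schwarz_integral:
  fixes f g :: "'a \<Rightarrow> real"
  assumes "integrable M (\<lambda>x. (f x)\<^sup>2)" "integrable M (\<lambda>x. (g x)\<^sup>2)" "integrable M (\<lambda>x. f x * g x)"
  shows "(LINT x|M. f x * g x)\<^sup>2 \<le> (LINT x|M. (f x)\<^sup>2) * (LINT x|M. (g x)\<^sup>2)"
proof -
  define A B C where "A = (LINT x|M. (f x)\<^sup>2)" and "B = (LINT x|M. f x * g x)" and "C = (LINT x|M. (g x)\<^sup>2)"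
  have *: "0 \<le> A - 2 * t * B + t\<^sup>2 * C" for t
  proof -
    have "0 \<le> (LINT x|M. (f x - t * g x)\<^sup>2)" by simp
    also have "\<dots> = (LINT x|M. (f x)\<^sup>2 - 2 * t * (f x * g x) + t\<^sup>2 * (g x)\<^sup>2)"
      by (intro Bochner_Integration.integral_cong) (auto simp: power2_eq_square algebra_simps)
    also have "\<dots> = A - 2 * t * B + t\<^sup>2 * C"
      using assms by (simp add: A_def B_def C_def)
    finally show ?thesis .
  qed
  show ?thesis
  proof (cases "C = 0")
    case True
    have "B = 0"
    proof (rule ccontr)
      assume "B \<noteq> 0"
      \<comment> \<open>With C = 0 the expression in \<open>*\<close> is affine in t; this t makes
        it -1.\<close>
      then show False using *[of "(A + 1) / (2 * B)"] True by simp
    qed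
    then show ?thesis using True by (simp add: B_def C_def)
  next
    case False
    moreover have "C \<ge> 0" by (simp add: C_def)
    ultimately have "B\<^sup>2 \<le> A * C"
      using *[of "B / C"] by (simp add: power2_eq_square field_simps)
    then show ?thesis by (simp add: A_def B_def C_def)
  qed
qed

lemma L2_norm_nonneg: "L2_norm a b f \<ge> 0"
  by (simp add: L2_norm_def L2_inner_def)

lemma L2_norm_power2: "(L2_norm a b f)\<^sup>2 = (LINT x|lebesgue_on {a<..<b}. (f x)\<^sup>2)"
  by (simp add: L2_norm_def L2_inner_def power2_eq_square[symmetric])

lemma L2_Cauchy_Schwarz:
  assumes "f \<in> L2 a b" "g \<in> L2 a b"
  shows "\<bar>LINT x|lebesgue_on {a<..<b}. f x * g x\<bar> \<le> L2_norm a b f * L2_norm a b g"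
proof -
  have "(LINT x|lebesgue_on {a<..<b}. f x * g x)\<^sup>2 \<le> (L2_norm a b f * L2_norm a b g)\<^sup>2"
    using Cauchy_Schwarz_integral[of "lebesgue_on {a<..<b}" f g] assms L2_mult_integrable[OF assms]
    by (simp add: L2_def L2_norm_power2 power_mult_distrib)
  then have "\<bar>LINT x|lebesgue_on {a<..<b}. f x * g x\<bar> \<le> \<bar>L2_norm a b f * L2_norm a b g\<bar>"
    by (rule abs_le_square_iff[THEN iffD2])
  then show ?thesis by (simp add: L2_norm_nonneg)
qed

lemma L2_norm_weight:
  assumes \<rho>: "\<rho> \<in> borel_measurable (lebesgue_on {a<..<b})" "AE x in lebesgue_on {a<..<b}. \<bar>\<rho> x\<bar> \<le> C"
    and f: "f \<in> L2 a b" and "C \<ge> 0"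
  shows "L2_norm a b (\<lambda>x. \<rho> x * f x) \<le> C * L2_norm a b f"
proof -
  have "(L2_norm a b (\<lambda>x. \<rho> x * f x))\<^sup>2 \<le> (LINT x|lebesgue_on {a<..<b}. C\<^sup>2 * (f x)\<^sup>2)"
    unfolding L2_norm_power2
  proof (rule integral_mono_AE)
    show "integrable (lebesgue_on {a<..<b}) (\<lambda>x. (\<rho> x * f x)\<^sup>2)"
      "integrable (lebesgue_on {a<..<b}) (\<lambda>x. C\<^sup>2 * (f x)\<^sup>2)"
      using L2_weight[OF \<rho> f] f by (auto simp: L2_def)
    show "AE x in lebesgue_on {a<..<b}. (\<rho> x * f x)\<^sup>2 \<le> C\<^sup>2 * (f x)\<^sup>2"
      using \<rho>(2)
    proof eventually_elim
      case (elim x)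
      then have "\<bar>\<rho> x\<bar>\<^sup>2 \<le> C\<^sup>2" by (intro power_mono) auto
      then show ?case by (simp add: power_mult_distrib mult_right_mono)
    qed
  qed
  also have "\<dots> = (C * L2_norm a b f)\<^sup>2"
    by (simp add: power_mult_distrib L2_norm_power2)
  finally show ?thesis
    by (rule power2_le_imp_le) (simp add: \<open>C \<ge> 0\<close> L2_norm_nonneg)
qed

lemma L2_norm_triangle:
  assumes "f \<in> L2 a b" "g \<in> L2 a b"
  shows "\<bar>L2_norm a b f - L2_norm a b g\<bar> \<le> L2_norm a b (f - g)"
proof -
  let ?M = "lebesgue_on {a<..<b}"
  have "(L2_norm a b f - L2_norm a b g)\<^sup>2
      = (L2_norm a b f)\<^sup>2 - 2 * (L2_norm a b f * L2_norm a b g) + (L2_norm a b g)\<^sup>2"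
    by (simp add: power2_eq_square algebra_simps)
  also have "\<dots> \<le> (L2_norm a b f)\<^sup>2 - 2 * (LINT x|?M. f x * g x) + (L2_norm a b g)\<^sup>2"
    using L2_Cauchy_Schwarz[OF assms] by linarith
  also have "\<dots> = (LINT x|?M. (f x)\<^sup>2 - 2 * (f x * g x) + (g x)\<^sup>2)"
    using assms L2_mult_integrable[OF assms] by (simp add: L2_norm_power2 L2_def)
  also have "\<dots> = (L2_norm a b (f - g))\<^sup>2"
    unfolding L2_norm_power2
    by (intro Bochner_Integration.integral_cong) (simp_all add: power2_diff)
  finally have "\<bar>L2_norm a b f - L2_norm a b g\<bar> \<le> \<bar>L2_norm a b (f - g)\<bar>"
    by (rule abs_le_square_iff[THEN iffD2])
  then show ?thesis by (simp add: L2_norm_nonneg)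
qed

lemma L2_weighted_bound:
  assumes \<rho>: "\<rho> \<in> borel_measurable (lebesgue_on {a<..<b})" "AE x in lebesgue_on {a<..<b}. \<bar>\<rho> x\<bar> \<le> C" "C \<ge> 0"
    and "f \<in> L2 a b" "g \<in> L2 a b"
  shows "\<bar>LINT x|lebesgue_on {a<..<b}. \<rho> x * f x * g x\<bar> \<le> C * L2_norm a b f * L2_norm a b g"
proof -
  have "\<bar>LINT x|lebesgue_on {a<..<b}. \<rho> x * f x * g x\<bar> \<le> L2_norm a b (\<lambda>x. \<rho> x * f x) * L2_norm a b g"
    using L2_Cauchy_Schwarz[OF L2_weight[OF \<rho>(1,2) assms(4)] assms(5)] .
  also have "\<dots> \<le> C * L2_norm a b f * L2_norm a b g"
    using L2_norm_weight[OF \<rho>(1,2) assms(4) \<rho>(3)] by (intro mult_right_mono L2_norm_nonneg)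
  finally show ?thesis .
qed

text \<open>The filter \<open>at z within {0..T}\<close> ignores the point \<open>z\<close> itself,
  but a sequence may visit it. As \<open>N\<close> is an arbitrary function here, its vanishing on
  \<open>f z - f z\<close> has to be assumed.\<close>

lemma cont_in_time_sequentially:
  assumes f: "f \<in> cont_in_time T X N" and "N (f z - f z) = 0"
    and "\<And>n. s n \<in> {0..T}" "z \<in> {0..T}" "s \<longlonglongrightarrow> z"
  shows "(\<lambda>n::nat. N (f (s n) - f z)) \<longlonglongrightarrow> 0"
proof -
  have "continuous (at z within {0..T}) (\<lambda>s. N (f s - f z))"
    using f assms(2,4) by (auto simp: cont_in_time_def continuous_within)
  from continuous_within_tendsto_compose'[OF this assms(3,5)] show ?thesis
    using assms(2) by simp
qed

text \<open>Joint continuity comes from splitting f(s) g(t) - f(s0) g(t0) into (f(s) - f(s0)) g(t) +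
  f(s0) (g(t) - g(t0)) and bounding each weighted product by Cauchy-Schwarz.\<close>

lemma continuous_on_L2_kernel:
  assumes \<rho>: "\<rho> \<in> borel_measurable (lebesgue_on {a<..<b})" "AE x in lebesgue_on {a<..<b}. \<bar>\<rho> x\<bar> \<le> C" "C \<ge> 0"
    and f: "f \<in> cont_in_time T (L2 a b) (L2_norm a b)" and g: "g \<in> cont_in_time T (L2 a b) (L2_norm a b)"
  shows "continuous_on ({0..T} \<times> {0..T}) (\<lambda>(s, t). LINT x|lebesgue_on {a<..<b}. \<rho> x * f s x * g t x)"
  unfolding continuous_on_sequentially
proof (intro allI ballI impI)
  let ?M = "lebesgue_on {a<..<b}" and ?N = "L2_norm a b"
  let ?k = "\<lambda>s t. LINT x|?M. \<rho> x * f s x * g t x"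
  fix x y assume y: "y \<in> {0..T} \<times> {0..T}" and x: "(\<forall>n. x n \<in> {0..T} \<times> {0..T}) \<and> x \<longlonglongrightarrow> y"
  define s t s0 t0 where st: "s = fst \<circ> x" "t = snd \<circ> x" "s0 = fst y" "t0 = snd y"
  have mem: "s n \<in> {0..T}" "t n \<in> {0..T}" "s0 \<in> {0..T}" "t0 \<in> {0..T}" for n
    using x y by (auto simp: st mem_Times_iff)
  have L2: "f r \<in> L2 a b" "g r \<in> L2 a b" if "r \<in> {0..T}" for r
    using f g that by (auto simp: cont_in_time_def)
  have "s \<longlonglongrightarrow> s0" "t \<longlonglongrightarrow> t0"
    using x by (auto simp: st o_def intro: tendsto_fst tendsto_snd)
  then have lim: "(\<lambda>n. ?N (f (s n) - f s0)) \<longlonglongrightarrow> 0" "(\<lambda>n. ?N (g (t n) - g t0)) \<longlonglongrightarrow> 0"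
    by (auto intro!: cont_in_time_sequentially[OF f _ mem(1,3)] cont_in_time_sequentially[OF g _ mem(2,4)]
        simp: L2_norm_def[of a b "f s0 - f s0"] L2_norm_def[of a b "g t0 - g t0"] L2_inner_def)
  \<comment> \<open>The norm of \<open>g (t n)\<close> is replaced by that of \<open>g t0\<close>
    plus the norm of the increment, so that \<open>e\<close> tends to 0 without a separate bound
    along the sequence.\<close>
  define e where "e n = C * ?N (f (s n) - f s0) * (?N (g t0) + ?N (g (t n) - g t0))
      + C * ?N (f s0) * ?N (g (t n) - g t0)" for n
  have "e \<longlonglongrightarrow> C * 0 * (?N (g t0) + 0) + C * ?N (f s0) * 0"
    unfolding e_def by (intro tendsto_intros lim)
  then have e0: "e \<longlonglongrightarrow> 0" by simp
  have bound: "norm (?k (s n) (t n) - ?k s0 t0) \<le> e n" for n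
  proof -
    note int = L2_mult_integrable[OF L2_weight[OF \<rho>(1,2)]]
    note L2n = L2(1)[OF mem(1)[of n]] L2(2)[OF mem(2)[of n]] L2(1)[OF mem(3)] L2(2)[OF mem(4)]
    have "?k (s n) (t n) - ?k s0 t0 = (LINT x|?M. \<rho> x * f (s n) x * g (t n) x - \<rho> x * f s0 x * g t0 x)"
      using int L2n by simp
    also have "\<dots> = (LINT x|?M. \<rho> x * (f (s n) - f s0) x * g (t n) x + \<rho> x * f s0 x * (g (t n) - g t0) x)"
      by (intro Bochner_Integration.integral_cong) (auto simp: algebra_simps)
    also have "\<dots> = (LINT x|?M. \<rho> x * (f (s n) - f s0) x * g (t n) x) + (LINT x|?M. \<rho> x * f s0 x * (g (t n) - g t0) x)"
      by (intro Bochner_Integration.integral_add int L2n L2_diff)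
    finally have "\<bar>?k (s n) (t n) - ?k s0 t0\<bar>
        \<le> C * ?N (f (s n) - f s0) * ?N (g (t n)) + C * ?N (f s0) * ?N (g (t n) - g t0)"
      using L2_weighted_bound[OF \<rho> L2_diff[OF L2n(1,3)] L2n(2)] L2_weighted_bound[OF \<rho> L2n(3) L2_diff[OF L2n(2,4)]]
      by linarith
    also have "\<dots> \<le> e n"
      unfolding e_def using L2_norm_triangle[OF L2n(2,4)] \<rho>(3) L2_norm_nonneg
      by (intro add_mono mult_left_mono mult_nonneg_nonneg) auto
    finally show ?thesis by simp
  qed
  have "(\<lambda>n. ?k (s n) (t n) - ?k s0 t0) \<longlonglongrightarrow> 0"
    by (rule Lim_null_comparison[OF always_eventually[OF allI[OF bound]] e0])
  then show "((\<lambda>(s, t). ?k s t) \<circ> x) \<longlonglongrightarrow> (\<lambda>(s, t). ?k s t) y"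
    by (simp add: LIM_zero_iff st o_def case_prod_beta)
qed

section \<open>Weak derivatives and the choice of representatives\<close>

lemma weak_deriv_unique:
  assumes "a < b" "has_weak_deriv a b k f g" "has_weak_deriv a b k f h"
  shows "AE x in lebesgue_on {a<..<b}. g x = h x"
proof -
  have "AE x in lebesgue_on {a<..<b}. g x - h x = 0"
  proof (rule fundamental_lemma[OF assms(1)])
    show "loc_integrable a b (\<lambda>x. g x - h x)"
      using assms by (intro loc_integrable_diff has_weak_deriv_loc)
    fix \<phi> assume \<phi>: "\<phi> \<in> test_functions a b"
    have "integrable (lebesgue_on {a<..<b}) (\<lambda>x. g x * \<phi> x)" "integrable (lebesgue_on {a<..<b}) (\<lambda>x. h x * \<phi> x)"
      using assms \<phi> by (auto intro!: integrable_times_test has_weak_deriv_loc)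
    moreover have "(LINT x|lebesgue_on {a<..<b}. g x * \<phi> x) = (LINT x|lebesgue_on {a<..<b}. h x * \<phi> x)"
      using assms \<phi> by (simp add: has_weak_deriv_def)
    ultimately show "(LINT x|lebesgue_on {a<..<b}. (g x - h x) * \<phi> x) = 0"
      by (simp add: left_diff_distrib)
  qed
  then show ?thesis by simp
qed

lemma wderiv_H2:
  assumes "a < b" "f \<in> H2 a b" "k \<in> {1, 2}"
  shows "has_weak_deriv a b k f (wderiv a b k f)" "wderiv a b k f \<in> L2 a b"
proof -
  obtain g where g: "g \<in> L2 a b" "has_weak_deriv a b k f g"
    using assms by (auto simp: H2_def)
  then show *: "has_weak_deriv a b k f (wderiv a b k f)"
    unfolding wderiv_def by (metis someI_ex)
  show "wderiv a b k f \<in> L2 a b"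
    using L2_cong_AE g weak_deriv_unique[OF assms(1) g(2) *] by blast
qed

lemma test_function_higher_deriv:
  "a < b \<Longrightarrow> \<phi> \<in> test_functions a b \<Longrightarrow> (deriv ^^ k) \<phi> \<in> test_functions a b"
  by (induction k) (auto simp: test_function_deriv)

lemma has_weak_deriv_diff:
  assumes "a < b" "has_weak_deriv a b k f f'" "has_weak_deriv a b k g g'"
  shows "has_weak_deriv a b k (f - g) (f' - g')"
  unfolding has_weak_deriv_def
proof (intro conjI ballI)
  note loc = has_weak_deriv_loc[OF assms(2)] has_weak_deriv_loc[OF assms(3)]
  show "\<forall>c d. a < c \<and> d < b \<longrightarrow> integrable (lebesgue_on {c..d}) (f - g) \<and> integrable (lebesgue_on {c..d}) (f' - g')"
    using loc by (auto simp: loc_integrable_def fun_diff_def)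
  fix \<phi> assume \<phi>: "\<phi> \<in> test_functions a b"
  note int = integrable_times_test[OF assms(1)]
  show "(LINT x|lebesgue_on {a<..<b}. (f - g) x * (deriv ^^ k) \<phi> x) =
        (- 1) ^ k * (LINT x|lebesgue_on {a<..<b}. (f' - g') x * \<phi> x)"
    using assms \<phi> int[OF loc(2) \<phi>] int[OF loc(4) \<phi>]
      int[OF loc(1) test_function_higher_deriv[OF assms(1) \<phi>, of k]]
      int[OF loc(3) test_function_higher_deriv[OF assms(1) \<phi>, of k]]
    by (simp add: left_diff_distrib has_weak_deriv_def right_diff_distrib)
qed

text \<open>\<open>wderiv\<close> picks arbitrary representatives, so linearity can be expected only
  almost everywhere.\<close>

lemma wderiv_diff:
  assumes "a < b" "f \<in> H2 a b" "g \<in> H2 a b" "k \<in> {1, 2}"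
  shows "AE x in lebesgue_on {a<..<b}. wderiv a b k (f - g) x = wderiv a b k f x - wderiv a b k g x"
    and "f - g \<in> H2 a b"
proof -
  note wd = has_weak_deriv_diff[OF assms(1) wderiv_H2(1)[OF assms(1,2)] wderiv_H2(1)[OF assms(1,3)]]
  have L2: "wderiv a b k f - wderiv a b k g \<in> L2 a b" if "k \<in> {1, 2}" for k
    using wderiv_H2(2) that assms by (intro L2_diff) auto
  show H2: "f - g \<in> H2 a b"
    using assms wd L2 by (auto simp: H2_def intro: L2_diff)
  show "AE x in lebesgue_on {a<..<b}. wderiv a b k (f - g) x = wderiv a b k f x - wderiv a b k g x"
    using weak_deriv_unique[OF assms(1) wderiv_H2(1)[OF assms(1) H2 assms(4)] wd[OF assms(4,4)]] by simp
qed

lemma has_weak_deriv_cong_AE: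
  assumes "a < b" and fg: "AE x in lebesgue_on {a<..<b}. f x = g x" and h: "has_weak_deriv a b k f h"
  shows "has_weak_deriv a b k g h"
proof -
  obtain N where N: "negligible N" "\<forall>x\<in>{a<..<b} - N. f x = g x"
    using fg by (auto simp: AE_lebesgue_on_iff)
  note f = has_weak_deriv_loc(1)[OF h]
  have g: "loc_integrable a b g"
    unfolding loc_integrable_def
  proof (intro allI impI)
    fix c d assume cd: "a < c \<and> d < b"
    then have f: "integrable (lebesgue_on {c..d}) f" using f by (auto simp: loc_integrable_def)
    have AE: "AE x in lebesgue_on {c..d}. f x = g x"
      using N cd by (subst AE_lebesgue_on_iff) (auto intro!: exI[of _ N])
    then show "integrable (lebesgue_on {c..d}) g"
      using f borel_measurable_cong_AE_lebesgue_on[OF borel_measurable_integrable[OF f] AE]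
      by (intro integrable_cong_AE_imp[OF f]) (auto elim: eventually_mono)
  qed
  have "(LINT x|lebesgue_on {a<..<b}. g x * \<psi> x) = (LINT x|lebesgue_on {a<..<b}. f x * \<psi> x)"
    if "\<psi> \<in> test_functions a b" for \<psi>
    using that assms(1) f g fg
    by (intro integral_cong_AE borel_measurable_integrable integrable_times_test) (auto elim: eventually_mono)
  then show ?thesis
    using g h test_function_higher_deriv[OF assms(1)]
    by (auto simp: has_weak_deriv_def loc_integrable_def)
qed

text \<open>Here the equality is exact: functions that agree almost everywhere have the same set of
  weak derivatives, so \<open>SOME\<close> picks the same member of it.\<close>

lemma wderiv_cong_AE:
  assumes "a < b" "AE x in lebesgue_on {a<..<b}. f x = g x"
  shows "wderiv a b k f = wderiv a b k g"
proof -
  have "AE x in lebesgue_on {a<..<b}. g x = f x" using assms(2) by (auto elim: eventually_mono)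
  then have "has_weak_deriv a b k f = has_weak_deriv a b k g"
    using has_weak_deriv_cong_AE assms by blast
  then show ?thesis by (simp add: wderiv_def)
qed

text \<open>The set where two continuous functions differ is open and here null, hence empty in the
  open interval; the endpoints follow by closure.\<close>

lemma continuous_AE_eq:
  fixes f g :: "real \<Rightarrow> real"
  assumes "continuous_on {a..b} f" "continuous_on {a..b} g" "a < b"
    "AE x in lebesgue_on {a<..<b}. f x = g x" "x \<in> {a..b}"
  shows "f x = g x"
proof -
  let ?h = "\<lambda>x. f x - g x"
  have cont: "continuous_on {a..b} ?h" using assms by (intro continuous_intros)
  obtain N where N: "negligible N" "\<forall>x\<in>{a<..<b} - N. f x = g x"
    using assms(4) by (auto simp: AE_lebesgue_on_iff)
  let ?U = "{a<..<b} \<inter> ?h -` (- {0})"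
  have "continuous_on {a<..<b} ?h" by (rule continuous_on_subset[OF cont]) auto
  then have "open ?U" by (intro continuous_open_preimage) auto
  moreover have "negligible ?U" using N by (intro negligible_subset[OF N(1)]) auto
  ultimately have "?U = {}" using open_not_negligible by blast
  then have h0: "?h y = 0" if "y \<in> {a<..<b}" for y using that by blast
  have closure: "closure {a<..<b} = {a..b}" using assms(3) by simp
  have "?h x = 0"
    by (rule continuous_constant_on_closure[of "{a<..<b}" ?h 0, unfolded closure, OF cont h0 assms(5)])
  then show ?thesis by simp
qed

section \<open>Continuous representatives and boundary values\<close>

definition is_trace :: "real \<Rightarrow> real \<Rightarrow> (real \<Rightarrow> real) \<Rightarrow> (real \<Rightarrow> real) \<Rightarrow> bool" where
  "is_trace a b f F \<longleftrightarrow> continuous_on {a..b} F \<and> (AE x in lebesgue_on {a<..<b}. f x = F x)"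

lemma is_trace_trace:
  assumes "is_trace a b f F" shows "is_trace a b f (trace a b f)"
  using someI_ex[of "is_trace a b f"] assms unfolding is_trace_def trace_def by blast

lemma is_trace_unique:
  assumes "is_trace a b f F" "is_trace a b f G" "a < b" "x \<in> {a..b}"
  shows "F x = G x"
proof -
  have "AE x in lebesgue_on {a<..<b}. f x = F x" "AE x in lebesgue_on {a<..<b}. f x = G x"
    using assms by (auto simp: is_trace_def)
  then have "AE x in lebesgue_on {a<..<b}. F x = G x" by eventually_elim simp
  then show ?thesis
    using assms by (intro continuous_AE_eq[of a b F G]) (auto simp: is_trace_def)
qed

lemma trace_eq: "is_trace a b f F \<Longrightarrow> a < b \<Longrightarrow> x \<in> {a..b} \<Longrightarrow> trace a b f x = F x"
  using is_trace_unique is_trace_trace by blast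

lemma trace_diff:
  assumes "a < b" "is_trace a b f F" "is_trace a b g G" "AE x in lebesgue_on {a<..<b}. h x = f x - g x" "x \<in> {a..b}"
  shows "trace a b h x = trace a b f x - trace a b g x"
proof -
  have "AE x in lebesgue_on {a<..<b}. f x = F x" "AE x in lebesgue_on {a<..<b}. g x = G x"
    using assms by (auto simp: is_trace_def)
  with assms(4) have "AE x in lebesgue_on {a<..<b}. h x = F x - G x" by eventually_elim simp
  then have "is_trace a b h (\<lambda>x. F x - G x)"
    using assms by (auto simp: is_trace_def intro!: continuous_intros)
  from trace_eq[OF this] trace_eq[OF assms(2)] trace_eq[OF assms(3)] show ?thesis
    using assms(1,5) by simp
qed

lemma trace_primitive:
  assumes "a < b" "has_weak_deriv a b 1 f g" "integrable (lebesgue_on {a<..<b}) g"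
  shows "is_trace a b f (trace a b f)"
    and "x \<in> {a..b} \<Longrightarrow> trace a b f x = trace a b f a + integral {a..x} g"
proof -
  obtain C where C: "AE x in lebesgue_on {a<..<b}. f x = C + integral {a..x} g"
    using weak_deriv_primitive[OF assms] by metis
  have "g integrable_on {a..b}"
    using assms(3) by (auto simp: integrable_open_closed intro: integrable_on_lebesgue_on)
  then have "is_trace a b f (\<lambda>x. C + integral {a..x} g)"
    unfolding is_trace_def using C
    by (intro conjI continuous_intros indefinite_integral_continuous_1) auto
  then show "is_trace a b f (trace a b f)"
    "x \<in> {a..b} \<Longrightarrow> trace a b f x = trace a b f a + integral {a..x} g"
    using trace_eq[of a b f "\<lambda>x. C + integral {a..x} g"] \<open>a < b\<close> by (auto intro: is_trace_trace)
qed

text \<open>The weak derivatives of order one and two are defined independently of each other, both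
  by testing \<open>f\<close>. They fit together because the derivative of a test function is a test
  function: hence \<open>wderiv a b 2 f\<close> is the weak derivative of
  \<open>wderiv a b 1 f\<close>, and \<open>trace_primitive\<close> applies at both levels.\<close>

lemma H2_traces:
  assumes "a < b" "f \<in> H2 a b"
  defines "D \<equiv> trace a b (wderiv a b 1 f)"
  shows "is_trace a b f (trace a b f)" "is_trace a b (wderiv a b 1 f) D"
    and "x \<in> {a..b} \<Longrightarrow> D x = D a + integral {a..x} (wderiv a b 2 f)"
    and "x \<in> {a..b} \<Longrightarrow> trace a b f x = trace a b f a + integral {a..x} D"
proof -
  have w1: "has_weak_deriv a b 1 f (wderiv a b 1 f)" "wderiv a b 1 f \<in> L2 a b"
    and w2: "has_weak_deriv a b 2 f (wderiv a b 2 f)" "wderiv a b 2 f \<in> L2 a b"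
    by (intro wderiv_H2[OF assms(1,2)]; simp)+
  have "has_weak_deriv a b 1 (wderiv a b 1 f) (wderiv a b 2 f)"
    unfolding has_weak_deriv_def
  proof (intro conjI ballI)
    show "\<forall>c d. a < c \<and> d < b \<longrightarrow> integrable (lebesgue_on {c..d}) (wderiv a b 1 f) \<and>
      integrable (lebesgue_on {c..d}) (wderiv a b 2 f)"
      using w1(1) w2(1) by (auto simp: has_weak_deriv_def)
    fix \<phi> assume \<phi>: "\<phi> \<in> test_functions a b"
    show "(LINT x|lebesgue_on {a<..<b}. wderiv a b 1 f x * (deriv ^^ 1) \<phi> x) =
         (- 1) ^ 1 * (LINT x|lebesgue_on {a<..<b}. wderiv a b 2 f x * \<phi> x)"
      using w1(1)[unfolded has_weak_deriv_def, THEN conjunct2, THEN bspec, OF test_function_deriv[OF \<phi> assms(1)]]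
        w2(1)[unfolded has_weak_deriv_def, THEN conjunct2, THEN bspec, OF \<phi>]
      by (simp add: numeral_2_eq_2)
  qed
  note D = trace_primitive[OF assms(1) this L2_integrable[OF w2(2)]]
  show "is_trace a b (wderiv a b 1 f) D" unfolding D_def by (rule D(1))
  show "x \<in> {a..b} \<Longrightarrow> D x = D a + integral {a..x} (wderiv a b 2 f)"
    unfolding D_def by (rule D(2))
  note F = trace_primitive[OF assms(1) w1(1) L2_integrable[OF w1(2)]]
  show "is_trace a b f (trace a b f)" by (rule F(1))
  obtain N where N: "negligible N" "\<forall>x\<in>{a<..<b} - N. wderiv a b 1 f x = D x"
    using D(1) by (auto simp: AE_lebesgue_on_iff is_trace_def D_def)
  have "integral {a..x} (wderiv a b 1 f) = integral {a..x} D" if "x \<in> {a..b}"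
    using N that by (intro integral_spike[of "N \<union> {a, b}"]) auto
  then show "x \<in> {a..b} \<Longrightarrow> trace a b f x = trace a b f a + integral {a..x} D"
    using F(2)[of x] by simp
qed

lemma V2_diff:
  assumes "a < b" "f \<in> V2 a b" "g \<in> V2 a b"
  shows "f - g \<in> V2 a b"
    and "x \<in> {a..b} \<Longrightarrow> trace a b (wderiv a b 1 (f - g)) x = trace a b (wderiv a b 1 f) x - trace a b (wderiv a b 1 g) x"
proof -
  have H2: "f \<in> H2 a b" "g \<in> H2 a b" using assms by (auto simp: V2_def)
  note tr = H2_traces(1,2)[OF assms(1) H2(1)] H2_traces(1,2)[OF assms(1) H2(2)]
  show "f - g \<in> V2 a b"
    using assms trace_diff[OF assms(1) tr(1,3), of "f - g"] wderiv_diff(2)[OF assms(1) H2, of 1]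
    by (simp add: V2_def)
  show "x \<in> {a..b} \<Longrightarrow> trace a b (wderiv a b 1 (f - g)) x = trace a b (wderiv a b 1 f) x - trace a b (wderiv a b 1 g) x"
    by (rule trace_diff[OF assms(1) tr(2,4) wderiv_diff(1)[OF assms(1) H2]]) auto
qed

section \<open>Poincare inequalities with explicit constants\<close>

lemma integral_square_bound:
  assumes "g \<in> L2 a b" "a \<le> c" "c \<le> d" "d \<le> b"
  shows "(integral {c..d} g)\<^sup>2 \<le> (d - c) * (L2_norm a b g)\<^sup>2"
proof -
  let ?M = "lebesgue_on {c<..<d}"
  have int: "integrable (lebesgue_on {a<..<b}) g" "integrable (lebesgue_on {a<..<b}) (\<lambda>x. (g x)\<^sup>2)"

    using L2_integrable[OF assms(1)] assms(1) by (simp_all add: L2_def)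
  have int': "integrable ?M g" "integrable ?M (\<lambda>x. (g x)\<^sup>2)"
    using int assms by (auto intro: integrable_on_subset[of "{a<..<b}"])
  have "(LINT x|?M. 1 * g x)\<^sup>2 \<le> (LINT x|?M. 1\<^sup>2) * (LINT x|?M. (g x)\<^sup>2)"
    using int' by (intro Cauchy_Schwarz_integral) (auto simp: integrable_lebesgue_on_iff)
  moreover have "(LINT x|?M. 1\<^sup>2) = d - c"
    using assms by (simp add: measure_restrict_space)
  moreover have "(LINT x|?M. (g x)\<^sup>2) \<le> (L2_norm a b g)\<^sup>2"
  proof -
    have "integral {c..d} (\<lambda>x. (g x)\<^sup>2) \<le> integral {a..b} (\<lambda>x. (g x)\<^sup>2)"
      using int int' assms by (intro integral_subset_le)
        (auto simp: integrable_open_closed intro: integrable_on_lebesgue_on)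
    then show ?thesis using int int' by (simp add: L2_norm_power2 integral_open_eq)
  qed
  ultimately show ?thesis
    using int' assms mult_left_mono[of "LINT x|?M. (g x)\<^sup>2" "(L2_norm a b g)\<^sup>2" "d - c"]
    by (simp add: integral_open_eq)
qed

text \<open>This integrates the linear majorant; \<open>e\<close> is the endpoint at which it
  vanishes, and the two cases of \<open>?P\<close> are its primitives for the left and for the right
  endpoint.\<close>

lemma integral_linear_bound:
  fixes h :: "real \<Rightarrow> real"
  assumes "c \<le> d" "continuous_on {c..d} h" and "\<And>x. x \<in> {c..d} \<Longrightarrow> h x \<le> \<bar>x - e\<bar> * N" "e \<in> {c, d}"
  shows "integral {c..d} h \<le> (d - c)\<^sup>2 / 2 * N"
proof -
  let ?P = "\<lambda>x. (if e = c then (x - c)\<^sup>2 / 2 * N else - (d - x)\<^sup>2 / 2 * N)"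
  have "((\<lambda>x. \<bar>x - e\<bar> * N) has_integral ?P d - ?P c) {c..d}"
  proof (rule fundamental_theorem_of_calculus[OF assms(1)])
    fix x assume "x \<in> {c..d}"
    then show "(?P has_vector_derivative \<bar>x - e\<bar> * N) (at x within {c..d})"
      using assms(4) unfolding has_real_derivative_iff_has_vector_derivative[symmetric]
      by (cases "e = c") (auto intro!: derivative_eq_intros simp: field_simps)
  qed
  moreover have "(h has_integral integral {c..d} h) {c..d}"
    using assms by (intro integrable_integral integrable_continuous_real)
  ultimately have "integral {c..d} h \<le> ?P d - ?P c"
    using has_integral_le assms(3) by blast
  also have "\<dots> = (d - c)\<^sup>2 / 2 * N" using assms(4) by auto
  finally show ?thesis .
qed

text \<open>Since \<open>v\<close> vanishes at both ends, Rolle gives a zero \<xi> of v'.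
  Integrating v'' from \<xi> bounds v'(x)^2 by |x - \<xi>| N. Integrating this bound, and then v'
  from \<open>a\<close>, produces two factors (b - a)^2 / 2, whose product is the constant (b - a)^4
  / 4.\<close>

lemma V2_bounds:
  assumes "a < b" "v \<in> V2 a b"
  defines "N \<equiv> (L2_norm a b (wderiv a b 2 v))\<^sup>2"
  shows "x \<in> {a..b} \<Longrightarrow> (trace a b (wderiv a b 1 v) x)\<^sup>2 \<le> (b - a) * N"
    and "(L2_norm a b v)\<^sup>2 \<le> (b - a) ^ 4 / 4 * N"
proof -
  define F D where "F = trace a b v" and "D = trace a b (wderiv a b 1 v)"
  have H2: "v \<in> H2 a b" using assms by (simp add: V2_def)
  note tr = H2_traces[OF assms(1) H2, folded F_def D_def]
  have F0: "F a = 0" "F b = 0" using assms by (auto simp: V2_def F_def)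
  have contF: "continuous_on {a..b} F" and contD: "continuous_on {a..b} D"
    using tr by (auto simp: is_trace_def)
  have F: "F x = integral {a..x} D" if "x \<in> {a..b}" for x using tr(4)[OF that] F0 by simp
  have w2: "wderiv a b 2 v \<in> L2 a b" using wderiv_H2[OF assms(1) H2] by simp
  \<comment> \<open>\<open>v\<close> is only a class of functions, but its continuous representative
    \<open>F\<close> is the primitive of the continuous \<open>D\<close>, hence differentiable
    inside the interval, and Rolle applies to it.\<close>
  have "\<exists>\<xi>>a. \<xi> < b \<and> D \<xi> = 0"
  proof -
    have der: "(F has_real_derivative D x) (at x)" if "a < x" "x < b" for x
    proof -
      have "((\<lambda>x. integral {a..x} D) has_real_derivative D x) (at x within {a..b})"
        using that by (intro integral_has_real_derivative contD) auto
      then have "((\<lambda>x. integral {a..x} D) has_real_derivative D x) (at x)"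
        using that by (simp add: at_within_Icc_at)
      then show ?thesis
        by (rule has_field_derivative_transform_within_open[of _ _ _ "{a<..<b}"]) (use that F in auto)
    qed
    have "\<exists>\<xi>>a. \<xi> < b \<and> (\<lambda>h. D \<xi> * h) = (\<lambda>h. 0)"
      by (rule Rolle_deriv[OF assms(1) _ contF]) (use F0 der in \<open>auto simp: has_field_derivative_def\<close>)
    then show ?thesis by (metis mult.right_neutral)
  qed
  then obtain \<xi> where \<xi>: "a < \<xi>" "\<xi> < b" "D \<xi> = 0" by blast
  have Dx: "(D x)\<^sup>2 \<le> \<bar>x - \<xi>\<bar> * N" if x: "x \<in> {a..b}" for x
  proof -
    have int: "wderiv a b 2 v integrable_on {a..b}"
      using L2_integrable[OF w2] by (auto simp: integrable_open_closed intro: integrable_on_lebesgue_on)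
    have D': "D d = D c + integral {c..d} (wderiv a b 2 v)" if "a \<le> c" "c \<le> d" "d \<le> b" for c d
    proof -
      have "integral {a..d} (wderiv a b 2 v) = integral {a..c} (wderiv a b 2 v) + integral {c..d} (wderiv a b 2 v)"
        using that int by (intro Henstock_Kurzweil_Integration.integral_combine[symmetric])
          (auto intro: integrable_on_subinterval)
      then show ?thesis using tr(3)[of c] tr(3)[of d] that by simp
    qed
    show ?thesis
    proof (cases "x \<le> \<xi>")
      case True
      then have "D x = - integral {x..\<xi>} (wderiv a b 2 v)" using D'[of x \<xi>] x \<xi> by simp
      then show ?thesis
        using integral_square_bound[OF w2, of x \<xi>] True x \<xi> by (simp add: N_def)
    next
      case False
      then have "D x = integral {\<xi>..x} (wderiv a b 2 v)" using D'[of \<xi> x] x \<xi> by simp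
      then show ?thesis
        using integral_square_bound[OF w2, of \<xi> x] False x \<xi> by (simp add: N_def)
    qed
  qed
  have "N \<ge> 0" by (simp add: N_def)
  show "(trace a b (wderiv a b 1 v) x)\<^sup>2 \<le> (b - a) * N" if "x \<in> {a..b}"
  proof -
    have "(D x)\<^sup>2 \<le> \<bar>x - \<xi>\<bar> * N" using Dx that by blast
    also have "\<dots> \<le> (b - a) * N" using that \<xi> \<open>N \<ge> 0\<close> by (intro mult_right_mono) auto
    finally show ?thesis by (simp add: D_def)
  qed
  define I where "I = integral {a..b} (\<lambda>x. (D x)\<^sup>2)"
  have contD2: "continuous_on {a..b} (\<lambda>x. (D x)\<^sup>2)" by (intro continuous_intros contD)
  have "I = integral {a..\<xi>} (\<lambda>x. (D x)\<^sup>2) + integral {\<xi>..b} (\<lambda>x. (D x)\<^sup>2)"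
    unfolding I_def using \<xi> integrable_continuous_real[OF contD2]
    by (intro Henstock_Kurzweil_Integration.integral_combine[symmetric]) auto
  also have "\<dots> \<le> (\<xi> - a)\<^sup>2 / 2 * N + (b - \<xi>)\<^sup>2 / 2 * N"
    using \<xi> by (intro add_mono integral_linear_bound[where e = \<xi>] continuous_on_subset[OF contD2] Dx) auto
  \<comment> \<open>The position of \<xi> is unknown; the squares of two adjacent lengths add up to
    at most the square of their sum.\<close>
  also have "\<dots> \<le> (b - a)\<^sup>2 / 2 * N"
  proof -
    have "(\<xi> - a)\<^sup>2 + (b - \<xi>)\<^sup>2 \<le> ((\<xi> - a) + (b - \<xi>))\<^sup>2"
      using \<xi> by (subst power2_sum) simp
    then have "((\<xi> - a)\<^sup>2 + (b - \<xi>)\<^sup>2) / 2 * N \<le> (b - a)\<^sup>2 / 2 * N"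
      using \<open>N \<ge> 0\<close> by (intro mult_right_mono divide_right_mono) auto
    then show ?thesis by (simp add: algebra_simps add_divide_distrib)
  qed
  finally have I: "I \<le> (b - a)\<^sup>2 / 2 * N" .
  have cont_int: "integrable (lebesgue_on {a<..<b}) h" if "continuous_on {a..b} h" for h :: "real \<Rightarrow> real"
    using continuous_imp_integrable_real[OF that] by (simp add: integrable_open_closed)
  have DL2: "D \<in> L2 a b"
    using cont_int[OF contD] cont_int[OF contD2] by (auto simp: L2_def)
  have "I = (L2_norm a b D)\<^sup>2"
    using cont_int[OF contD2] by (simp add: L2_norm_power2 integral_open_eq I_def)
  then have Fx: "(F x)\<^sup>2 \<le> \<bar>x - a\<bar> * I" if "x \<in> {a..b}" for x
    using integral_square_bound[OF DL2, of a x] that by (simp add: F)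
  have "(L2_norm a b v)\<^sup>2 = (LINT x|lebesgue_on {a<..<b}. (F x)\<^sup>2)"
    unfolding L2_norm_power2
  proof (rule integral_cong_AE)
    show "(\<lambda>x. (v x)\<^sup>2) \<in> borel_measurable (lebesgue_on {a<..<b})"
      using H2 by (auto simp: H2_def L2_def)
    show "(\<lambda>x. (F x)\<^sup>2) \<in> borel_measurable (lebesgue_on {a<..<b})"
      by (intro borel_measurable_integrable cont_int continuous_intros contF)
    show "AE x in lebesgue_on {a<..<b}. (v x)\<^sup>2 = (F x)\<^sup>2"
      using tr(1) by (auto simp: is_trace_def elim: eventually_mono)
  qed
  also have "\<dots> = integral {a..b} (\<lambda>x. (F x)\<^sup>2)"
    by (intro integral_open_eq cont_int continuous_intros contF)
  also have "\<dots> \<le> (b - a)\<^sup>2 / 2 * I"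
    using assms(1) Fx by (intro integral_linear_bound[where e = a] continuous_intros contF) auto
  also have "\<dots> \<le> (b - a)\<^sup>2 / 2 * ((b - a)\<^sup>2 / 2 * N)"
    using I by (intro mult_left_mono) auto
  also have "\<dots> = (b - a) ^ 4 / 4 * N" by (simp add: power2_eq_square power4_eq_xxxx)
  finally show "(L2_norm a b v)\<^sup>2 \<le> (b - a) ^ 4 / 4 * N" .
qed

text \<open>Test functions have to be admissible in the weak equation in order to identify the
  initial velocity. The formula is k-fold integration by parts, obtained from
  \<open>integral_primitive_test\<close> because a test function is the primitive of its own
  derivative.\<close>

lemma test_function_weak_deriv:
  assumes "a < b" "\<phi> \<in> test_functions a b"
  shows "has_weak_deriv a b k \<phi> ((deriv ^^ k) \<phi>)"
proof -
  have test_int: "integrable (lebesgue_on {c..d}) \<psi>" if "\<psi> \<in> test_functions a b" for c d \<psi>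
    using that by (auto simp: test_functions_iff intro: continuous_imp_integrable_real smooth_continuous_on)
  have by_parts: "(LINT x|lebesgue_on {a<..<b}. f x * deriv \<psi> x) = - (LINT x|lebesgue_on {a<..<b}. deriv f x * \<psi> x)"
    if f: "f \<in> test_functions a b" and \<psi>: "\<psi> \<in> test_functions a b" for f \<psi>
  proof -
    have "integral {a..x} (deriv f) = f x" if "x \<in> {a<..<b}" for x
    proof -
      have "(deriv f has_integral f x - f a) {a..x}"
        using that smooth_has_deriv f
        by (intro fundamental_theorem_of_calculus)
          (auto simp: test_functions_iff has_real_derivative_iff_has_vector_derivative[symmetric]
            intro: has_field_derivative_at_within)
      moreover obtain c d where "a < c" "\<And>x. x \<notin> {c..d} \<Longrightarrow> f x = 0"
        using test_function_support[OF f assms(1)] by metis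
      then have "f a = 0" by auto
      ultimately show ?thesis by (simp add: integral_unique)
    qed
    then have "(LINT x|lebesgue_on {a<..<b}. f x * deriv \<psi> x) = (LINT x|lebesgue_on {a<..<b}. integral {a..x} (deriv f) * deriv \<psi> x)"
      by (intro Bochner_Integration.integral_cong) auto
    also have "\<dots> = - (LINT x|lebesgue_on {a<..<b}. deriv f x * \<psi> x)"
      by (intro integral_primitive_test assms integrable_test test_function_deriv f \<psi>)
    finally show ?thesis .
  qed
  have "(LINT x|lebesgue_on {a<..<b}. \<phi> x * (deriv ^^ k) \<psi> x) = (- 1) ^ k * (LINT x|lebesgue_on {a<..<b}. (deriv ^^ k) \<phi> x * \<psi> x)"
    if "\<psi> \<in> test_functions a b" for \<psi>
    using that
  proof (induction k arbitrary: \<psi>)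
    case (Suc k)
    have "(LINT x|lebesgue_on {a<..<b}. \<phi> x * (deriv ^^ Suc k) \<psi> x)
        = (LINT x|lebesgue_on {a<..<b}. \<phi> x * (deriv ^^ k) (deriv \<psi>) x)"
      by (simp only: funpow_Suc_right o_apply)
    also have "\<dots> = (- 1) ^ k * (LINT x|lebesgue_on {a<..<b}. (deriv ^^ k) \<phi> x * deriv \<psi> x)"
      using Suc test_function_deriv assms(1) by blast
    also have "\<dots> = (- 1) ^ Suc k * (LINT x|lebesgue_on {a<..<b}. (deriv ^^ Suc k) \<phi> x * \<psi> x)"
      using by_parts[OF test_function_higher_deriv[OF assms] Suc.prems] by simp
    finally show ?case .
  qed simp
  then show ?thesis
    using test_int assms test_function_higher_deriv by (auto simp: has_weak_deriv_def)
qed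

lemma test_function_V2:
  assumes "a < b" "\<phi> \<in> test_functions a b"
  shows "\<phi> \<in> V2 a b"
proof -
  have L2: "\<psi> \<in> L2 a b" if "\<psi> \<in> test_functions a b" for \<psi>
  proof -
    have "smooth \<psi>" using that by (simp add: test_functions_iff)
    then have "continuous_on {a..b} \<psi>" "continuous_on {a..b} (\<lambda>x. (\<psi> x)\<^sup>2)"
      by (auto intro: continuous_on_power smooth_continuous_on)
    then have "integrable (lebesgue_on {a<..<b}) \<psi>" "integrable (lebesgue_on {a<..<b}) (\<lambda>x. (\<psi> x)\<^sup>2)"
      unfolding integrable_open_closed by (auto intro: continuous_imp_integrable_real)
    then show ?thesis by (simp add: L2_def)
  qed
  then have "\<phi> \<in> H2 a b"
    using assms test_function_weak_deriv test_function_higher_deriv unfolding H2_def by blast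
  moreover have "is_trace a b \<phi> \<phi>"
    using assms(2) by (auto simp: is_trace_def test_functions_iff smooth_continuous_on)
  moreover obtain c d where "a < c" "d < b" "\<And>x. x \<notin> {c..d} \<Longrightarrow> \<phi> x = 0"
    using test_function_support[OF assms(2,1)] by metis
  then have "\<phi> a = 0" "\<phi> b = 0" by auto
  ultimately show ?thesis
    using trace_eq assms(1) by (simp add: V2_def)
qed

section \<open>The Lyapunov argument for scalar kernels\<close>

text \<open>Only increments over short intervals are controlled, up to an error \<open>e\<close> per
  unit of time. Summing them over a fine partition and letting \<open>e\<close> tend to 0 gives
  monotonicity without differentiating \<open>F\<close>.\<close>

lemma nonincreasing_from_local:
  fixes F :: "real \<Rightarrow> real"
  assumes loc: "\<And>e. e > 0 \<Longrightarrow> \<exists>d>0. \<forall>s t. a \<le> s \<and> s < t \<and> t \<le> b \<and> t - s < d \<longrightarrow> F t - F s \<le> e * (t - s)"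
    and "a \<le> b"
  shows "F b \<le> F a"
proof (cases "a = b")
  case False
  then have "a < b" using assms(2) by simp
  have "F b - F a \<le> e" if "e > 0" for e
  proof -
    have e': "e / (b - a) > 0" using \<open>a < b\<close> that by simp
    obtain d where d: "d > 0"
      "\<And>s t. a \<le> s \<Longrightarrow> s < t \<Longrightarrow> t \<le> b \<Longrightarrow> t - s < d \<Longrightarrow> F t - F s \<le> e / (b - a) * (t - s)"
      using loc[OF e'] by blast
    obtain n where n: "(b - a) / d < real n" using reals_Archimedean2 by blast
    define h where "h = (b - a) / real n"
    have "n > 0" using n \<open>a < b\<close> d(1) by (metis divide_pos_pos diff_gt_0_iff_gt of_nat_0 not_gr_zero order.asym)
    then have h: "h > 0" "h < d" "real n * h = b - a"
      using n \<open>a < b\<close> d(1) by (auto simp: h_def field_simps)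
    have "i \<le> n \<Longrightarrow> F (a + real i * h) - F a \<le> e / (b - a) * (real i * h)" for i
    proof (induction i)
      case (Suc i)
      have "real (Suc i) * h \<le> real n * h" using Suc.prems h(1) by (intro mult_right_mono) auto
      then have le: "a + real (Suc i) * h \<le> b" using h(3) by simp
      have "F (a + real (Suc i) * h) - F (a + real i * h) \<le> e / (b - a) * ((a + real (Suc i) * h) - (a + real i * h))"
        using h le by (intro d(2)) (auto simp: algebra_simps)
      also have "(a + real (Suc i) * h) - (a + real i * h) = h" by (simp add: algebra_simps)
      finally show ?case using Suc by (simp add: algebra_simps)
    qed simp
    from this[of n] show ?thesis using h(3) \<open>a < b\<close> by simp
  qed
  then show ?thesis using field_le_epsilon[of "F b" "F a"] by (simp add: algebra_simps)
qed simp

lemma integral_near_const: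
  fixes f :: "real \<Rightarrow> real"
  assumes "continuous_on {a..b} f" "a \<le> b" "\<And>x. x \<in> {a..b} \<Longrightarrow> \<bar>f x - c\<bar> \<le> e"
  shows "\<bar>integral {a..b} f - (b - a) * c\<bar> \<le> (b - a) * e"
proof -
  have "f integrable_on {a..b}" using assms(1) by (rule integrable_continuous_real)
  then have "integral {a..b} (\<lambda>x. f x - c) = integral {a..b} f - (b - a) * c"
    using assms(2) Henstock_Kurzweil_Integration.integral_diff[OF _ integrable_const_ivl, of f a b c] by simp
  moreover have "norm (integral {a..b} (\<lambda>x. f x - c)) \<le> e * (b - a)"
    using assms by (intro integral_bound continuous_intros) auto
  ultimately show ?thesis by (simp add: mult.commute)
qed

lemma integral_initial_diff:
  fixes f :: "real \<Rightarrow> real"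
  assumes "continuous_on {0..T} f" "0 \<le> a" "a \<le> b" "b \<le> T"
  shows "integral {0..b} f - integral {0..a} f = integral {a..b} f"
proof -
  have "continuous_on {0..b} f" using assms by (auto intro: continuous_on_subset)
  then show ?thesis
    using Henstock_Kurzweil_Integration.integral_combine[of 0 a b f] assms integrable_continuous_real
    by fastforce
qed

section \<open>Jointly continuous kernels and their primitives\<close>

definition continuous_kernel :: "real \<Rightarrow> (real \<Rightarrow> real \<Rightarrow> real) \<Rightarrow> bool" where
  "continuous_kernel T C \<longleftrightarrow> continuous_on ({0..T} \<times> {0..T}) (\<lambda>(x, y). C x y)"

lemma continuous_kernel_uniform:
  assumes "continuous_kernel T C" "e > 0"
  obtains d where "d > 0"
    "\<And>x y x' y'. x \<in> {0..T} \<Longrightarrow> y \<in> {0..T} \<Longrightarrow> x' \<in> {0..T} \<Longrightarrow> y' \<in> {0..T} \<Longrightarrow>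
       \<bar>x - x'\<bar> < d \<Longrightarrow> \<bar>y - y'\<bar> < d \<Longrightarrow> \<bar>C x y - C x' y'\<bar> < e"
proof -
  have "uniformly_continuous_on ({0..T} \<times> {0..T}) (\<lambda>(x, y). C x y)"
    using assms by (intro compact_uniformly_continuous compact_Times) (auto simp: continuous_kernel_def)
  then obtain d where d: "d > 0" "\<And>p q. p \<in> {0..T} \<times> {0..T} \<Longrightarrow> q \<in> {0..T} \<times> {0..T} \<Longrightarrow> dist q p < d \<Longrightarrow>
      dist (case q of (x, y) \<Rightarrow> C x y) (case p of (x, y) \<Rightarrow> C x y) < e"
    using assms(2) unfolding uniformly_continuous_on_def by meson
  have "\<bar>C x y - C x' y'\<bar> < e" if "x \<in> {0..T}" "y \<in> {0..T}" "x' \<in> {0..T}" "y' \<in> {0..T}"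
    "\<bar>x - x'\<bar> < d / 2" "\<bar>y - y'\<bar> < d / 2" for x y x' y'
  proof -
    have "dist (x, y) (x', y') \<le> \<bar>x - x'\<bar> + \<bar>y - y'\<bar>"
      unfolding dist_Pair_Pair dist_real_def by (rule sqrt_sum_squares_le_sum_abs[THEN order_trans]) simp
    then show ?thesis using d(2)[of "(x', y')" "(x, y)"] that by (auto simp: dist_real_def)
  qed
  then show thesis using d(1) by (intro that[of "d / 2"]) auto
qed

lemma continuous_kernel_comp:
  assumes "continuous_kernel T C" "continuous_on S f" "continuous_on S g" "f ` S \<subseteq> {0..T}" "g ` S \<subseteq> {0..T}"
  shows "continuous_on S (\<lambda>x. C (f x) (g x))"
  using continuous_on_compose2[of _ "\<lambda>(x, y). C x y" S "\<lambda>x. (f x, g x)"] assms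
  by (auto simp: continuous_kernel_def intro!: continuous_on_Pair)

lemma continuous_kernel_sections:
  assumes "continuous_kernel T C" "S \<subseteq> {0..T}"
  shows "z \<in> {0..T} \<Longrightarrow> continuous_on S (\<lambda>x. C x z)"
    and "z \<in> {0..T} \<Longrightarrow> continuous_on S (C z)"
    and "continuous_on S (\<lambda>x. C x x)"
  by (rule continuous_kernel_comp[OF assms(1)]; use assms(2) in \<open>auto intro: continuous_intros\<close>)+

lemma continuous_kernel_add:
  "continuous_kernel T C \<Longrightarrow> continuous_kernel T D \<Longrightarrow> continuous_kernel T (\<lambda>x y. C x y + D x y)"
  unfolding continuous_kernel_def by (auto simp: case_prod_beta intro: continuous_on_add)

lemma continuous_kernel_diff:
  "continuous_kernel T C \<Longrightarrow> continuous_kernel T D \<Longrightarrow> continuous_kernel T (\<lambda>x y. C x y - D x y)"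
  unfolding continuous_kernel_def by (auto simp: case_prod_beta intro: continuous_on_diff)

lemma continuous_kernel_cmult:
  "continuous_kernel T C \<Longrightarrow> continuous_kernel T (\<lambda>x y. c * C x y)"
  unfolding continuous_kernel_def by (auto simp: case_prod_beta intro: continuous_on_mult_left)

text \<open>Moving \<open>x\<close> changes the integral by at most \<open>T\<close> times the
  oscillation of \<open>C\<close>; moving \<open>t\<close> with \<open>x\<close> fixed is the
  continuity of a single primitive.\<close>

lemma continuous_kernel_primitive:
  assumes C: "continuous_kernel T C"
  shows "continuous_kernel T (\<lambda>x t. integral {0..t} (C x))"
  unfolding continuous_kernel_def continuous_on_iff
proof (intro ballI allI impI)
  fix p and e :: real assume p: "p \<in> {0..T} \<times> {0..T}" and "e > 0"
  obtain x0 t0 where p_eq: "p = (x0, t0)" by (cases p)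
  then have x0: "x0 \<in> {0..T}" and t0: "t0 \<in> {0..T}" using p by auto
  then have "T \<ge> 0" by simp
  \<comment> \<open>Only T \<ge> 0 is known here, hence T + 1 in the denominator; moving the first
    argument then costs less than half of \<open>e\<close>.\<close>
  define e1 where "e1 = e / (2 * (T + 1))"
  have e1: "e1 > 0" "T * e1 < e / 2" using \<open>e > 0\<close> \<open>T \<ge> 0\<close> by (auto simp: e1_def field_simps)
  obtain d1 where d1: "d1 > 0"
    "\<And>x y x' y'. x \<in> {0..T} \<Longrightarrow> y \<in> {0..T} \<Longrightarrow> x' \<in> {0..T} \<Longrightarrow> y' \<in> {0..T} \<Longrightarrow>
       \<bar>x - x'\<bar> < d1 \<Longrightarrow> \<bar>y - y'\<bar> < d1 \<Longrightarrow> \<bar>C x y - C x' y'\<bar> < e1"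
    using continuous_kernel_uniform[OF C e1(1)] by metis
  have "continuous_on {0..T} (\<lambda>t. integral {0..t} (C x0))"
    using C x0 by (intro indefinite_integral_continuous_1 integrable_continuous_real continuous_kernel_sections) auto
  then obtain d2 where d2: "d2 > 0" "\<And>t. t \<in> {0..T} \<Longrightarrow> \<bar>t - t0\<bar> < d2 \<Longrightarrow>
      \<bar>integral {0..t} (C x0) - integral {0..t0} (C x0)\<bar> < e / 2"
    using t0 \<open>e > 0\<close> unfolding continuous_on_iff dist_real_def by (metis half_gt_zero)
  show "\<exists>d>0. \<forall>q\<in>{0..T} \<times> {0..T}. dist q p < d \<longrightarrow>
      dist (case q of (x, t) \<Rightarrow> integral {0..t} (C x)) (case p of (x, t) \<Rightarrow> integral {0..t} (C x)) < e"
  proof (intro exI[of _ "min d1 d2"] conjI ballI impI)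
    fix q assume q: "q \<in> {0..T} \<times> {0..T}" "dist q p < min d1 d2"
    obtain x t where q_eq: "q = (x, t)" by (cases q)
    then have x: "x \<in> {0..T}" and t: "t \<in> {0..T}" using q by auto
    have "\<bar>x - x0\<bar> < d1" "\<bar>t - t0\<bar> < d2"
      using q(2) dist_fst_le[of q p] dist_snd_le[of q p] by (auto simp: q_eq p_eq dist_real_def)
    have int: "C z integrable_on {0..t}" if "z \<in> {0..T}" for z
      using C t that by (intro integrable_continuous_real continuous_kernel_sections) auto
    have "\<bar>integral {0..t} (\<lambda>y. C x y - C x0 y) - (t - 0) * 0\<bar> \<le> (t - 0) * e1"
    proof (rule integral_near_const)
      show "continuous_on {0..t} (\<lambda>y. C x y - C x0 y)"
        using C t x x0 by (intro continuous_intros continuous_kernel_sections) auto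
      show "\<bar>C x y - C x0 y - 0\<bar> \<le> e1" if "y \<in> {0..t}" for y
        using d1(2)[of x y x0 y] \<open>\<bar>x - x0\<bar> < d1\<close> that x x0 t d1(1) by auto
    qed (use t in auto)
    also have "(t - 0) * e1 \<le> T * e1" using t e1 by (intro mult_right_mono) auto
    finally have "\<bar>integral {0..t} (C x) - integral {0..t} (C x0)\<bar> \<le> T * e1"
      using int[OF x] int[OF x0] by (simp add: Henstock_Kurzweil_Integration.integral_diff)
    then show "dist (case q of (x, t) \<Rightarrow> integral {0..t} (C x)) (case p of (x, t) \<Rightarrow> integral {0..t} (C x)) < e"
      using d2(2)[OF t \<open>\<bar>t - t0\<bar> < d2\<close>] e1(2)
      unfolding q_eq p_eq dist_real_def prod.case by linarith
  qed (use d1 d2 in auto)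
qed

text \<open>A first-order expansion of the integral over a rectangle when both sides grow by
  \<open>s\<close>: \<open>g a b\<close> is its derivative in the first side and, by symmetry of
  \<open>C\<close>, \<open>g b a\<close> that in the second. The bound \<open>d\<close> is uniform
  in \<open>a\<close> and \<open>b\<close>, because the corners move with time in the
  application.\<close>

lemma double_primitive_increment:
  assumes C: "continuous_kernel T C"
    and sym: "\<And>x y. x \<in> {0..T} \<Longrightarrow> y \<in> {0..T} \<Longrightarrow> C x y = C y x"
    and "e > 0"
  defines "\<Phi> \<equiv> \<lambda>a b. integral {0..a} (\<lambda>x. integral {0..b} (C x))"
    and "g \<equiv> \<lambda>x t. integral {0..t} (C x)"
  obtains d where "d > 0" "\<And>a b s. a \<ge> 0 \<Longrightarrow> b \<ge> 0 \<Longrightarrow> 0 \<le> s \<Longrightarrow> s < d \<Longrightarrow> a + s \<le> T \<Longrightarrow> b + s \<le> T \<Longrightarrow>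
    \<bar>\<Phi> (a + s) (b + s) - \<Phi> a b - s * (g a b + g b a)\<bar> \<le> s * e"
proof -
  have g: "continuous_kernel T g" unfolding g_def by (rule continuous_kernel_primitive[OF C])
  have \<Phi>_eq: "\<Phi> a b = integral {0..a} (\<lambda>x. g x b)" for a b by (simp add: \<Phi>_def g_def)
  have \<Phi>_sym: "\<Phi> a b = \<Phi> b a" if ab: "a \<in> {0..T}" "b \<in> {0..T}" for a b
  proof -
    have "continuous_on (cbox (0, 0) (a, b)) (\<lambda>(x, y). C x y)"
      using C ab unfolding continuous_kernel_def cbox_Pair_eq box_real
      by (elim continuous_on_subset) auto
    then have "\<Phi> a b = integral {0..b} (\<lambda>y. integral {0..a} (\<lambda>x. C x y))"
      unfolding \<Phi>_def using integral_swap_continuous[of 0 0 a b C] by simp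
    also have "\<dots> = \<Phi> b a"
      unfolding \<Phi>_def using ab by (intro Henstock_Kurzweil_Integration.integral_cong sym) auto
    finally show ?thesis .
  qed
  obtain d where d: "d > 0"
    "\<And>x y x' y'. x \<in> {0..T} \<Longrightarrow> y \<in> {0..T} \<Longrightarrow> x' \<in> {0..T} \<Longrightarrow> y' \<in> {0..T} \<Longrightarrow>
       \<bar>x - x'\<bar> < d \<Longrightarrow> \<bar>y - y'\<bar> < d \<Longrightarrow> \<bar>g x y - g x' y'\<bar> < e / 2"
    using continuous_kernel_uniform[OF g, of "e / 2"] \<open>e > 0\<close> by (metis half_gt_zero)
  have "\<bar>\<Phi> (a + s) (b + s) - \<Phi> a b - s * (g a b + g b a)\<bar> \<le> s * e"
    if "a \<ge> 0" "b \<ge> 0" "0 \<le> s" "s < d" "a + s \<le> T" "b + s \<le> T" for a b s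
  proof -
    \<comment> \<open>One side moves at a time; \<open>q'\<close> may differ from \<open>q\<close>
      so that the first move can be made with the other side already at b + s.\<close>
    have part: "\<bar>\<Phi> (p + s) q' - \<Phi> p q' - s * g p q\<bar> \<le> s * (e / 2)"
      if "0 \<le> p" "p + s \<le> T" "q \<in> {0..T}" "q' \<in> {0..T}" "\<bar>q' - q\<bar> < d" for p q q'
    proof -
      have "\<Phi> (p + s) q' - \<Phi> p q' = integral {p..p + s} (\<lambda>x. g x q')"
        unfolding \<Phi>_eq using that \<open>0 \<le> s\<close> g
        by (intro integral_initial_diff continuous_kernel_sections) auto
      moreover have "\<bar>integral {p..p + s} (\<lambda>x. g x q') - (p + s - p) * g p q\<bar> \<le> (p + s - p) * (e / 2)"
      proof (rule integral_near_const)
        show "\<bar>g x q' - g p q\<bar> \<le> e / 2" if "x \<in> {p..p + s}" for x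
          using that \<open>s < d\<close> \<open>0 \<le> s\<close> \<open>0 \<le> p\<close> \<open>p + s \<le> T\<close> \<open>q \<in> {0..T}\<close> \<open>q' \<in> {0..T}\<close> \<open>\<bar>q' - q\<bar> < d\<close>
          by (intro less_imp_le d(2)) auto
      qed (use that \<open>0 \<le> s\<close> g in \<open>auto intro: continuous_kernel_sections\<close>)
      ultimately show ?thesis by simp
    qed
    have "\<bar>\<Phi> (a + s) (b + s) - \<Phi> a (b + s) - s * g a b\<bar> \<le> s * (e / 2)"
      using that by (intro part) auto
    moreover have "\<bar>\<Phi> (b + s) a - \<Phi> b a - s * g b a\<bar> \<le> s * (e / 2)"
      using that d(1) by (intro part) auto
    moreover have "\<Phi> (b + s) a = \<Phi> a (b + s)" "\<Phi> b a = \<Phi> a b"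
      using that by (auto intro!: \<Phi>_sym)
    ultimately show ?thesis unfolding distrib_left by (simp only:)
  qed
  then show thesis using that d(1) by blast
qed

text \<open>For fixed \<open>t\<close>, the hypothesis on [s, t] bounds \<open>P\<close> by L s +
  \<sigma> I s, and \<open>L\<close> is the derivative of \<open>I\<close>. The integrating factor
  can therefore be applied to \<sigma> I - P, whose values at 0 and t are -P and -L t, and
  \<open>L\<close> itself is never differentiated.\<close>

lemma gronwall_decay:
  fixes L :: "real \<Rightarrow> real"
  assumes L: "continuous_on {0..T} L" and "\<sigma> > 0"
    and dec: "\<And>s t. 0 \<le> s \<Longrightarrow> s \<le> t \<Longrightarrow> t \<le> T \<Longrightarrow> L t - L s \<le> - \<sigma> * integral {s..t} L"
    and t: "t \<in> {0..T}"
  shows "L t \<le> exp (- \<sigma> * t) * L 0"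
proof -
  define I where "I s = integral {0..s} L" for s
  define P where "P = L t + \<sigma> * I t"
  have P: "P \<le> L s + \<sigma> * I s" if "0 \<le> s" "s \<le> t" for s
  proof -
    have "I t - I s = integral {s..t} L"
      unfolding I_def using that t L by (intro integral_initial_diff) auto
    then show ?thesis using dec[of s t] that t by (simp add: P_def algebra_simps)
  qed
  define W where "W s = exp (\<sigma> * s) * (\<sigma> * I s - P)" for s
  have Lt: "continuous_on {0..t} L" using L t by (auto intro: continuous_on_subset)
  have "W 0 \<le> W t"
  proof (rule DERIV_nonneg_imp_increasing_open[where f = W])
    show "0 \<le> t" using t by simp
    show "\<exists>y. (W has_real_derivative y) (at s) \<and> 0 \<le> y" if "0 < s" "s < t" for s
    proof -
      have "(I has_real_derivative L s) (at s within {0..t})"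
        unfolding I_def using that Lt by (intro integral_has_real_derivative) auto
      then have "(I has_real_derivative L s) (at s)" using that by (simp add: at_within_Icc_at)
      then have "(W has_real_derivative exp (\<sigma> * s) * \<sigma> * (L s + \<sigma> * I s - P)) (at s)"
        unfolding W_def by (auto intro!: derivative_eq_intros simp: algebra_simps)
      moreover have "0 \<le> exp (\<sigma> * s) * \<sigma> * (L s + \<sigma> * I s - P)"
        using P[of s] that \<open>\<sigma> > 0\<close> by simp
      ultimately show ?thesis by blast
    qed
    show "continuous_on {0..t} W"
      unfolding W_def I_def using Lt
      by (intro continuous_intros indefinite_integral_continuous_1 integrable_continuous_real)
  qed
  then have "exp (\<sigma> * t) * L t \<le> P"
    by (simp add: W_def P_def I_def algebra_simps)
  also have "P \<le> L 0" using P[of 0] t by (simp add: I_def)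
  finally show ?thesis by (simp add: exp_minus field_simps)
qed

text \<open>
  All that the Lyapunov argument needs of the solution is contained in the scalar kernels
  \<open>K s t = (m u(s), u(t))\<close>, \<open>K1 s t = (m u\<^sub>t(s), u(t))\<close>, \<open>K12 s t = (m u\<^sub>t(s), u\<^sub>t(t))\<close>, and
  \<open>A s t\<close>, \<open>B s t\<close>, the stiffness and boundary damping forms at \<open>u(s)\<close>, \<open>u(t)\<close>.
\<close>

locale damped_kernels =
  fixes T \<gamma> :: real and K K1 K12 A B :: "real \<Rightarrow> real \<Rightarrow> real"
  assumes gamma: "\<gamma> \<ge> 0" and T: "T > 0"
    and cont: "continuous_kernel T K1" "continuous_kernel T K12" "continuous_kernel T A"
    and sym: "\<And>s t. s \<in> {0..T} \<Longrightarrow> t \<in> {0..T} \<Longrightarrow> K s t = K t s"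
      "\<And>s t. s \<in> {0..T} \<Longrightarrow> t \<in> {0..T} \<Longrightarrow> K12 s t = K12 t s"
      "\<And>s t. s \<in> {0..T} \<Longrightarrow> t \<in> {0..T} \<Longrightarrow> A s t = A t s"
      "\<And>s t. s \<in> {0..T} \<Longrightarrow> t \<in> {0..T} \<Longrightarrow> B s t = B t s"
    and psd: "\<And>s t. s \<in> {0..T} \<Longrightarrow> t \<in> {0..T} \<Longrightarrow> 0 \<le> K s s - 2 * K s t + K t t"
      "\<And>s t. s \<in> {0..T} \<Longrightarrow> t \<in> {0..T} \<Longrightarrow> 0 \<le> B s s - 2 * B s t + B t t"
      "\<And>t. t \<in> {0..T} \<Longrightarrow> 0 \<le> K12 t t" "\<And>t. t \<in> {0..T} \<Longrightarrow> 0 \<le> A t t"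
    and K_diff: "\<And>a b z. 0 \<le> a \<Longrightarrow> a \<le> b \<Longrightarrow> b \<le> T \<Longrightarrow> z \<in> {0..T} \<Longrightarrow>
      K b z - K a z = integral {a..b} (\<lambda>x. K1 x z)"
    and K1_diff: "\<And>a b z. 0 \<le> a \<Longrightarrow> a \<le> b \<Longrightarrow> b \<le> T \<Longrightarrow> z \<in> {0..T} \<Longrightarrow>
      K1 z b - K1 z a = integral {a..b} (K12 z)"
    and evolution: "\<And>a b z. 0 \<le> a \<Longrightarrow> a \<le> b \<Longrightarrow> b \<le> T \<Longrightarrow> z \<in> {0..T} \<Longrightarrow>
      (K1 b z + \<gamma> * K b z + B b z) - (K1 a z + \<gamma> * K a z + B a z) = - integral {a..b} (\<lambda>x. A x z)"
begin

lemma integrable_sections: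
  assumes "continuous_kernel T C" "0 \<le> a" "b \<le> T" "z \<in> {0..T}"
  shows "C z integrable_on {a..b}" "(\<lambda>x. C x z) integrable_on {a..b}"
  by (intro integrable_continuous_real continuous_kernel_sections[OF assms(1)]; use assms in auto)+

text \<open>The weak equation between \<open>t\<close> and \<open>t + h\<close>, tested with the increment \<open>u(t+h) - u(t)\<close>.\<close>

lemma tested_increment:
  assumes "0 \<le> t" "0 < h" "t + h \<le> T"
  shows "integral {t..t+h} (\<lambda>x. (K12 x (t+h) + A x (t+h)) - (K12 x t + A x t))
    \<le> - \<gamma> * integral {t..t+h} (\<lambda>x. integral {t..t+h} (K12 x))"
proof -
  have mem: "t \<in> {0..T}" "t + h \<in> {0..T}" using assms by auto
  note int = integrable_sections[of _ t "t + h", OF _ assms(1,3)]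
  have K12_int: "integral {t..t+h} (\<lambda>x. K12 x z) = K1 z (t+h) - K1 z t" if "z \<in> {0..T}" for z
  proof -
    have "integral {t..t+h} (\<lambda>x. K12 x z) = integral {t..t+h} (K12 z)"
      using assms that by (intro Henstock_Kurzweil_Integration.integral_cong sym) auto
    then show ?thesis using K1_diff[of t "t+h" z] that assms by simp
  qed
  have "integral {t..t+h} (\<lambda>x. (K12 x (t+h) + A x (t+h)) - (K12 x t + A x t))
    = (integral {t..t+h} (\<lambda>x. K12 x (t+h)) + integral {t..t+h} (\<lambda>x. A x (t+h)))
    - (integral {t..t+h} (\<lambda>x. K12 x t) + integral {t..t+h} (\<lambda>x. A x t))"
    using int(2)[OF cont(2) mem(1)] int(2)[OF cont(2) mem(2)] int(2)[OF cont(3) mem(1)] int(2)[OF cont(3) mem(2)]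
    by (simp add: Henstock_Kurzweil_Integration.integral_diff Henstock_Kurzweil_Integration.integral_add
      Henstock_Kurzweil_Integration.integrable_add)
  \<comment> \<open>The \<open>K12\<close> integrals form the mixed second difference of
    \<open>K1\<close>: velocity increment paired with displacement increment. Subtracting the
    evolution equations for z = t and z = t + h expresses the same difference by \<open>K\<close>,
    \<open>B\<close> and \<open>A\<close>, and the \<open>A\<close> integrals cancel.\<close>
  also have "\<dots> = - \<gamma> * (K t t - 2 * K t (t+h) + K (t+h) (t+h)) - (B t t - 2 * B t (t+h) + B (t+h) (t+h))"
    using evolution[of t "t+h" t] evolution[of t "t+h" "t+h"] assms K12_int[OF mem(1)] K12_int[OF mem(2)]
      sym(1)[OF mem(2,1)] sym(4)[OF mem(2,1)]
    by (simp add: algebra_simps)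
  also have "\<dots> \<le> - \<gamma> * (K t t - 2 * K t (t+h) + K (t+h) (t+h))"
    using psd(2)[OF mem] by simp
  \<comment> \<open>The increment of u is the time integral of ut, so its mass form is a double
    integral of \<open>K12\<close>.\<close>
  also have "K t t - 2 * K t (t+h) + K (t+h) (t+h) = integral {t..t+h} (\<lambda>x. integral {t..t+h} (K12 x))"
  proof -
    have "integral {t..t+h} (\<lambda>x. integral {t..t+h} (K12 x)) = integral {t..t+h} (\<lambda>x. K1 x (t+h) - K1 x t)"
      using K1_diff assms by (intro Henstock_Kurzweil_Integration.integral_cong) auto
    also have "\<dots> = (K (t+h) (t+h) - K t (t+h)) - (K (t+h) t - K t t)"
      using K_diff[of t "t+h"] int(2)[OF cont(1) mem(1)] int(2)[OF cont(1) mem(2)] mem assms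
      by (simp add: Henstock_Kurzweil_Integration.integral_diff)
    finally show ?thesis using sym(1)[OF mem] by simp
  qed
  finally show ?thesis .
qed

definition E :: "real \<Rightarrow> real" where
  "E t = (K12 t t + A t t) / 2"

lemma continuous_diag: "continuous_kernel T C \<Longrightarrow> 0 \<le> a \<Longrightarrow> b \<le> T \<Longrightarrow> continuous_on {a..b} (\<lambda>t. C t t)"
  by (rule continuous_kernel_sections(3)) auto

text \<open>
  The energy inequality follows from \<open>tested_increment\<close> because the left-hand side of the latter is
  half the \<open>t\<close>-derivative of \<open>\<integral>\<integral> K12 + A\<close> over the square \<open>{t..t+h}\<^sup>2\<close>, and \<open>h\<^sup>-\<^sup>2\<close> times such integrals
  approximate the values on the diagonal.
\<close>

lemma energy_inequality:
  assumes t12: "0 \<le> t1" "t1 \<le> t2" "t2 \<le> T"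
  shows "E t2 - E t1 \<le> - \<gamma> * integral {t1..t2} (\<lambda>t. K12 t t)"
proof (cases "t1 = t2")
  case False
  then have "t1 < t2" using t12 by simp
  define C D where "C x y = K12 x y + A x y" and "D x y = \<gamma> * K12 x y" for x y
  have C: "continuous_kernel T C" and D: "continuous_kernel T D"
    unfolding C_def D_def by (intro continuous_kernel_add continuous_kernel_cmult cont)+
  have symC: "C x y = C y x" if "x \<in> {0..T}" "y \<in> {0..T}" for x y
    using sym(2,3) that by (simp add: C_def)
  define Dint where "Dint t = integral {0..t} (\<lambda>s. D s s)" for t
  have Dint: "Dint b - Dint a = integral {a..b} (\<lambda>s. D s s)" if "0 \<le> a" "a \<le> b" "b \<le> T" for a b
    unfolding Dint_def using that by (intro integral_initial_diff continuous_diag D) auto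
  obtain KD where KD: "KD > 0" "\<And>t. t \<in> {0..T} \<Longrightarrow> \<bar>D t t\<bar> \<le> KD"
  proof -
    have "bounded ((\<lambda>t. D t t) ` {0..T})"
      using continuous_diag[OF D, of 0 T] by (intro compact_imp_bounded compact_continuous_image) auto
    then show thesis using that by (force simp: bounded_pos)
  qed
  define \<Phi> where "\<Phi> a b = integral {0..a} (\<lambda>x. integral {0..b} (C x))" for a b
  define g where "g x t = integral {0..t} (C x)" for x t
  have g: "continuous_kernel T g" unfolding g_def by (rule continuous_kernel_primitive[OF C])
  \<comment> \<open>By inclusion-exclusion this is the integral of \<open>C\<close> over the square
    with lower corner (t, t) and side h. Written with \<open>\<Phi>\<close>, it can be expanded
    corner by corner.\<close>
  define S where "S h t = \<Phi> (t+h) (t+h) - \<Phi> t (t+h) - \<Phi> (t+h) t + \<Phi> t t" for h t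
  \<comment> \<open>Two \<eta> come from replacing averages over squares near t1 and t2 by diagonal
    values, two more from the last slice [t2 - h, t2]; 5 \<eta> per unit of time is the error in the
    monotonicity of \<open>F\<close> below.\<close>
  have "C t2 t2 - C t1 t1 + 2 * (Dint t2 - Dint t1) \<le> \<eta> * (4 + 5 * (t2 - t1))" if "\<eta> > 0" for \<eta>
  proof -
    obtain d1 where d1: "d1 > 0"
      "\<And>x y x' y'. x \<in> {0..T} \<Longrightarrow> y \<in> {0..T} \<Longrightarrow> x' \<in> {0..T} \<Longrightarrow> y' \<in> {0..T} \<Longrightarrow>
       \<bar>x - x'\<bar> < d1 \<Longrightarrow> \<bar>y - y'\<bar> < d1 \<Longrightarrow> \<bar>C x y - C x' y'\<bar> < \<eta>"
      using continuous_kernel_uniform[OF C \<open>\<eta> > 0\<close>] by metis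
    obtain d2 where d2: "d2 > 0"
      "\<And>x y x' y'. x \<in> {0..T} \<Longrightarrow> y \<in> {0..T} \<Longrightarrow> x' \<in> {0..T} \<Longrightarrow> y' \<in> {0..T} \<Longrightarrow>
       \<bar>x - x'\<bar> < d2 \<Longrightarrow> \<bar>y - y'\<bar> < d2 \<Longrightarrow> \<bar>D x y - D x' y'\<bar> < \<eta>"
      using continuous_kernel_uniform[OF D \<open>\<eta> > 0\<close>] by metis
    \<comment> \<open>\<open>h\<close> makes \<open>C\<close> and \<open>D\<close> oscillate by less
      than \<eta> on squares of side h, keeps the last slice below \<eta> and leaves t1 < t2 - h. It
      stays fixed while the time step below tends to 0.\<close>
    define h where "h = Min {d1 / 2, d2 / 2, \<eta> / KD, (t2 - t1) / 2}"
    have h: "h > 0" "h < d1" "h < d2" "h * KD \<le> \<eta>" "t1 < t2 - h"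
    proof -
      show "h > 0" using d1(1) d2(1) KD(1) \<open>\<eta> > 0\<close> \<open>t1 < t2\<close> by (simp add: h_def)
      have "h \<le> d1 / 2" "h \<le> d2 / 2" "h \<le> \<eta> / KD" "h \<le> (t2 - t1) / 2"
        unfolding h_def by (intro Min_le; simp)+
      then show "h < d1" "h < d2" "h * KD \<le> \<eta>" "t1 < t2 - h"
        using d1(1) d2(1) KD(1) \<open>t1 < t2\<close> by (auto simp: field_simps)
    qed
    have square: "\<bar>integral {t..t+h} (\<lambda>x. integral {t..t+h} (F x)) - h * (h * c)\<bar> \<le> h * (h * \<eta>)"
      if F: "continuous_kernel T F" and t: "0 \<le> t" "t + h \<le> T"
        and near: "\<And>x y. x \<in> {t..t+h} \<Longrightarrow> y \<in> {t..t+h} \<Longrightarrow> \<bar>F x y - c\<bar> \<le> \<eta>" for F t c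
    proof -
      have in_eq: "integral {t..t+h} (F x) = integral {0..t+h} (F x) - integral {0..t} (F x)" if "x \<in> {t..t+h}" for x
        using that t h(1) F by (intro integral_initial_diff[symmetric] continuous_kernel_sections[of T]) auto
      have "continuous_on {t..t+h} (\<lambda>x. integral {0..t+h} (F x) - integral {0..t} (F x))"
        using continuous_kernel_primitive[OF F] t h(1)
        by (intro continuous_intros continuous_kernel_sections(1)[of T "\<lambda>x t. integral {0..t} (F x)"]) auto
      then have cont_in: "continuous_on {t..t+h} (\<lambda>x. integral {t..t+h} (F x))"
        by (rule continuous_on_eq) (rule in_eq[symmetric])
      have "\<bar>integral {t..t+h} (F x) - h * c\<bar> \<le> h * \<eta>" if "x \<in> {t..t+h}" for x
        using integral_near_const[of t "t+h" "F x" c \<eta>] that t h(1) near F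
        by (simp add: continuous_kernel_sections)
      from integral_near_const[OF cont_in _ this] show ?thesis using h(1) by simp
    qed
    have S_eq: "S h t = integral {t..t+h} (\<lambda>x. integral {t..t+h} (C x))" if t: "0 \<le> t" "t + h \<le> T" for t
    proof -
      have gc: "continuous_on {0..T} (\<lambda>x. g x (t+h))" "continuous_on {0..T} (\<lambda>x. g x t)"
        using g t h(1) by (auto intro: continuous_kernel_sections)
      have "S h t = integral {t..t+h} (\<lambda>x. g x (t+h)) - integral {t..t+h} (\<lambda>x. g x t)"
        using integral_initial_diff[OF gc(1), of t "t+h"] integral_initial_diff[OF gc(2), of t "t+h"] t h(1)
        by (simp add: S_def \<Phi>_def g_def)
      also have "\<dots> = integral {t..t+h} (\<lambda>x. g x (t+h) - g x t)"
        using gc t h(1)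
        by (intro Henstock_Kurzweil_Integration.integral_diff[symmetric] integrable_continuous_real)
          (auto intro: continuous_on_subset)
      also have "\<dots> = integral {t..t+h} (\<lambda>x. integral {t..t+h} (C x))"
      proof (intro Henstock_Kurzweil_Integration.integral_cong)
        fix x assume "x \<in> {t..t+h}"
        then show "g x (t+h) - g x t = integral {t..t+h} (C x)"
          unfolding g_def using t h(1) C by (intro integral_initial_diff continuous_kernel_sections[of T]) auto
      qed
      finally show ?thesis .
    qed
    have S_near: "\<bar>S h t - h * (h * C p p)\<bar> \<le> h * (h * \<eta>)" if "0 \<le> t" "t + h \<le> T" "p \<in> {t, t+h}" for t p
      unfolding S_eq[OF that(1,2)]
      by (rule square[OF C that(1,2)], rule less_imp_le, rule d1(2)) (use that h in auto)
    \<comment> \<open>S h t / h^2 is an averaged form of twice the energy, and the drift -5 \<eta> t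
      absorbs all errors.\<close>
    define F where "F t = S h t / (h * h) + 2 * Dint t - 5 * \<eta> * t" for t
    have "F (t2 - h) \<le> F t1"
    proof (rule nonincreasing_from_local[where F = F])
      show "t1 \<le> t2 - h" using h by simp
      \<comment> \<open>Four corners of the square contribute and the sum is divided by h^2, so this
        accuracy amounts to an error of \<eta> per unit of time.\<close>
      have "\<eta> * h * h / 4 > 0" using \<open>\<eta> > 0\<close> h(1) by simp
      then obtain d3 where d3: "d3 > 0"
        "\<And>a b s. a \<ge> 0 \<Longrightarrow> b \<ge> 0 \<Longrightarrow> 0 \<le> s \<Longrightarrow> s < d3 \<Longrightarrow> a + s \<le> T \<Longrightarrow> b + s \<le> T \<Longrightarrow>
          \<bar>\<Phi> (a + s) (b + s) - \<Phi> a b - s * (g a b + g b a)\<bar> \<le> s * (\<eta> * h * h / 4)"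
        using double_primitive_increment[OF C symC, of "\<eta> * h * h / 4"] unfolding \<Phi>_def g_def by metis
      have "F t - F s \<le> 0" if st: "t1 \<le> s" "s < t" "t \<le> t2 - h" "t - s < min d2 d3" for s t
      proof -
        define r where "r = t - s"
        have r: "t = s + r" "0 < r" "r < d2" "r < d3" using st by (auto simp: r_def)
        have s: "0 \<le> s" "s + h \<le> T" "s + h + r \<le> T" using st t12 r by auto
        \<comment> \<open>Adding the expansions at the four corners with their signs counts each of
          these terms twice, so 2 R is the rate of change of \<open>S h\<close> at s.\<close>
        define R where "R = g (s+h) (s+h) - g (s+h) s - g s (s+h) + g s s"
        have "S h t - S h s \<le> r * (2 * R) + 4 * (r * (\<eta> * h * h / 4))"
        proof -
          have eq: "s + r + h = s + h + r" by simp
          show ?thesis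
            using d3(2)[of "s+h" "s+h" r] d3(2)[of "s" "s+h" r] d3(2)[of "s+h" "s" r] d3(2)[of s s r] s r h(1)
            unfolding S_def R_def r(1) eq abs_le_iff by (simp add: algebra_simps)
        qed
        moreover have "R \<le> - (h * (h * (D s s - \<eta>)))"
        proof -
          have "R = integral {s..s+h} (C (s+h)) - integral {s..s+h} (C s)"
            using integral_initial_diff[of T "C (s+h)" s "s+h"] integral_initial_diff[of T "C s" s "s+h"] s h(1) C
            by (simp add: R_def g_def continuous_kernel_sections)
          also have "\<dots> = integral {s..s+h} (\<lambda>x. C (s+h) x - C s x)"
            using C s h(1) by (intro Henstock_Kurzweil_Integration.integral_diff[symmetric] integrable_sections) auto
          also have "\<dots> = integral {s..s+h} (\<lambda>x. C x (s+h) - C x s)"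
            using s h(1) symC by (intro Henstock_Kurzweil_Integration.integral_cong) simp
          \<comment> \<open>The equation of motion enters here; the double integral of
            \<open>D\<close> that results is close to h^2 times \<open>D s s\<close>.\<close>
          also have "\<dots> \<le> - \<gamma> * integral {s..s+h} (\<lambda>x. integral {s..s+h} (K12 x))"
            unfolding C_def using s h(1) by (intro tested_increment) auto
          also have "\<dots> = - integral {s..s+h} (\<lambda>x. integral {s..s+h} (D x))"
            by (simp add: D_def[abs_def])
          also have "\<dots> \<le> - (h * (h * (D s s - \<eta>)))"
          proof -
            have "\<bar>integral {s..s+h} (\<lambda>x. integral {s..s+h} (D x)) - h * (h * D s s)\<bar> \<le> h * (h * \<eta>)"
              by (rule square[OF D s(1,2)], rule less_imp_le, rule d2(2)) (use s h in auto)
            then show ?thesis by (simp add: abs_le_iff algebra_simps)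
          qed
          finally show ?thesis .
        qed
        then have "r * (2 * R) \<le> r * (2 * - (h * (h * (D s s - \<eta>))))"
          using r by (intro mult_left_mono) auto
        ultimately have "S h t - S h s \<le> r * (2 * - (h * (h * (D s s - \<eta>)))) + 4 * (r * (\<eta> * h * h / 4))"
          by linarith
        \<comment> \<open>Of the three \<eta>, two come from \<open>D\<close> on the square and one
          from the corners. The increment of 2 Dint adds two more, which makes five.\<close>
        also have "\<dots> = (r * (3 * \<eta> - 2 * D s s)) * (h * h)" by (simp add: algebra_simps)
        finally have "(S h t - S h s) / (h * h) \<le> r * (3 * \<eta> - 2 * D s s)"
          using h(1) by (simp add: pos_divide_le_eq)
        moreover have "Dint t - Dint s \<le> r * (D s s + \<eta>)"
        proof -
          have "\<bar>integral {s..t} (\<lambda>x. D x x) - (t - s) * D s s\<bar> \<le> (t - s) * \<eta>"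
            by (intro integral_near_const continuous_diag[OF D] less_imp_le[OF d2(2)]) (use s r h(1) in auto)
          then show ?thesis using Dint[of s t] s r h(1) by (simp add: abs_le_iff algebra_simps)
        qed
        ultimately show ?thesis
          unfolding F_def r(1) by (simp add: algebra_simps diff_divide_distrib)
      qed
      then show "\<exists>d>0. \<forall>s t. t1 \<le> s \<and> s < t \<and> t \<le> t2 - h \<and> t - s < d \<longrightarrow> F t - F s \<le> e * (t - s)"
        if "e > 0" for e
        using that d2(1) d3(1) by (intro exI[of _ "min d2 d3"]) (fastforce intro: order_trans[of _ 0])
    qed
    then have "S h (t2 - h) / (h * h) - S h t1 / (h * h) + 2 * (Dint (t2 - h) - Dint t1) \<le> 5 * \<eta> * (t2 - t1 - h)"
      by (simp add: F_def algebra_simps)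
    moreover have "C t2 t2 - \<eta> \<le> S h (t2 - h) / (h * h)"
    proof -
      have "(C t2 t2 - \<eta>) * (h * h) \<le> S h (t2 - h)"
        using S_near[of "t2 - h" t2] h t12 unfolding abs_le_iff by (simp add: algebra_simps)
      then show ?thesis using h(1) by (simp add: pos_le_divide_eq)
    qed
    moreover have "S h t1 / (h * h) \<le> C t1 t1 + \<eta>"
    proof -
      have "S h t1 \<le> (C t1 t1 + \<eta>) * (h * h)"
        using S_near[of t1 t1] h t12 unfolding abs_le_iff by (simp add: algebra_simps)
      then show ?thesis using h(1) by (simp add: pos_divide_le_eq)
    qed
    moreover have "Dint t2 - Dint (t2 - h) \<le> \<eta>"
    proof -
      have "\<bar>integral {t2 - h..t2} (\<lambda>x. D x x) - (t2 - (t2 - h)) * 0\<bar> \<le> (t2 - (t2 - h)) * KD"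
        by (intro integral_near_const continuous_diag[OF D]) (use h t12 KD(2) in auto)
      then show ?thesis using Dint[of "t2 - h" t2] h t12 by (simp add: mult.commute)
    qed
    moreover have "5 * \<eta> * (t2 - t1 - h) \<le> 5 * \<eta> * (t2 - t1)" using \<open>\<eta> > 0\<close> h(1) by simp
    ultimately show ?thesis by (simp add: algebra_simps)
  qed
  then have "C t2 t2 - C t1 t1 + 2 * (Dint t2 - Dint t1) \<le> 0 + e" if "e > 0" for e
  proof -
    have pos: "4 + 5 * (t2 - t1) > 0" using t12 by simp
    with that \<open>\<And>\<eta>. \<eta> > 0 \<Longrightarrow> C t2 t2 - C t1 t1 + 2 * (Dint t2 - Dint t1) \<le> \<eta> * (4 + 5 * (t2 - t1))\<close>
      [of "e / (4 + 5 * (t2 - t1))"] show ?thesis by simp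
  qed
  then have "C t2 t2 - C t1 t1 + 2 * (Dint t2 - Dint t1) \<le> 0" by (rule field_le_epsilon)
  moreover have "Dint t2 - Dint t1 = \<gamma> * integral {t1..t2} (\<lambda>t. K12 t t)"
    using Dint[OF t12] by (simp add: D_def)
  ultimately show ?thesis by (simp add: E_def C_def field_simps)
qed simp

definition J :: "real \<Rightarrow> real" where
  "J t = K1 t t + \<gamma> / 2 * K t t + B t t / 2"

text \<open>
  \<open>B(u(t), u(t))\<close> need not be differentiable; only an upper bound for the increments of \<open>J\<close> is
  used, and there the square of the increment of \<open>u\<close> enters with a favourable sign.
\<close>

lemma J_inequality:
  assumes t12: "0 \<le> t1" "t1 \<le> t2" "t2 \<le> T"
  shows "J t2 - J t1 \<le> integral {t1..t2} (\<lambda>t. K12 t t - A t t)"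
proof -
  define P where "P x y = K12 x y - A x y" for x y
  have P: "continuous_kernel T P" unfolding P_def by (intro continuous_kernel_diff cont)
  define Pint where "Pint t = integral {0..t} (\<lambda>s. P s s)" for t
  have Pint: "Pint b - Pint a = integral {a..b} (\<lambda>s. P s s)" if "0 \<le> a" "a \<le> b" "b \<le> T" for a b
    unfolding Pint_def using that by (intro integral_initial_diff continuous_diag P) auto
  have "J t2 - Pint t2 \<le> J t1 - Pint t1"
  proof (rule nonincreasing_from_local[where F = "\<lambda>t. J t - Pint t"])
    show "t1 \<le> t2" by fact
    fix e :: real assume "e > 0"
    then have e3: "e / 3 > 0" by simp
    obtain d1 where d1: "d1 > 0"
      "\<And>x y x' y'. x \<in> {0..T} \<Longrightarrow> y \<in> {0..T} \<Longrightarrow> x' \<in> {0..T} \<Longrightarrow> y' \<in> {0..T} \<Longrightarrow>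
       \<bar>x - x'\<bar> < d1 \<Longrightarrow> \<bar>y - y'\<bar> < d1 \<Longrightarrow> \<bar>K12 x y - K12 x' y'\<bar> < e / 3"
      using continuous_kernel_uniform[OF cont(2) e3] by metis
    obtain d2 where d2: "d2 > 0"
      "\<And>x y x' y'. x \<in> {0..T} \<Longrightarrow> y \<in> {0..T} \<Longrightarrow> x' \<in> {0..T} \<Longrightarrow> y' \<in> {0..T} \<Longrightarrow>
       \<bar>x - x'\<bar> < d2 \<Longrightarrow> \<bar>y - y'\<bar> < d2 \<Longrightarrow> \<bar>A x y - A x' y'\<bar> < e / 3"
      using continuous_kernel_uniform[OF cont(3) e3] by metis
    obtain d3 where d3: "d3 > 0"
      "\<And>x y x' y'. x \<in> {0..T} \<Longrightarrow> y \<in> {0..T} \<Longrightarrow> x' \<in> {0..T} \<Longrightarrow> y' \<in> {0..T} \<Longrightarrow>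
       \<bar>x - x'\<bar> < d3 \<Longrightarrow> \<bar>y - y'\<bar> < d3 \<Longrightarrow> \<bar>P x y - P x' y'\<bar> < e / 3"
      using continuous_kernel_uniform[OF P e3] by metis
    have "(J t - Pint t) - (J s - Pint s) \<le> e * (t - s)"
      if st: "t1 \<le> s" "s < t" "t \<le> t2" "t - s < min d1 (min d2 d3)" for s t
    proof -
      have mem: "s \<in> {0..T}" "t \<in> {0..T}" using st t12 by auto
      \<comment> \<open>Testing with the later state u(t) leaves the squares of the increment with a
        minus sign; with u(s) the sign would be plus.\<close>
      have "J t - J s = - integral {s..t} (\<lambda>x. A x t) + (K1 s t - K1 s s)
         - \<gamma> / 2 * (K s s - 2 * K s t + K t t) - (B s s - 2 * B s t + B t t) / 2"
        using evolution[of s t t] st mem by (simp add: J_def algebra_simps add_divide_distrib diff_divide_distrib)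
      also have "\<dots> \<le> - integral {s..t} (\<lambda>x. A x t) + integral {s..t} (K12 s)"
      proof -
        have "0 \<le> \<gamma> / 2 * (K s s - 2 * K s t + K t t)"
          using psd(1)[OF mem] gamma by (intro mult_nonneg_nonneg) auto
        moreover have "K1 s t - K1 s s = integral {s..t} (K12 s)"
          using K1_diff[of s t s] st mem by simp
        moreover have "- a + p - x - y / 2 \<le> - a + q" if "0 \<le> x" "p = q" "0 \<le> y" for a p q x y :: real
          using that by simp
        ultimately show ?thesis using psd(2)[OF mem] by blast
      qed
      finally have J: "J t - J s \<le> - integral {s..t} (\<lambda>x. A x t) + integral {s..t} (K12 s)" .
      have "\<bar>integral {s..t} (K12 s) - (t - s) * K12 s s\<bar> \<le> (t - s) * (e / 3)"
        by (intro integral_near_const continuous_kernel_sections(2)[OF cont(2)] less_imp_le[OF d1(2)])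
          (use st mem in auto)
      moreover have "\<bar>integral {s..t} (\<lambda>x. A x t) - (t - s) * A s s\<bar> \<le> (t - s) * (e / 3)"
        by (intro integral_near_const continuous_kernel_sections(1)[OF cont(3)] less_imp_le[OF d2(2)])
          (use st mem in auto)
      moreover have "\<bar>integral {s..t} (\<lambda>x. P x x) - (t - s) * P s s\<bar> \<le> (t - s) * (e / 3)"
        by (intro integral_near_const continuous_diag[OF P] less_imp_le[OF d3(2)]) (use st mem in auto)
      ultimately show ?thesis
        using J Pint[of s t] st mem unfolding abs_le_iff P_def by (simp add: algebra_simps)
    qed
    then show "\<exists>d>0. \<forall>s t. t1 \<le> s \<and> s < t \<and> t \<le> t2 \<and> t - s < d \<longrightarrow> (J t - Pint t) - (J s - Pint s) \<le> e * (t - s)"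
      using d1(1) d2(1) d3(1) by (intro exI[of _ "min d1 (min d2 d3)"]) auto
  qed
  then show ?thesis using Pint[OF t12] by (simp add: P_def)
qed

text \<open>The comparison (1 - \<beta>0 lam) E \<le> L \<le> (1 + \<beta>1 lam) E is used three
  times: the upper bound turns the loss 2 lam E into \<sigma> L, the upper bound at time 0 and the
  lower bound at time t lead back to \<open>E\<close>. This is where the rate and the quotient in
  front come from.\<close>

lemma exponential_decay:
  assumes J: "\<And>t. t \<in> {0..T} \<Longrightarrow> - \<beta>0 * E t \<le> J t" "\<And>t. t \<in> {0..T} \<Longrightarrow> J t \<le> \<beta>1 * E t"
    and J_cont: "continuous_on {0..T} J"
    and lam: "0 < lam" "\<beta>0 * lam < 1" "2 * lam \<le> \<gamma>" and "\<beta>1 \<ge> 0"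
    and t: "t \<in> {0..T}"
  shows "E t \<le> (1 + \<beta>1 * lam) / (1 - \<beta>0 * lam) * exp (- (2 * lam / (1 + \<beta>1 * lam)) * t) * E 0"
proof -
  define L where "L t = E t + lam * J t" for t
  define \<sigma> where "\<sigma> = 2 * lam / (1 + \<beta>1 * lam)"
  have b1: "1 + \<beta>1 * lam > 0" using lam \<open>\<beta>1 \<ge> 0\<close> by (simp add: add_pos_nonneg)
  then have "\<sigma> > 0" using lam by (simp add: \<sigma>_def)
  have E_cont: "continuous_on {0..T} E"
    unfolding E_def using continuous_diag cont by (intro continuous_intros) auto
  have L_cont: "continuous_on {0..T} L"
    unfolding L_def by (intro continuous_intros E_cont J_cont)
  have L_le: "L t \<le> (1 + \<beta>1 * lam) * E t" and L_ge: "(1 - \<beta>0 * lam) * E t \<le> L t" if "t \<in> {0..T}" for t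
    using mult_left_mono[OF J(1)[OF that], of lam] mult_left_mono[OF J(2)[OF that], of lam] lam
    by (simp_all add: L_def algebra_simps)
  have dec: "L t - L s \<le> - \<sigma> * integral {s..t} L" if st: "0 \<le> s" "s \<le> t" "t \<le> T" for s t
  proof -
    have int: "C integrable_on {s..t}" if "continuous_on {0..T} C" for C :: "real \<Rightarrow> real"
      using that st by (intro integrable_continuous_real) (auto intro: continuous_on_subset)
    have intK: "(\<lambda>t. K12 t t) integrable_on {s..t}" and intA: "(\<lambda>t. A t t) integrable_on {s..t}"
      using continuous_diag cont by (auto intro!: int)
    have "L t - L s \<le> - \<gamma> * integral {s..t} (\<lambda>t. K12 t t) + lam * integral {s..t} (\<lambda>t. K12 t t - A t t)"
      using energy_inequality[OF st] mult_left_mono[OF J_inequality[OF st], of lam] lam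
      by (simp add: L_def algebra_simps)
    \<comment> \<open>The coefficient -2 lam together with the lam coming from \<open>J\<close>
      leaves -lam for the kinetic part, which matches the -lam of the stiffness part; together they
      are -2 lam E.\<close>
    also have "\<dots> \<le> - (2 * lam) * integral {s..t} (\<lambda>t. K12 t t) + lam * integral {s..t} (\<lambda>t. K12 t t - A t t)"
    proof -
      have "0 \<le> integral {s..t} (\<lambda>t. K12 t t)"
        using psd(3) st intK by (intro Henstock_Kurzweil_Integration.integral_nonneg) auto
      then show ?thesis using lam(3) by (simp add: mult_right_mono)
    qed
    also have "\<dots> = integral {s..t} (\<lambda>t. - (2 * lam) * K12 t t + lam * (K12 t t - A t t))"
      using integrable_on_mult_right[OF intK, of "- (2 * lam)"]
        integrable_on_mult_right[OF Henstock_Kurzweil_Integration.integrable_diff[OF intK intA], of lam]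
      by (subst Henstock_Kurzweil_Integration.integral_add) auto
    also have "\<dots> \<le> integral {s..t} (\<lambda>t. - \<sigma> * L t)"
    proof (rule integral_le)
      show "(\<lambda>t. - (2 * lam) * K12 t t + lam * (K12 t t - A t t)) integrable_on {s..t}"
        using continuous_diag cont by (intro int continuous_intros) auto
      show "(\<lambda>t. - \<sigma> * L t) integrable_on {s..t}"
        by (intro int continuous_intros L_cont)
      fix x assume "x \<in> {s..t}"
      then have "\<sigma> * L x \<le> \<sigma> * ((1 + \<beta>1 * lam) * E x)"
        using st \<open>\<sigma> > 0\<close> by (intro mult_left_mono L_le) auto
      also have "\<dots> = 2 * lam * E x" using b1 by (simp add: \<sigma>_def)
      finally show "- (2 * lam) * K12 x x + lam * (K12 x x - A x x) \<le> - \<sigma> * L x"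
        by (simp add: E_def algebra_simps)
    qed
    also have "\<dots> = - \<sigma> * integral {s..t} L" by simp
    finally show ?thesis .
  qed
  have "(1 - \<beta>0 * lam) * E t \<le> L t" using t by (rule L_ge)
  also have "\<dots> \<le> exp (- \<sigma> * t) * L 0"
    using L_cont \<open>\<sigma> > 0\<close> dec t by (rule gronwall_decay)
  also have "\<dots> \<le> exp (- \<sigma> * t) * ((1 + \<beta>1 * lam) * E 0)"
    using L_le[of 0] T by (intro mult_left_mono) auto
  finally show ?thesis
    using lam(2) by (simp add: \<sigma>_def pos_le_divide_eq mult.commute mult.assoc mult.left_commute)
qed

end

section \<open>The beam\<close>

text \<open>The representation by a primitive holds almost everywhere; as both sides are continuous
  in time it holds at every time, endpoints included.\<close>

lemma weak_time_deriv_increment: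
  assumes "T > 0" "has_weak_deriv 0 T 1 f g" and f: "continuous_on {0..T} f" and g: "continuous_on {0..T} g"
    and ab: "0 \<le> a" "a \<le> b" "b \<le> T"
  shows "f b - f a = integral {a..b} g"
proof -
  have "integrable (lebesgue_on {0<..<T}) g"
    using g by (simp add: integrable_open_closed continuous_imp_integrable_real)
  then obtain C where C: "AE t in lebesgue_on {0<..<T}. f t = C + integral {0..t} g"
    using weak_deriv_primitive[OF assms(1,2)] by metis
  have "f t = C + integral {0..t} g" if "t \<in> {0..T}" for t
  proof (rule continuous_AE_eq[OF f _ assms(1) C that])
    show "continuous_on {0..T} (\<lambda>t. C + integral {0..t} g)"
      using g by (intro continuous_intros indefinite_integral_continuous_1 integrable_continuous_real)
  qed
  then show ?thesis
    using integral_initial_diff[OF g ab] ab by simp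
qed

lemma L2_norm_cong_AE:
  assumes "f \<in> L2 a b" "g \<in> L2 a b" "AE x in lebesgue_on {a<..<b}. f x = g x"
  shows "L2_norm a b f = L2_norm a b g"
proof -
  have "(LINT x|lebesgue_on {a<..<b}. f x * f x) = (LINT x|lebesgue_on {a<..<b}. g x * g x)"
    using assms by (intro integral_cong_AE) (auto simp: L2_def elim: eventually_mono)
  then show ?thesis by (simp add: L2_norm_def L2_inner_def)
qed

lemma L2_norm_le_H2_norm:
  "L2_norm a b f \<le> H2_norm a b f" "L2_norm a b (wderiv a b 2 f) \<le> H2_norm a b f"
  unfolding H2_norm_def by (auto intro!: real_le_rsqrt)

text \<open>Differences \<open>u s - u t\<close> stay in \<open>V2\<close>, so the slope bound in
  \<open>V2_bounds\<close> controls the change of slope at a point by the H2 norm.\<close>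

lemma cont_in_time_V2:
  assumes "a < b" and u: "u \<in> cont_in_time T (V2 a b) (H2_norm a b)"
  shows "u \<in> cont_in_time T (L2 a b) (L2_norm a b)"
    and "(\<lambda>t. wderiv a b 2 (u t)) \<in> cont_in_time T (L2 a b) (L2_norm a b)"
    and "x \<in> {a..b} \<Longrightarrow> continuous_on {0..T} (\<lambda>t. trace a b (wderiv a b 1 (u t)) x)"
proof -
  have V2: "u t \<in> V2 a b" and lim: "((\<lambda>s. H2_norm a b (u s - u t)) \<longlongrightarrow> 0) (at t within {0..T})"
    if "t \<in> {0..T}" for t
    using u that by (auto simp: cont_in_time_def)
  have H2: "u t \<in> H2 a b" if "t \<in> {0..T}" for t using V2[OF that] by (simp add: V2_def)
  have sq: "((\<lambda>s. N s) \<longlongrightarrow> 0) (at t within {0..T})"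
    if "t \<in> {0..T}" "\<And>s. s \<in> {0..T} \<Longrightarrow> \<bar>N s\<bar> \<le> H2_norm a b (u s - u t) * c" for t c and N :: "real \<Rightarrow> real"
  proof (rule Lim_null_comparison)
    show "((\<lambda>s. H2_norm a b (u s - u t) * c) \<longlongrightarrow> 0) (at t within {0..T})"
      using tendsto_mult_right[OF lim[OF that(1)], of c] by simp
    show "\<forall>\<^sub>F s in at t within {0..T}. norm (N s) \<le> H2_norm a b (u s - u t) * c"
      using that(2) by (simp add: eventually_at_filter)
  qed
  show "u \<in> cont_in_time T (L2 a b) (L2_norm a b)"
    unfolding cont_in_time_def using H2 L2_norm_nonneg[of a b] L2_norm_le_H2_norm(1)[of a b]
    by (auto simp: H2_def intro!: sq[where c = 1])
  show "(\<lambda>t. wderiv a b 2 (u t)) \<in> cont_in_time T (L2 a b) (L2_norm a b)"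
    unfolding cont_in_time_def
  proof (intro CollectI ballI conjI)
    fix t assume t: "t \<in> {0..T}"
    show "wderiv a b 2 (u t) \<in> L2 a b" using wderiv_H2(2)[OF assms(1) H2[OF t]] by simp
    show "((\<lambda>s. L2_norm a b (wderiv a b 2 (u s) - wderiv a b 2 (u t))) \<longlongrightarrow> 0) (at t within {0..T})"
    proof (rule sq[OF t, where c = 1])
      fix s assume s: "s \<in> {0..T}"
      note wd = wderiv_diff[OF assms(1) H2[OF s] H2[OF t], of 2, simplified]
      have "L2_norm a b (wderiv a b 2 (u s - u t)) = L2_norm a b (wderiv a b 2 (u s) - wderiv a b 2 (u t))"
        using wd(1) wderiv_H2(2)[OF assms(1) wd(2), of 2] wderiv_H2(2)[OF assms(1) H2[OF s], of 2]
          wderiv_H2(2)[OF assms(1) H2[OF t], of 2]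
        by (intro L2_norm_cong_AE L2_diff) auto
      then show "\<bar>L2_norm a b (wderiv a b 2 (u s) - wderiv a b 2 (u t))\<bar> \<le> H2_norm a b (u s - u t) * 1"
        using L2_norm_le_H2_norm(2)[of a b "u s - u t"] L2_norm_nonneg by simp
    qed
  qed
  show "continuous_on {0..T} (\<lambda>t. trace a b (wderiv a b 1 (u t)) x)" if x: "x \<in> {a..b}"
    unfolding continuous_on_def
  proof
    fix t assume t: "t \<in> {0..T}"
    have "((\<lambda>s. trace a b (wderiv a b 1 (u s)) x - trace a b (wderiv a b 1 (u t)) x) \<longlongrightarrow> 0) (at t within {0..T})"
    proof (rule sq[OF t, where c = "sqrt (b - a)"])
      fix s assume s: "s \<in> {0..T}"
      let ?N = "L2_norm a b (wderiv a b 2 (u s - u t))"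
      note vd = V2_diff[OF assms(1) V2[OF s] V2[OF t]]
      have "\<bar>trace a b (wderiv a b 1 (u s)) x - trace a b (wderiv a b 1 (u t)) x\<bar>\<^sup>2 \<le> (b - a) * ?N\<^sup>2"
        using V2_bounds(1)[OF assms(1) vd(1) x] vd(2)[OF x] by simp
      also have "\<dots> = (?N * sqrt (b - a))\<^sup>2" using assms(1) by (simp add: power_mult_distrib)
      finally have "\<bar>trace a b (wderiv a b 1 (u s)) x - trace a b (wderiv a b 1 (u t)) x\<bar> \<le> ?N * sqrt (b - a)"
        by (rule power2_le_imp_le) (use assms(1) L2_norm_nonneg in simp)
      also have "\<dots> \<le> H2_norm a b (u s - u t) * sqrt (b - a)"
        using L2_norm_le_H2_norm(2) assms(1) by (intro mult_right_mono) auto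
      finally show "\<bar>trace a b (wderiv a b 1 (u s)) x - trace a b (wderiv a b 1 (u t)) x\<bar> \<le> H2_norm a b (u s - u t) * sqrt (b - a)" .
    qed
    then show "((\<lambda>t. trace a b (wderiv a b 1 (u t)) x) \<longlongrightarrow> trace a b (wderiv a b 1 (u t)) x) (at t within {0..T})"
      by (rule LIM_zero_cancel)
  qed
qed

text \<open>A nonempty open interval is not null, so some point satisfies both bounds.\<close>

lemma AE_bounds_le:
  fixes f :: "real \<Rightarrow> real"
  assumes "a < b" "AE x in lebesgue_on {a<..<b}. c \<le> f x \<and> f x \<le> d"
  shows "c \<le> d"
proof -
  obtain N where N: "negligible N" "\<forall>x\<in>{a<..<b} - N. c \<le> f x \<and> f x \<le> d"
    using assms(2) by (subst (asm) AE_lebesgue_on_iff) (simp, blast)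
  have "\<not> negligible {a<..<b}"
    using open_not_negligible[of "{a<..<b}"] assms(1) by auto
  then have "\<not> {a<..<b} \<subseteq> N" using N(1) negligible_subset by blast
  then show ?thesis using N(2) by force
qed

locale damped_beam =
  fixes l T \<gamma> m0 m1 \<mu>1 r0 r1 krm kam krp kap :: real
    and m \<mu> r u0 u1 :: "real \<Rightarrow> real" and u ut :: "real \<Rightarrow> real \<Rightarrow> real"
  assumes l: "l > 0" and T: "T > 0"
    and m_meas: "m \<in> borel_measurable (lebesgue_on {0<..<l})"
    and \<mu>_meas: "\<mu> \<in> borel_measurable (lebesgue_on {0<..<l})"
    and r_meas: "r \<in> borel_measurable (lebesgue_on {0<..<l})"
    and m0: "0 < m0" and m_bounds: "AE x in lebesgue_on {0<..<l}. m0 \<le> m x \<and> m x \<le> m1"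
    and \<mu>_bounds: "AE x in lebesgue_on {0<..<l}. 0 \<le> \<mu> x \<and> \<mu> x \<le> \<mu>1"
    and r0: "0 < r0" and r_bounds: "AE x in lebesgue_on {0<..<l}. r0 \<le> r x \<and> r x \<le> r1"
    and \<mu>_eq: "AE x in lebesgue_on {0<..<l}. \<mu> x = \<gamma> * m x"
    and u0: "u0 \<in> H2 0 l" and u1: "u1 \<in> L2 0 l"
    and nonneg: "krm \<ge> 0" "kam \<ge> 0" "krp \<ge> 0" "kap \<ge> 0" "\<gamma> \<ge> 0"
    and sol: "weak_solution l T m \<mu> r krm kam krp kap u0 u1 u ut"
begin

abbreviation "\<Omega> \<equiv> lebesgue_on {0<..<l}"

lemma m0_le_m1: "m0 \<le> m1" and \<mu>1_nonneg: "0 \<le> \<mu>1" and r0_le_r1: "r0 \<le> r1"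
  using AE_bounds_le[OF l m_bounds] AE_bounds_le[OF l \<mu>_bounds] AE_bounds_le[OF l r_bounds] .

lemma m1_pos: "0 < m1" and r1_nonneg: "0 \<le> r1"
  using m0_le_m1 r0_le_r1 m0 r0 by auto

lemma u_cont: "u \<in> cont_in_time T (V2 0 l) (H2_norm 0 l)"
  and ut_cont: "ut \<in> cont_in_time T (L2 0 l) (L2_norm 0 l)"
  and u_init: "AE x in \<Omega>. u 0 x = u0 x"
  using sol by (auto simp: weak_solution_def)

lemma u_V2: "t \<in> {0..T} \<Longrightarrow> u t \<in> V2 0 l" and ut_L2: "t \<in> {0..T} \<Longrightarrow> ut t \<in> L2 0 l"
  using u_cont ut_cont by (auto simp: cont_in_time_def)

lemma V2_L2: "v \<in> V2 0 l \<Longrightarrow> v \<in> L2 0 l" and V2_w2_L2: "v \<in> V2 0 l \<Longrightarrow> wderiv 0 l 2 v \<in> L2 0 l"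
  using wderiv_H2(2)[OF l, of v 2] by (auto simp: V2_def H2_def)

lemma u_L2: "t \<in> {0..T} \<Longrightarrow> u t \<in> L2 0 l"
  using u_V2 V2_L2 by blast

lemma m_abs: "AE x in \<Omega>. \<bar>m x\<bar> \<le> m1"
  using m_bounds by (rule eventually_mono) (use m0 in auto)

lemma r_abs: "AE x in \<Omega>. \<bar>r x\<bar> \<le> r1"
  using r_bounds by (rule eventually_mono) (use r0 in auto)

text \<open>Seen as a constant curve, a fixed test function falls under the continuity lemma for
  kernels.\<close>

lemma const_cont: "v \<in> L2 0 l \<Longrightarrow> (\<lambda>_. v) \<in> cont_in_time T (L2 0 l) (L2_norm 0 l)"
  by (auto simp: cont_in_time_def L2_norm_def L2_inner_def)

lemma mass_integrable: "f \<in> L2 0 l \<Longrightarrow> g \<in> L2 0 l \<Longrightarrow> integrable \<Omega> (\<lambda>x. m x * f x * g x)"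
  and stiffness_integrable: "f \<in> L2 0 l \<Longrightarrow> g \<in> L2 0 l \<Longrightarrow> integrable \<Omega> (\<lambda>x. r x * f x * g x)"
  using L2_mult_integrable[OF L2_weight[OF m_meas m_abs]] L2_mult_integrable[OF L2_weight[OF r_meas r_abs]]
  by auto

lemma mass_kernel:
  "f \<in> cont_in_time T (L2 0 l) (L2_norm 0 l) \<Longrightarrow> g \<in> cont_in_time T (L2 0 l) (L2_norm 0 l) \<Longrightarrow>
    continuous_kernel T (\<lambda>s t. LINT x|\<Omega>. m x * f s x * g t x)"
  unfolding continuous_kernel_def
  using m1_pos by (intro continuous_on_L2_kernel[OF m_meas m_abs]) auto

section \<open>The bilinear forms of the beam and their continuity in time\<close>

definition mass :: "(real \<Rightarrow> real) \<Rightarrow> (real \<Rightarrow> real) \<Rightarrow> real" where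
  "mass f g = (LINT x|\<Omega>. m x * f x * g x)"

definition slope :: "(real \<Rightarrow> real) \<Rightarrow> real \<Rightarrow> real" where
  "slope v = trace 0 l (wderiv 0 l 1 v)"

definition stiffness :: "(real \<Rightarrow> real) \<Rightarrow> (real \<Rightarrow> real) \<Rightarrow> real" where
  "stiffness v w = (LINT x|\<Omega>. r x * wderiv 0 l 2 v x * wderiv 0 l 2 w x)
     + krm * slope v 0 * slope w 0 + krp * slope v l * slope w l"

definition boundary_damping :: "(real \<Rightarrow> real) \<Rightarrow> (real \<Rightarrow> real) \<Rightarrow> real" where
  "boundary_damping v w = kam * slope v 0 * slope w 0 + kap * slope v l * slope w l"

lemma mass_sym: "mass f g = mass g f"
  and stiffness_sym: "stiffness f g = stiffness g f"
  and boundary_damping_sym: "boundary_damping f g = boundary_damping g f"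
  unfolding mass_def stiffness_def boundary_damping_def
  by (simp_all add: mult.assoc mult.commute mult.left_commute)

lemma slope_cont: "x \<in> {0, l} \<Longrightarrow> continuous_on {0..T} (\<lambda>t. slope (u t) x)"
  unfolding slope_def using cont_in_time_V2(3)[OF l u_cont] l by auto

lemma continuous_kernel_product:
  assumes "continuous_on {0..T} f" "continuous_on {0..T} g"
  shows "continuous_kernel T (\<lambda>s t. c * f s * g t)"
  unfolding continuous_kernel_def case_prod_beta
  by (intro continuous_intros continuous_on_compose2[OF assms(1)] continuous_on_compose2[OF assms(2)]) auto

lemma kernels:
  "continuous_kernel T (\<lambda>s t. mass (u s) (u t))" "continuous_kernel T (\<lambda>s t. mass (ut s) (u t))"
  "continuous_kernel T (\<lambda>s t. mass (ut s) (ut t))"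
  "continuous_kernel T (\<lambda>s t. stiffness (u s) (u t))" "continuous_kernel T (\<lambda>s t. boundary_damping (u s) (u t))"
proof -
  have "continuous_kernel T (\<lambda>s t. LINT x|\<Omega>. r x * wderiv 0 l 2 (u s) x * wderiv 0 l 2 (u t) x)"
    unfolding continuous_kernel_def
    by (rule continuous_on_L2_kernel[OF r_meas r_abs r1_nonneg cont_in_time_V2(2)[OF l u_cont] cont_in_time_V2(2)[OF l u_cont]])
  then show "continuous_kernel T (\<lambda>s t. stiffness (u s) (u t))"
    unfolding stiffness_def by (intro continuous_kernel_add continuous_kernel_product slope_cont) auto
  show "continuous_kernel T (\<lambda>s t. boundary_damping (u s) (u t))"
    unfolding boundary_damping_def by (intro continuous_kernel_add continuous_kernel_product slope_cont) auto
qed (auto simp: mass_def intro!: mass_kernel cont_in_time_V2(1)[OF l u_cont] ut_cont)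

lemma stiffness_cont:
  assumes "v \<in> V2 0 l"
  shows "continuous_on {0..T} (\<lambda>t. stiffness (u t) v)"
proof -
  have "continuous_kernel T (\<lambda>s t. LINT x|\<Omega>. r x * wderiv 0 l 2 (u s) x * wderiv 0 l 2 v x)"
    unfolding continuous_kernel_def
    by (rule continuous_on_L2_kernel[OF r_meas r_abs r1_nonneg cont_in_time_V2(2)[OF l u_cont] const_cont[OF V2_w2_L2[OF assms]]])
  then have "continuous_on {0..T} (\<lambda>s. LINT x|\<Omega>. r x * wderiv 0 l 2 (u s) x * wderiv 0 l 2 v x)"
    using continuous_kernel_sections(3) by blast
  then show ?thesis
    unfolding stiffness_def by (intro continuous_intros slope_cont) auto
qed

lemma mass_cont:
  assumes "f \<in> cont_in_time T (L2 0 l) (L2_norm 0 l)" "v \<in> L2 0 l"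
  shows "continuous_on {0..T} (\<lambda>t. mass (f t) v)"
  using continuous_kernel_sections(3)[OF mass_kernel[OF assms(1) const_cont[OF assms(2)]]]
  by (simp add: mass_def)

text \<open>Proportionality of \<open>\<mu>\<close> and \<open>m\<close> expresses the viscous term
  by the mass form, so that inertia and damping share one form.\<close>

lemma damped_mass:
  assumes f: "f \<in> L2 0 l" and g: "g \<in> L2 0 l" and v: "v \<in> L2 0 l"
  shows "(LINT x|\<Omega>. m x * f x * v x + \<mu> x * g x * v x) = mass f v + \<gamma> * mass g v"
proof -
  have "(LINT x|\<Omega>. m x * f x * v x + \<mu> x * g x * v x) = (LINT x|\<Omega>. m x * f x * v x + \<gamma> * (m x * g x * v x))"
  proof (rule integral_cong_AE)
    show "AE x in \<Omega>. m x * f x * v x + \<mu> x * g x * v x = m x * f x * v x + \<gamma> * (m x * g x * v x)"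
      using \<mu>_eq by eventually_elim simp
  qed (use m_meas \<mu>_meas f g v in \<open>auto simp: L2_def\<close>)
  also have "\<dots> = mass f v + \<gamma> * mass g v"
    using mass_integrable[OF f v] mass_integrable[OF g v] by (simp add: mass_def)
  finally show ?thesis .
qed

text \<open>The null set of times in \<open>weak_solution\<close> depends on \<open>v\<close>. Both
  sides are continuous in t, so the equation holds at every time; this permits t = 0 and comparison
  of any two times with the test function u(z), z fixed.\<close>

lemma weak_form:
  assumes v: "v \<in> V2 0 l" and t: "t \<in> {0..T}"
  shows "mass (ut t) v + \<gamma> * mass (u t) v + boundary_damping (u t) v + integral {0..t} (\<lambda>\<tau>. stiffness (u \<tau>) v)
    = mass u1 v + \<gamma> * mass u0 v + boundary_damping u0 v"
proof -
  have u0_L2: "u0 \<in> L2 0 l" using u0 by (simp add: H2_def)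
  have "AE t in lebesgue_on {0<..<T}.
        (LINT x|\<Omega>. m x * ut t x * v x + \<mu> x * u t x * v x)
        + kam * trace 0 l (wderiv 0 l 1 (u t)) 0 * trace 0 l (wderiv 0 l 1 v) 0
        + kap * trace 0 l (wderiv 0 l 1 (u t)) l * trace 0 l (wderiv 0 l 1 v) l
        + (LINT \<tau>|lebesgue_on {0<..<t}.
             (LINT x|\<Omega>. r x * wderiv 0 l 2 (u \<tau>) x * wderiv 0 l 2 v x)
             + krm * trace 0 l (wderiv 0 l 1 (u \<tau>)) 0 * trace 0 l (wderiv 0 l 1 v) 0
             + krp * trace 0 l (wderiv 0 l 1 (u \<tau>)) l * trace 0 l (wderiv 0 l 1 v) l)
        = (LINT x|\<Omega>. m x * u1 x * v x + \<mu> x * u0 x * v x)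
          + kam * trace 0 l (wderiv 0 l 1 u0) 0 * trace 0 l (wderiv 0 l 1 v) 0
          + kap * trace 0 l (wderiv 0 l 1 u0) l * trace 0 l (wderiv 0 l 1 v) l"
    using sol v by (simp add: weak_solution_def)
  then have AE1: "AE t in lebesgue_on {0<..<T}.
        (LINT x|\<Omega>. m x * ut t x * v x + \<mu> x * u t x * v x) + boundary_damping (u t) v
        + (LINT \<tau>|lebesgue_on {0<..<t}. stiffness (u \<tau>) v)
        = mass u1 v + \<gamma> * mass u0 v + boundary_damping u0 v"
    unfolding damped_mass[OF u1 u0_L2 V2_L2[OF v]] stiffness_def boundary_damping_def slope_def
    by (simp add: add.assoc)
  have "AE t in lebesgue_on {0<..<T}. t \<in> {0<..<T}"
    by (rule AE_I2) simp
  with AE1 have "AE t in lebesgue_on {0<..<T}.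
      mass (ut t) v + \<gamma> * mass (u t) v + boundary_damping (u t) v + integral {0..t} (\<lambda>\<tau>. stiffness (u \<tau>) v)
    = mass u1 v + \<gamma> * mass u0 v + boundary_damping u0 v"
  proof eventually_elim
    case (elim t)
    then have "t \<in> {0..T}" by simp
    have "continuous_on {0..t} (\<lambda>\<tau>. stiffness (u \<tau>) v)"
      using stiffness_cont[OF v] elim(2) by (auto intro: continuous_on_subset)
    then have "integrable (lebesgue_on {0<..<t}) (\<lambda>\<tau>. stiffness (u \<tau>) v)"
      by (simp add: integrable_open_closed continuous_imp_integrable_real)
    then show ?case
      using elim(1) damped_mass[OF ut_L2 u_L2 V2_L2[OF v], OF \<open>t \<in> {0..T}\<close> \<open>t \<in> {0..T}\<close>]
      by (simp add: integral_open_eq)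
  qed
  from continuous_AE_eq[OF _ _ T this t] show ?thesis
  proof this
    show "continuous_on {0..T} (\<lambda>t. mass (ut t) v + \<gamma> * mass (u t) v + boundary_damping (u t) v + integral {0..t} (\<lambda>\<tau>. stiffness (u \<tau>) v))"
      unfolding boundary_damping_def
      by (intro continuous_intros mass_cont ut_cont cont_in_time_V2(1)[OF l u_cont] V2_L2 v slope_cont
          indefinite_integral_continuous_1 integrable_continuous_real stiffness_cont) auto
  qed simp
qed

text \<open>\<open>weak_solution\<close> prescribes \<open>u1\<close> only through the right-hand
  side of the equation. At t = 0 the time integral vanishes and the terms in \<open>u 0\<close>
  cancel those in \<open>u0\<close>, which leaves m (ut 0 - u1) orthogonal to all test functions; m
  \<ge> m0 > 0 can then be divided out.\<close>

lemma initial_velocity: "AE x in \<Omega>. ut 0 x = u1 x"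
proof -
  have t0: "0 \<in> {0..T}" using T by simp
  have u0_L2: "u0 \<in> L2 0 l" using u0 by (simp add: H2_def)
  note L2 = ut_L2[OF t0] u1
  have slope0: "slope (u 0) = slope u0"
    unfolding slope_def using wderiv_cong_AE[OF l u_init] by simp
  have "AE x in \<Omega>. m x * (ut 0 - u1) x = 0"
  proof (rule fundamental_lemma[OF l])
    show "loc_integrable 0 l (\<lambda>x. m x * (ut 0 - u1) x)"
      by (intro integrable_imp_loc_integrable L2_integrable L2_weight[OF m_meas m_abs] L2_diff L2)
    fix \<phi> assume "\<phi> \<in> test_functions 0 l"
    then have \<phi>: "\<phi> \<in> V2 0 l" by (rule test_function_V2[OF l])
    have "mass (u 0) \<phi> = mass u0 \<phi>"
      unfolding mass_def
      by (rule integral_cong_AE) (use u_init m_meas u_L2[OF t0] u0_L2 V2_L2[OF \<phi>] in \<open>auto simp: L2_def elim: eventually_mono\<close>)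
    then have "mass (ut 0) \<phi> = mass u1 \<phi>"
      using weak_form[OF \<phi> t0] by (simp add: boundary_damping_def slope0)
    moreover have "(LINT x|\<Omega>. m x * (ut 0 - u1) x * \<phi> x) = mass (ut 0) \<phi> - mass u1 \<phi>"
      unfolding mass_def using mass_integrable[OF L2(1) V2_L2[OF \<phi>]] mass_integrable[OF L2(2) V2_L2[OF \<phi>]]
      by (simp add: left_diff_distrib right_diff_distrib)
    ultimately show "(LINT x|\<Omega>. m x * (ut 0 - u1) x * \<phi> x) = 0" by simp
  qed
  then show ?thesis
    using m_bounds by eventually_elim (use m0 in auto)
qed

lemma energy_initial: "energy l m r krm krp (u 0) (ut 0) = energy l m r krm krp u0 u1"
proof -
  have wd: "wderiv 0 l k (u 0) = wderiv 0 l k u0" for k by (rule wderiv_cong_AE[OF l u_init])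
  have "ut 0 \<in> L2 0 l" "wderiv 0 l 2 u0 \<in> L2 0 l"
    using T ut_L2[of 0] wderiv_H2(2)[OF l u0, of 2] by auto
  then have "(LINT x|\<Omega>. m x * (ut 0 x)\<^sup>2 + r x * (wderiv 0 l 2 u0 x)\<^sup>2) =
        (LINT x|\<Omega>. m x * (u1 x)\<^sup>2 + r x * (wderiv 0 l 2 u0 x)\<^sup>2)"
    by (intro integral_cong_AE)
      (use initial_velocity m_meas r_meas u1 in \<open>auto simp: L2_def elim: eventually_mono\<close>)
  then show ?thesis unfolding energy_def wd by simp
qed

section \<open>Energy and quadratic forms\<close>

lemma energy_eq:
  assumes "w \<in> V2 0 l" "z \<in> L2 0 l"
  shows "energy l m r krm krp w z = (mass z z + stiffness w w) / 2"
proof -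
  have "(LINT x|\<Omega>. m x * (z x)\<^sup>2 + r x * (wderiv 0 l 2 w x)\<^sup>2)
      = mass z z + (LINT x|\<Omega>. r x * wderiv 0 l 2 w x * wderiv 0 l 2 w x)"
    using mass_integrable[OF assms(2,2)] stiffness_integrable[OF V2_w2_L2 V2_w2_L2, OF assms(1,1)]
    by (simp add: mass_def power2_eq_square mult.assoc)
  then show ?thesis
    by (simp add: energy_def stiffness_def slope_def power2_eq_square field_simps)
qed

text \<open>Two coefficients are kept because several choices occur: (1, -1) and (1, 0) for
  positivity of the kernels, and (\<beta>0, c) with c = 1 or -1 for the cross term in
  \<open>J\<close>.\<close>

lemma mass_quadratic_nonneg:
  assumes "f \<in> L2 0 l" "g \<in> L2 0 l"
  shows "0 \<le> a\<^sup>2 * mass f f + 2 * (a * b) * mass f g + b\<^sup>2 * mass g g"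
proof -
  have "0 \<le> (LINT x|\<Omega>. m x * (a * f x + b * g x)\<^sup>2)"
    using m_bounds m0 by (intro integral_nonneg_AE) (auto elim!: eventually_mono)
  also have "\<dots> = (LINT x|\<Omega>. a\<^sup>2 * (m x * f x * f x) + 2 * (a * b) * (m x * f x * g x) + b\<^sup>2 * (m x * g x * g x))"
    by (intro Bochner_Integration.integral_cong) (auto simp: power2_eq_square algebra_simps)
  also have "\<dots> = a\<^sup>2 * mass f f + 2 * (a * b) * mass f g + b\<^sup>2 * mass g g"
    using mass_integrable assms by (simp add: mass_def)
  finally show ?thesis .
qed

text \<open>Everything is compared with the norm of v'' by \<open>V2_bounds\<close>, and r \<ge> r0
  bounds that norm by the stiffness. The factor in the first estimate is the square of \<beta>0; the
  second one uses \<gamma> m = \<mu> \<le> \<mu>1, so that \<mu>1 appears as it does in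
  \<beta>1.\<close>

lemma state_bounds:
  assumes v: "v \<in> V2 0 l"
  shows "mass v v \<le> m1 * l ^ 4 / (4 * r0) * stiffness v v"
    and "\<gamma> * mass v v \<le> \<mu>1 * l ^ 4 / (4 * r0) * stiffness v v"
    and "boundary_damping v v \<le> (kam + kap) * l / r0 * stiffness v v"
    and "0 \<le> stiffness v v"
    and "0 \<le> boundary_damping v v"
proof -
  define N where "N = (L2_norm 0 l (wderiv 0 l 2 v))\<^sup>2"
  have w2: "wderiv 0 l 2 v \<in> L2 0 l" by (rule V2_w2_L2[OF v])
  have N0: "0 \<le> N" by (simp add: N_def)
  have "r0 * N = (LINT x|\<Omega>. r0 * (wderiv 0 l 2 v x)\<^sup>2)"
    by (simp add: N_def L2_norm_power2)
  also have "\<dots> \<le> (LINT x|\<Omega>. r x * wderiv 0 l 2 v x * wderiv 0 l 2 v x)"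
  proof (rule integral_mono_AE)
    show "AE x in \<Omega>. r0 * (wderiv 0 l 2 v x)\<^sup>2 \<le> r x * wderiv 0 l 2 v x * wderiv 0 l 2 v x"
      using r_bounds by eventually_elim (auto simp: power2_eq_square mult.assoc intro: mult_right_mono)
  qed (use w2 stiffness_integrable[OF w2 w2] in \<open>auto simp: L2_def\<close>)
  also have "\<dots> \<le> stiffness v v"
    using nonneg by (simp add: stiffness_def mult.assoc)
  finally have N: "r0 * N \<le> stiffness v v" .
  then show S: "0 \<le> stiffness v v" using N0 r0 by (meson mult_nonneg_nonneg less_imp_le order_trans)
  have N': "N \<le> stiffness v v / r0" using N r0 by (simp add: field_simps)
  have v2: "(LINT x|\<Omega>. (v x)\<^sup>2) \<le> l ^ 4 / (4 * r0) * stiffness v v"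
  proof -
    have "(LINT x|\<Omega>. (v x)\<^sup>2) \<le> l ^ 4 / 4 * N"
      using V2_bounds(2)[OF l v] by (simp add: L2_norm_power2 N_def)
    also have "\<dots> \<le> l ^ 4 / 4 * (stiffness v v / r0)" using N' by (intro mult_left_mono) auto
    finally show ?thesis by simp
  qed
  have v_L2: "v \<in> L2 0 l" by (rule V2_L2[OF v])
  have weighted: "(LINT x|\<Omega>. p x * v x * v x) \<le> c * l ^ 4 / (4 * r0) * stiffness v v"
    if "AE x in \<Omega>. p x \<le> c" "integrable \<Omega> (\<lambda>x. p x * v x * v x)" "0 \<le> c" for p and c :: real
  proof -
    have "(LINT x|\<Omega>. p x * v x * v x) \<le> (LINT x|\<Omega>. c * (v x)\<^sup>2)"
    proof (rule integral_mono_AE)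
      show "AE x in \<Omega>. p x * v x * v x \<le> c * (v x)\<^sup>2"
        using that(1) by eventually_elim (auto simp: power2_eq_square mult.assoc intro: mult_right_mono)
    qed (use that v_L2 in \<open>auto simp: L2_def\<close>)
    also have "\<dots> \<le> c * (l ^ 4 / (4 * r0) * stiffness v v)"
      using mult_left_mono[OF v2 that(3)] by simp
    finally show ?thesis by simp
  qed
  show "mass v v \<le> m1 * l ^ 4 / (4 * r0) * stiffness v v"
    unfolding mass_def using m_bounds m1_pos mass_integrable[OF v_L2 v_L2]
    by (intro weighted) (auto elim: eventually_mono)
  have "AE x in \<Omega>. \<gamma> * m x \<le> \<mu>1"
    using \<mu>_eq \<mu>_bounds by eventually_elim simp
  then have "(LINT x|\<Omega>. \<gamma> * m x * v x * v x) \<le> \<mu>1 * l ^ 4 / (4 * r0) * stiffness v v"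
    using mass_integrable[OF v_L2 v_L2] \<mu>1_nonneg by (intro weighted) (auto simp: mult.assoc)
  then show "\<gamma> * mass v v \<le> \<mu>1 * l ^ 4 / (4 * r0) * stiffness v v"
    by (simp add: mass_def mult.assoc)
  show "0 \<le> boundary_damping v v"
    using nonneg by (simp add: boundary_damping_def mult.assoc)
  have slope: "(slope v x)\<^sup>2 \<le> l * (stiffness v v / r0)" if "x \<in> {0..l}" for x
  proof -
    have "(slope v x)\<^sup>2 \<le> l * N" using V2_bounds(1)[OF l v that] by (simp add: slope_def N_def)
    also have "\<dots> \<le> l * (stiffness v v / r0)" using N' l by (intro mult_left_mono) auto
    finally show ?thesis .
  qed
  have "boundary_damping v v = kam * (slope v 0)\<^sup>2 + kap * (slope v l)\<^sup>2"
    by (simp add: boundary_damping_def power2_eq_square mult.assoc)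
  also have "\<dots> \<le> kam * (l * (stiffness v v / r0)) + kap * (l * (stiffness v v / r0))"
    using slope l nonneg by (intro add_mono mult_left_mono) auto
  finally show "boundary_damping v v \<le> (kam + kap) * l / r0 * stiffness v v"
    by (simp add: algebra_simps add_divide_distrib)
qed

lemma boundary_damping_quadratic_nonneg:
  "boundary_damping v v - 2 * boundary_damping v w + boundary_damping w w \<ge> 0"
proof -
  have "boundary_damping v v - 2 * boundary_damping v w + boundary_damping w w =
      kam * (slope v 0 - slope w 0)\<^sup>2 + kap * (slope v l - slope w l)\<^sup>2"
    by (simp add: boundary_damping_def power2_eq_square algebra_simps)
  then show ?thesis using nonneg by simp
qed

text \<open>Time derivatives in \<open>weak_solution\<close> are tested with the unweighted inner
  product; the weight is moved into the test function m f, which is in \<open>L2\<close> because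
  \<open>m\<close> is bounded.\<close>

lemma mass_increments:
  assumes "0 \<le> a" "a \<le> b" "b \<le> T" "f \<in> L2 0 l"
  shows "mass (u b) f - mass (u a) f = integral {a..b} (\<lambda>t. mass (ut t) f)"
proof (rule weak_time_deriv_increment[OF T _ _ _ assms(1-3)])
  have "(\<lambda>x. m x * f x) \<in> L2 0 l" by (rule L2_weight[OF m_meas m_abs assms(4)])
  then have "has_weak_deriv 0 T 1 (\<lambda>t. L2_inner 0 l (u t) (\<lambda>x. m x * f x)) (\<lambda>t. L2_inner 0 l (ut t) (\<lambda>x. m x * f x))"
    using sol by (simp add: weak_solution_def has_time_deriv_def)
  then show "has_weak_deriv 0 T 1 (\<lambda>t. mass (u t) f) (\<lambda>t. mass (ut t) f)"
    by (simp add: L2_inner_def mass_def mult.assoc mult.left_commute)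
qed (intro mass_cont ut_cont cont_in_time_V2(1)[OF l u_cont] assms(4))+

section \<open>The beam as a system of damped kernels\<close>

sublocale damped_kernels T \<gamma> "\<lambda>s t. mass (u s) (u t)" "\<lambda>s t. mass (ut s) (u t)" "\<lambda>s t. mass (ut s) (ut t)"
  "\<lambda>s t. stiffness (u s) (u t)" "\<lambda>s t. boundary_damping (u s) (u t)"
proof
  show "0 \<le> \<gamma>" "0 < T" using nonneg T by auto
  show "continuous_kernel T (\<lambda>s t. mass (ut s) (u t))" "continuous_kernel T (\<lambda>s t. mass (ut s) (ut t))"
    "continuous_kernel T (\<lambda>s t. stiffness (u s) (u t))" by (fact kernels)+
  fix s t assume s: "s \<in> {0..T}" and t: "t \<in> {0..T}"
  show "mass (u s) (u t) = mass (u t) (u s)" "mass (ut s) (ut t) = mass (ut t) (ut s)" by (rule mass_sym)+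
  show "stiffness (u s) (u t) = stiffness (u t) (u s)" by (rule stiffness_sym)
  show "boundary_damping (u s) (u t) = boundary_damping (u t) (u s)" by (rule boundary_damping_sym)
  show "0 \<le> mass (u s) (u s) - 2 * mass (u s) (u t) + mass (u t) (u t)"
    using mass_quadratic_nonneg[OF u_L2[OF s] u_L2[OF t], of 1 "-1"] by simp
  show "0 \<le> boundary_damping (u s) (u s) - 2 * boundary_damping (u s) (u t) + boundary_damping (u t) (u t)"
    by (rule boundary_damping_quadratic_nonneg)
  show "0 \<le> mass (ut t) (ut t)"
    using mass_quadratic_nonneg[OF ut_L2[OF t] ut_L2[OF t], of 1 0] by simp
  show "0 \<le> stiffness (u t) (u t)" by (rule state_bounds(4)[OF u_V2[OF t]])
next
  fix a b z assume ab: "0 \<le> a" "a \<le> b" "b \<le> T" and z: "z \<in> {0..T}"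
  show "mass (u b) (u z) - mass (u a) (u z) = integral {a..b} (\<lambda>x. mass (ut x) (u z))"
    by (rule mass_increments[OF ab u_L2[OF z]])
  \<comment> \<open>The test function is now ut(z), which lies only in \<open>L2\<close>; it is
    admissible because the time derivative of u is tested against all of \<open>L2\<close>.\<close>
  show "mass (ut z) (u b) - mass (ut z) (u a) = integral {a..b} (\<lambda>t. mass (ut z) (ut t))"
    using mass_increments[OF ab ut_L2[OF z]] by (simp add: mass_sym[of "ut z"])
  show "(mass (ut b) (u z) + \<gamma> * mass (u b) (u z) + boundary_damping (u b) (u z)) -
      (mass (ut a) (u z) + \<gamma> * mass (u a) (u z) + boundary_damping (u a) (u z)) =
      - integral {a..b} (\<lambda>x. stiffness (u x) (u z))"
    using weak_form[OF u_V2[OF z], of a] weak_form[OF u_V2[OF z], of b] ab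
      integral_initial_diff[OF stiffness_cont[OF u_V2[OF z]] ab]
    by simp
qed

lemma energy_eq_E: "t \<in> {0..T} \<Longrightarrow> energy l m r krm krp (u t) (ut t) = E t"
  using energy_eq u_V2 ut_L2 by (simp add: E_def)

text \<open>Positivity of the mass form at \<beta>0 ut + u and \<beta>0 ut - u, together with the
  bound of the mass of u by \<beta>0^2 times its stiffness, shows that the cross term is at most
  \<beta>0 E in absolute value. The other two terms of \<open>J\<close> are nonnegative, which
  settles the lower bound; their upper bounds account for the two extra terms of \<beta>1.\<close>

lemma J_bounds:
  assumes \<beta>0: "\<beta>0 = l\<^sup>2 / 2 * sqrt (m1 / r0)"
    and \<beta>1: "\<beta>1 = \<beta>0 * (1 + 1 / sqrt (m1 * r0) * (l\<^sup>2 * \<mu>1 + 2 / l * (kam + kap)))"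
    and t: "t \<in> {0..T}"
  shows "- \<beta>0 * E t \<le> J t" "J t \<le> \<beta>1 * E t"
proof -
  have pos: "0 < \<beta>0" using l m1_pos r0 by (simp add: \<beta>0)
  have \<beta>0_sq: "\<beta>0\<^sup>2 = m1 * l ^ 4 / (4 * r0)"
    using m1_pos r0 by (simp add: \<beta>0 power_mult_distrib power_divide mult.commute)
  define k k1 k12 a b where "k = mass (u t) (u t)" and "k1 = mass (ut t) (u t)" and "k12 = mass (ut t) (ut t)"
    and "a = stiffness (u t) (u t)" and "b = boundary_damping (u t) (u t)"
  note defs = k_def k1_def k12_def a_def b_def
  have E: "E t = (k12 + a) / 2" and J: "J t = k1 + \<gamma> / 2 * k + b / 2" by (simp_all add: E_def J_def defs)
  note sb = state_bounds[OF u_V2[OF t], folded defs]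
  have q: "0 \<le> \<beta>0\<^sup>2 * k12 + 2 * (\<beta>0 * c) * k1 + c\<^sup>2 * k" for c
    unfolding defs by (rule mass_quadratic_nonneg[OF ut_L2[OF t] u_L2[OF t]])
  have k: "k \<le> \<beta>0 * (\<beta>0 * a)" using sb(1) unfolding \<beta>0_sq[symmetric] by (simp add: power2_eq_square mult.assoc)
  have "\<beta>0 * (2 * k1) \<le> \<beta>0 * (\<beta>0 * (k12 + a))" "\<beta>0 * (- 2 * k1) \<le> \<beta>0 * (\<beta>0 * (k12 + a))"
    using q[of 1] q[of "-1"] k by (simp_all add: power2_eq_square algebra_simps)
  then have k1: "2 * k1 \<le> \<beta>0 * (k12 + a)" "- 2 * k1 \<le> \<beta>0 * (k12 + a)"
    using pos mult_le_cancel_left_pos by blast+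
  have k0: "0 \<le> k" using mass_quadratic_nonneg[OF u_L2[OF t] u_L2[OF t], of 1 0] by (simp add: defs)
  have "0 \<le> \<gamma> / 2 * k" using k0 nonneg by simp
  then show "- \<beta>0 * E t \<le> J t"
    using k1(2) sb(5) by (simp add: E J)
  \<comment> \<open>This clears the square roots: \<beta>1 becomes \<beta>0 plus one term for \<mu>1
    and one for the boundary damping.\<close>
  have sqrt_eq: "\<beta>0 / sqrt (m1 * r0) = l\<^sup>2 / (2 * r0)"
    using m1_pos r0 by (simp add: \<beta>0 real_sqrt_divide real_sqrt_mult field_simps)
  have "\<beta>1 = \<beta>0 + \<beta>0 / sqrt (m1 * r0) * (l\<^sup>2 * \<mu>1 + 2 / l * (kam + kap))"
    by (simp add: \<beta>1 algebra_simps)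
  also have "\<dots> = \<beta>0 + \<mu>1 * l ^ 4 / (2 * r0) + (kam + kap) * l / r0"
    unfolding sqrt_eq using l r0 by (simp add: field_simps power2_eq_square power4_eq_xxxx)
  finally have \<beta>1': "\<beta>1 = \<beta>0 + \<mu>1 * l ^ 4 / (2 * r0) + (kam + kap) * l / r0" .
  have "0 \<le> k12" "0 \<le> a" using psd(3,4)[OF t] by (simp_all add: defs)
  have c: "0 \<le> \<mu>1 * l ^ 4 / (2 * r0)" "0 \<le> (kam + kap) * l / r0"
    using \<mu>1_nonneg r0 nonneg l by auto
  \<comment> \<open>\<open>state_bounds\<close> gives half of this constant; the value of \<beta>1
    leaves that room.\<close>
  have "\<gamma> * k \<le> \<mu>1 * l ^ 4 / (2 * r0) * (k12 + a)"
  proof -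
    have "\<gamma> * k \<le> \<mu>1 * l ^ 4 / (2 * r0) * (a / 2)" using sb(2) by simp
    also have "\<dots> \<le> \<mu>1 * l ^ 4 / (2 * r0) * (k12 + a)"
      using c(1) \<open>0 \<le> k12\<close> \<open>0 \<le> a\<close> by (intro mult_left_mono) auto
    finally show ?thesis .
  qed
  moreover have "b \<le> (kam + kap) * l / r0 * (k12 + a)"
    using sb(3) mult_left_mono[OF _ c(2), of a "k12 + a"] \<open>0 \<le> k12\<close> by simp
  ultimately show "J t \<le> \<beta>1 * E t"
    using k1(1) unfolding E J \<beta>1' by (simp add: distrib_right)
qed

lemma J_continuous: "continuous_on {0..T} J"
  unfolding J_def using continuous_kernel_sections(3)[OF _ order_refl] kernels
  by (intro continuous_intros) auto

end

theorem theorem2: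
  fixes l T \<gamma> m0 m1 \<mu>0 \<mu>1 r0 r1 krm kam krp kap \<beta>0 \<beta>1 lam M \<sigma> :: real
    and m \<mu> r u0 u1 :: "real \<Rightarrow> real"
    and u ut :: "real \<Rightarrow> real \<Rightarrow> real"
  assumes "l > 0" and "T > 0"
    and "m \<in> L_infty 0 l" and "\<mu> \<in> L_infty 0 l" and "r \<in> L_infty 0 l"
    and "0 < m0" and "AE x in lebesgue_on {0<..<l}. m0 \<le> m x \<and> m x \<le> m1"
    and "0 \<le> \<mu>0" and "AE x in lebesgue_on {0<..<l}. \<mu>0 \<le> \<mu> x \<and> \<mu> x \<le> \<mu>1"
    and "0 < r0" and "AE x in lebesgue_on {0<..<l}. r0 \<le> r x \<and> r x \<le> r1"
    and "AE x in lebesgue_on {0<..<l}. \<mu> x = \<gamma> * m x"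
    and "u0 \<in> H2 0 l" and "u1 \<in> L2 0 l"
    and "krm \<ge> 0" and "kam \<ge> 0" and "krp \<ge> 0" and "kap \<ge> 0"
    and "\<gamma> \<ge> 0" and "\<gamma> + krm + kam + krp + kap > 0"
    and "r \<in> H2 0 l" and "\<gamma> > 0"
    and "weak_solution l T m \<mu> r krm kam krp kap u0 u1 u ut"
    and "energy l m r krm krp u0 u1 > 0"
    and "\<beta>0 = l\<^sup>2 / 2 * sqrt (m1 / r0)"
    and "\<beta>1 = \<beta>0 * (1 + 1 / sqrt (m1 * r0) * (l\<^sup>2 * \<mu>1 + 2 / l * (kam + kap)))"
    and "0 < lam" and "lam < min (1 / \<beta>0) (\<gamma> * m0 / (2 * m1))"
    and "M = (1 + \<beta>1 * lam) / (1 - \<beta>0 * lam)"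
    and "\<sigma> = 2 * lam / (1 + \<beta>1 * lam)"
  shows "energy l m r krm krp (u 0) (ut 0) = energy l m r krm krp u0 u1 \<and>
    (\<forall>t\<in>{0..T}. energy l m r krm krp (u t) (ut t)
       \<le> M * exp (- \<sigma> * t) * energy l m r krm krp (u 0) (ut 0))"
proof -
  have "AE x in lebesgue_on {0<..<l}. 0 \<le> \<mu> x \<and> \<mu> x \<le> \<mu>1"
    using assms(9) by eventually_elim (use \<open>0 \<le> \<mu>0\<close> in auto)
  moreover have "m \<in> borel_measurable (lebesgue_on {0<..<l})" "\<mu> \<in> borel_measurable (lebesgue_on {0<..<l})"
    "r \<in> borel_measurable (lebesgue_on {0<..<l})"
    using assms(3-5) by (simp_all add: L_infty_def)
  ultimately interpret damped_beam l T \<gamma> m0 m1 \<mu>1 r0 r1 krm kam krp kap m \<mu> r u0 u1 u ut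
    using assms by unfold_locales
  have \<beta>0_pos: "0 < \<beta>0" using l m1_pos r0 by (simp add: assms(25))
  have \<beta>1_nonneg: "0 \<le> \<beta>1"
    using \<beta>0_pos l m1_pos r0 \<mu>1_nonneg nonneg by (simp add: assms(26))
  have "lam < 1 / \<beta>0" and lam2: "lam < \<gamma> * m0 / (2 * m1)" using assms(28) by auto
  then have lam1: "\<beta>0 * lam < 1" using \<beta>0_pos by (simp add: field_simps)
  \<comment> \<open>The ratio m0 / m1 \<le> 1 turns the assumption on \<open>lam\<close> into 2 lam
    \<le> \<gamma>, the form in which \<open>exponential_decay\<close> takes it.\<close>
  have "\<gamma> * m0 / (2 * m1) \<le> \<gamma> / 2"
    using m0_le_m1 m1_pos nonneg by (simp add: field_simps mult_left_mono)
  with lam2 have lam3: "2 * lam \<le> \<gamma>" by simp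
  have "energy l m r krm krp (u t) (ut t) \<le> M * exp (- \<sigma> * t) * energy l m r krm krp (u 0) (ut 0)"
    if t: "t \<in> {0..T}" for t
  proof -
    have "E t \<le> M * exp (- \<sigma> * t) * E 0"
      unfolding assms(29,30)
      using J_bounds[OF assms(25,26)] J_continuous assms(27) lam1 lam3 \<beta>1_nonneg t
      by (rule exponential_decay)
    then show ?thesis using energy_eq_E t T by simp
  qed
  then show ?thesis using energy_initial by blast
qed

end
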